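(* Let $l\ge 1$, let $p_1>\cdots>p_l$ be odd primes with $p_i=2p_{i+1}+1$ for $1\le i\le l-1$, let $n=p_1\cdots p_l$, and write $p_l-1=2^xs$ with $s$ odd. Then the total number of isomorphism types of permutation groups $G$ of degree $n$ which are realised by a Hopf--Galois structure of cyclic type is $$\sum_{I\ni l}2^{l-2|I|}\left(\sum_{k=0}^{l-|I|}\prod_{i=1}^k\frac{2^{l-|I|-(i-1)}-1}{2^i-1}\right)+\sum_{I\not\ni l}2^{l-1-2|I|}\,\Sigma_{l-|I|}\,\sigma_0(s),$$ where $I$ runs over all subsets of $\{2,\ldots,l\}$ (including the empty set) containing no two consecutive integers, the first sum being over those $I$ with $l\in I$ and the second over those with $l\notin I$; $\sigma_0(s)$ is the number of positive divisors of $s$; and for $r\ge1$ $$\Sigma_r:=\sum_{k=0}^{r-1}\left(2^{r-(k+1)}x+1\right)\prod_{i=1}^k\frac{2^{r-i}-1}{2^i-1}.$$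
   Context: Empty products equal $1$. For a finite separable extension $L/K$ of degree $n$ with Galois closure $E$, put $G=\mathrm{Gal}(E/K)$, $G'=\mathrm{Gal}(E/L)$, $X=G/G'$ (left cosets). By Greither--Pareigis, Hopf--Galois structures on $L/K$ correspond bijectively to regular subgroups $N$ of $\mathrm{Perm}(X)$ normalised by $\lambda(G)$, where $\lambda$ is left translation of $G$ on $X$; the isomorphism class of $N$ is the type of the structure. "Cyclic type" means $N\cong C_n$. A transitive permutation group $G$ of degree $n$ (with point stabiliser $G'$) is realised by a Hopf--Galois structure of type $N$ if a separable extension whose pair $(\mathrm{Gal}(E/K),\mathrm{Gal}(E/L))$ is isomorphic to $(G,G')$ admits a Hopf--Galois structure of type $N$; equivalently (Byott's translation) $G$ is isomorphic, as a permutation group, to a subgroup of $\mathrm{Hol}(N)=N\rtimes\mathrm{Aut}(N)$ which is transitive on $N$, where $[\eta,\alpha]\in\mathrm{Hol}(N)$ acts on $N$ by $\mu\mapsto\eta\alpha(\mu)$. Two transitive permutation groups are isomorphic as permutation groups if there is a group isomorphism between them taking a point stabiliser to a point stabiliser. *)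

theory Defs
  imports "HOL-Algebra.Algebra"
begin

section \<open>Galois closures and Galois groups\<close>

text \<open>
  All fields are given inside the field \<open>E\<close>. The condition on the minimal polynomials says that
  \<open>L / K\<close> is separable and that \<open>E\<close> is large enough to contain all conjugates over \<open>K\<close> of the
  elements of \<open>L\<close>; the last conjunct says that \<open>E\<close> is generated by these conjugates (among which
  are the elements of \<open>L\<close> themselves).
\<close>
definition is_galois_closure :: "'u ring \<Rightarrow> 'u set \<Rightarrow> 'u set \<Rightarrow> bool" where
  "is_galois_closure E K L \<longleftrightarrow>
     field E \<and> subfield K E \<and> subfield L E \<and> K \<subseteq> L \<and> ring.finite_dimension E K L \<and>
     (\<forall>x\<in>L. ring.splitted E (ring.Irr E K x) \<and>
            (\<forall>a\<in>carrier E. count (ring.roots E (ring.Irr E K x)) a \<le> 1)) \<and>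
     generate_field E (\<Union>x\<in>L. {a \<in> carrier E. ring.is_root E (ring.Irr E K x) a}) = carrier E"

definition galois_group :: "'u ring \<Rightarrow> 'u set \<Rightarrow> ('u \<Rightarrow> 'u) monoid" where
  "galois_group E K =
     BijGroup (carrier E)
       \<lparr>carrier := {\<sigma> \<in> Bij (carrier E). \<sigma> \<in> ring_hom E E \<and> (\<forall>a\<in>K. \<sigma> a = a)}\<rparr>"


section \<open>Hopf-Galois structures, in the form given by the Greither-Pareigis theorem\<close>

definition left_translation :: "('g, 'm) monoid_scheme \<Rightarrow> 'g set \<Rightarrow> 'g \<Rightarrow> 'g set \<Rightarrow> 'g set" where
  "left_translation G H g = (\<lambda>C\<in>lcosets\<^bsub>G\<^esub> H. g <#\<^bsub>G\<^esub> C)"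

definition regular_on :: "('x \<Rightarrow> 'x) set \<Rightarrow> 'x set \<Rightarrow> bool" where
  "regular_on N Y \<longleftrightarrow> (\<forall>x\<in>Y. \<forall>y\<in>Y. \<exists>!f \<in> N. f x = y)"

definition greither_pareigis_subgroup ::
    "('g, 'm) monoid_scheme \<Rightarrow> 'g set \<Rightarrow> ('g set \<Rightarrow> 'g set) set \<Rightarrow> bool" where
  "greither_pareigis_subgroup G H N \<longleftrightarrow>
     (let Y = lcosets\<^bsub>G\<^esub> H; P = BijGroup Y; \<tau> = left_translation G H in
      subgroup N P \<and> regular_on N Y \<and>
      (\<forall>g\<in>carrier G. \<forall>f\<in>N. \<tau> g \<otimes>\<^bsub>P\<^esub> f \<otimes>\<^bsub>P\<^esub> inv\<^bsub>P\<^esub> (\<tau> g) \<in> N))"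

text \<open>
  The extension \<open>L / K\<close> with Galois closure \<open>E\<close> admits a Hopf-Galois structure whose type is the
  isomorphism class of \<open>T\<close>. A Hopf-Galois structure is represented by the regular subgroup of
  \<open>Perm(G/G')\<close> to which it corresponds.
\<close>
definition admits_hopf_galois_structure ::
    "'u ring \<Rightarrow> 'u set \<Rightarrow> 'u set \<Rightarrow> 't monoid \<Rightarrow> bool" where
  "admits_hopf_galois_structure E K L T \<longleftrightarrow>
     (let G = galois_group E K; G' = carrier (galois_group E L) in
      \<exists>N. greither_pareigis_subgroup G G' N \<and>
          BijGroup (lcosets\<^bsub>G\<^esub> G') \<lparr>carrier := N\<rparr> \<cong> T)"


section \<open>Permutation groups\<close>

definition perm_group :: "nat \<Rightarrow> (nat \<Rightarrow> nat) set \<Rightarrow> (nat \<Rightarrow> nat) monoid" where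
  "perm_group n G = sym_group n \<lparr>carrier := G\<rparr>"

definition transitive_perm_group :: "nat \<Rightarrow> (nat \<Rightarrow> nat) set \<Rightarrow> bool" where
  "transitive_perm_group n G \<longleftrightarrow>
     subgroup G (sym_group n) \<and> (\<forall>x\<in>{1..n}. \<forall>y\<in>{1..n}. \<exists>g\<in>G. g x = y)"

abbreviation point_stabiliser :: "nat \<Rightarrow> (nat \<Rightarrow> nat) set \<Rightarrow> nat \<Rightarrow> (nat \<Rightarrow> nat) set" where
  "point_stabiliser n G x \<equiv> stabilizer (perm_group n G) (\<lambda>g. g) x"

definition pair_iso ::
    "('a, 'm) monoid_scheme \<Rightarrow> 'a set \<Rightarrow> ('b, 'k) monoid_scheme \<Rightarrow> 'b set \<Rightarrow> bool" where
  "pair_iso G G' H H' \<longleftrightarrow> (\<exists>\<phi>\<in>iso G H. \<phi> ` G' = H')"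

definition perm_iso_rel :: "nat \<Rightarrow> ((nat \<Rightarrow> nat) set \<times> (nat \<Rightarrow> nat) set) set" where
  "perm_iso_rel n =
     {(G, H). transitive_perm_group n G \<and> transitive_perm_group n H \<and>
        (\<exists>x\<in>{1..n}. \<exists>y\<in>{1..n}.
           pair_iso (perm_group n G) (point_stabiliser n G x)
                    (perm_group n H) (point_stabiliser n H y))}"

text \<open>
  \<open>HOL\<close> cannot quantify existentially over the type of the field elements, so the universe \<open>'u\<close>
  in which the fields live is a parameter. Every pair \<open>(Gal(E/K), Gal(E/L))\<close> already occurs with a
  countable \<open>E\<close>, so the notion does not depend on \<open>'u\<close> as long as \<open>'u\<close> is infinite.
\<close>
definition realised_by_hopf_galois ::
    "'u itself \<Rightarrow> nat \<Rightarrow> (nat \<Rightarrow> nat) set \<Rightarrow> 't monoid \<Rightarrow> bool" where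
  "realised_by_hopf_galois u n G T \<longleftrightarrow>
     (\<exists>(E :: 'u ring) K L. \<exists>x\<in>{1..n}.
        is_galois_closure E K L \<and>
        pair_iso (perm_group n G) (point_stabiliser n G x)
                 (galois_group E K) (carrier (galois_group E L)) \<and>
        admits_hopf_galois_structure E K L T)"

definition realised_perm_groups :: "'u itself \<Rightarrow> nat \<Rightarrow> 't monoid \<Rightarrow> (nat \<Rightarrow> nat) set set" where
  "realised_perm_groups u n T =
     {G. transitive_perm_group n G \<and> realised_by_hopf_galois u n G T}"

definition num_realised_types :: "'u itself \<Rightarrow> nat \<Rightarrow> 't monoid \<Rightarrow> nat" where
  "num_realised_types u n T = card (realised_perm_groups u n T // perm_iso_rel n)"


section \<open>The counting formula\<close>

definition index_sets :: "nat \<Rightarrow> nat set set" where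
  "index_sets l = {I. I \<subseteq> {2..l} \<and> (\<forall>i. \<not> (i \<in> I \<and> Suc i \<in> I))}"

definition num_divisors :: "nat \<Rightarrow> nat" where
  "num_divisors s = card {d. d dvd s}"

definition Sigma_coeff :: "nat \<Rightarrow> nat \<Rightarrow> rat" where
  "Sigma_coeff x r =
     (\<Sum>k=0..r - 1. (2 ^ (r - (k + 1)) * of_nat x + 1) *
                    (\<Prod>i=1..k. (2 ^ (r - i) - 1) / (2 ^ i - 1)))"

text \<open>
  The truncated subtractions in the exponents are harmless: an index set \<open>I\<close> without consecutive
  elements satisfies \<open>2 * card I \<le> l\<close>, and even \<open>2 * card I \<le> l - 1\<close> if \<open>l \<notin> I\<close>.
\<close>
definition type_count_formula :: "nat \<Rightarrow> nat \<Rightarrow> nat \<Rightarrow> rat" where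
  "type_count_formula l x s =
     (\<Sum>I\<in>{I \<in> index_sets l. l \<in> I}.
        2 ^ (l - 2 * card I) *
        (\<Sum>k=0..l - card I. \<Prod>i=1..k. (2 ^ (l - card I - (i - 1)) - 1) / (2 ^ i - 1)))
     + (\<Sum>I\<in>{I \<in> index_sets l. l \<notin> I}.
        2 ^ (l - 1 - 2 * card I) * Sigma_coeff x (l - card I) * of_nat (num_divisors s))"

end

theory Submission
  imports Defs "HOL-Library.Poly_Mapping" "HOL-Computational_Algebra.Fraction_Field"
    "HOL-Computational_Algebra.Squarefree" "HOL-Number_Theory.Number_Theory"
begin

text \<open>
  Let \<open>\<int>/n\<close> be represented by \<open>{1..n}\<close>. A transitive group of degree \<open>n\<close> is realised with cyclic type if and
  only if it is conjugate to a group of affine permutations \<open>i \<mapsto> a * i + t\<close> (\<open>realised_perm_groups_cyclic\<close>).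
  Indeed, a regular cyclic group on the cosets \<open>G/G'\<close> identifies them with \<open>\<int>/n\<close>, and what normalises it becomes
  affine; conversely, the translations are a regular cyclic group normalised by all affine permutations. The
  converse also needs an extension having the given group as the group of its Galois closure. Such an extension
  arises by letting the group permute the variables of a field of rational functions (Artin's theorem); this
  field is countable, hence has a copy inside any infinite type (\<open>transitive_group_is_galois_group\<close>).

  For squarefree \<open>n\<close> a transitive group of affine permutations is described by a divisor \<open>d\<close> of \<open>n\<close> and a
  subgroup \<open>H\<close> of the units modulo \<open>n\<close>: its translations are those by multiples of \<open>d\<close>, and \<open>H\<close> consists of its
  multipliers \<open>a\<close>. Modulo a prime divisor of \<open>d\<close> all multipliers are \<open>1\<close>, as otherwise the group would fix a
  residue class of that prime. Hence the translation part modulo \<open>d\<close> is a surjective homomorphism \<open>\<phi>\<close> from \<open>H\<close>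
  to \<open>\<int>/d\<close> (\<open>transitive_affine_group_datum\<close>), and \<open>d\<close> divides the order of \<open>H\<close>. If \<open>d\<close> is prime to the cofactor
  of \<open>d\<close> in that order, then such a \<open>\<phi>\<close> exists (\<open>affine_datum_exists\<close>) and is unique up to a unit factor, which
  only replaces the group by a conjugate (\<open>same_datum_conjugate\<close>). Conversely \<open>d\<close> and \<open>H\<close> can be read off from
  the abstract group: a prime divisor \<open>q\<close> of \<open>n\<close> does not divide \<open>d\<close> if and only if there is a normal subgroup
  of order \<open>q\<close>, and conjugation on it shows the multipliers modulo \<open>q\<close> (\<open>datum_eq_if_conjugate\<close>). So the classes
  are counted by the pairs \<open>(d, H)\<close> (\<open>num_realised_types_eq_card_pairs\<close>).

  Since \<open>H\<close> is trivial modulo \<open>d\<close>, the pairs with a given \<open>d\<close> correspond to the subgroups of the units modulo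
  \<open>n / d\<close> whose order is divisible by \<open>d\<close>. Let \<open>d\<close> be the product of the \<open>p i\<close> with \<open>i \<in> D\<close>. In the chain, \<open>p j\<close>
  divides \<open>p i - 1\<close> only for \<open>j = i + 1\<close>, and then exactly once. So there is no such subgroup unless \<open>i - 1 \<ge> 1\<close>
  and \<open>i - 1 \<notin> D\<close> for all \<open>i \<in> D\<close>; this is the condition on the index sets of the formula. If it holds, the
  units modulo \<open>n / d\<close> are a product of cyclic groups of order \<open>2 * p (i + 1)\<close>, one for each \<open>i < l\<close> outside
  \<open>D\<close>, and, if \<open>l \<notin> D\<close>, one of order \<open>2 ^ x * s\<close>. The subgroup may be chosen separately in each primary part.
  For \<open>j \<in> D\<close> the \<open>p j\<close>-part must be everything, every other \<open>p j\<close> dividing the order leaves two choices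
  (\<open>fibre_card_eq\<close>), and the cyclic part of order \<open>s\<close> has as many subgroups as \<open>s\<close> has divisors. The 2-part is
  elementary abelian if \<open>l \<in> D\<close>, and its subgroups are counted by Gaussian binomial coefficients
  (\<open>card_subgroups_elementary\<close>); otherwise it is the product of an elementary abelian group and a cyclic group
  of order \<open>2 ^ x\<close> (\<open>card_subgroups_elementary_times_cyclic\<close>). Summation over \<open>D\<close> gives the formula.
\<close>

section \<open>Subgroups of finite groups\<close>

text \<open>In a finite group inverses are powers.\<close>
lemma (in group) finite_subgroupI:
  assumes fin: "finite (carrier G)" and S: "S \<subseteq> carrier G" "S \<noteq> {}"
    and mult: "\<And>a b. a \<in> S \<Longrightarrow> b \<in> S \<Longrightarrow> a \<otimes> b \<in> S"
  shows "subgroup S G"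
proof (rule subgroupI)
  fix a assume a: "a \<in> S"
  then have ac: "a \<in> carrier G" using S(1) by blast
  have pow: "a [^] Suc k \<in> S" for k
  proof (induction k)
    case 0
    show ?case using a ac by simp
  next
    case (Suc k)
    show ?case using mult[OF Suc a] by (simp only: nat_pow_Suc)
  qed
  have "order G > 0" using fin order_gt_0_iff_finite by blast
  then have e: "Suc (Suc (2 * order G - 2)) = order G * 2" by simp
  have "a [^] Suc (2 * order G - 2) \<otimes> a = a [^] (order G * 2)" unfolding e[symmetric] by (simp only: nat_pow_Suc)
  also have "\<dots> = \<one>" using pow_order_eq_1[OF ac] ac by (simp add: nat_pow_pow[symmetric] nat_pow_one)
  finally have "inv a = a [^] Suc (2 * order G - 2)" using inv_equality pow S(1) ac by blast
  then show "inv a \<in> S" using pow by simp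
qed (use S mult in auto)

section \<open>Polynomials with prescribed roots\<close>

definition (in ring) poly_with_roots :: "'a list \<Rightarrow> 'a list" where
  "poly_with_roots as = foldr (\<otimes>\<^bsub>poly_ring R\<^esub>) (map (\<lambda>a. [\<one>, \<ominus> a]) as) \<one>\<^bsub>poly_ring R\<^esub>"

context field
begin

lemma poly_with_roots_Nil: "poly_with_roots [] = [\<one>]"
  by (simp add: poly_with_roots_def univ_poly_one)

lemma poly_with_roots_Cons:
  "poly_with_roots (a # as) = [\<one>, \<ominus> a] \<otimes>\<^bsub>poly_ring R\<^esub> poly_with_roots as"
  by (simp add: poly_with_roots_def)

lemma linear_in_poly_ring: "a \<in> carrier R \<Longrightarrow> [\<one>, \<ominus> a] \<in> carrier (poly_ring R)"
  unfolding univ_poly_carrier[symmetric] polynomial_def by simp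

lemma poly_with_roots_props:
  assumes "set as \<subseteq> carrier R"
  shows "poly_with_roots as \<in> carrier (poly_ring R)" "poly_with_roots as \<noteq> []"
    "roots (poly_with_roots as) = mset as" "degree (poly_with_roots as) = length as"
proof -
  interpret UP: domain "poly_ring R"
    using univ_poly_is_domain[OF carrier_is_subring] .
  have "poly_with_roots as \<in> carrier (poly_ring R) \<and> poly_with_roots as \<noteq> []
    \<and> roots (poly_with_roots as) = mset as \<and> degree (poly_with_roots as) = length as"
    using assms
  proof (induction as)
    case Nil
    have "[\<one>] \<in> carrier (poly_ring R)"
      using UP.one_closed by (simp add: univ_poly_one)
    then show ?case
      using degree_zero_imp_empty_roots[of "[\<one>]"] by (simp add: poly_with_roots_Nil)
  next
    case (Cons a as)
    let ?p = "poly_with_roots as"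
    have a: "a \<in> carrier R" and p: "?p \<in> carrier (poly_ring R)" "?p \<noteq> []"
      "roots ?p = mset as" "degree ?p = length as"
      using Cons by auto
    have c: "poly_with_roots (a # as) \<in> carrier (poly_ring R)"
      using p(1) linear_in_poly_ring[OF a] by (simp add: poly_with_roots_Cons)
    have nz: "poly_with_roots (a # as) \<noteq> []"
      using UP.integral[OF _ linear_in_poly_ring[OF a] p(1)] p(2)
      by (auto simp: poly_with_roots_Cons univ_poly_zero)
    have r: "roots (poly_with_roots (a # as)) = add_mset a (mset as)"
      using poly_mult_degree_one_monic_imp_same_roots[OF a p(1,2)] p(3)
      by (simp add: poly_with_roots_Cons)
    have len: "length ?p = Suc (length as)" using p(2,4) by (cases ?p) auto
    have d: "degree (poly_with_roots (a # as)) = length (a # as)"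
      using poly_mult_degree_eq[OF carrier_is_subring, of "[\<one>, \<ominus> a]" ?p]
        linear_in_poly_ring[OF a] p len
      by (simp add: poly_with_roots_Cons univ_poly_mult univ_poly_carrier del: poly_mult.simps)
    show ?case using c nz r d by simp
  qed
  then show "poly_with_roots as \<in> carrier (poly_ring R)" "poly_with_roots as \<noteq> []"
    "roots (poly_with_roots as) = mset as" "degree (poly_with_roots as) = length as"
    by auto
qed

lemma splitted_poly_with_roots:
  "set as \<subseteq> carrier R \<Longrightarrow> splitted (poly_with_roots as)"
  unfolding splitted_def using poly_with_roots_props(3,4)[of as] by simp

lemma poly_with_roots_mset_cong:
  assumes "set as \<subseteq> carrier R" "mset as = mset bs"
  shows "poly_with_roots as = poly_with_roots bs"
proof -
  interpret UP: domain "poly_ring R"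
    using univ_poly_is_domain[OF carrier_is_subring] .
  show ?thesis
    unfolding poly_with_roots_def using assms linear_in_poly_ring
    by (intro UP.multlist_perm_cong) auto
qed

lemma map_poly_with_roots:
  assumes "h \<in> ring_hom R R" "set as \<subseteq> carrier R"
  shows "map h (poly_with_roots as) = poly_with_roots (map h as)"
  using assms(2)
proof (induction as)
  case Nil
  then show ?case using ring_hom_one[OF assms(1)] by (simp add: poly_with_roots_Nil)
next
  case (Cons a as)
  interpret h: ring_hom_ring R R h
    using ring_hom_ringI2[OF is_ring is_ring assms(1)] .
  interpret UP: domain "poly_ring R"
    using univ_poly_is_domain[OF carrier_is_subring] .
  have a: "a \<in> carrier R" and as: "set as \<subseteq> carrier R" using Cons by auto
  have p: "poly_with_roots as \<in> carrier (poly_ring R)" and ap: "poly_with_roots (a # as) \<in> carrier (poly_ring R)"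
    using poly_with_roots_props(1)[OF as] poly_with_roots_props(1)[of "a # as"] a as by auto
  have sub: "q \<in> carrier (poly_ring R) \<Longrightarrow> set q \<subseteq> carrier R" for q
    using polynomial_incl univ_poly_carrier by blast
  have "map h (poly_with_roots (a # as)) \<in> carrier (poly_ring R)"
    by (rule polynomial_hom[OF assms(1) field_axioms field_axioms ap])
  then have "normalize (map h (poly_with_roots (a # as))) = map h (poly_with_roots (a # as))"
    using normalize_polynomial by (simp add: univ_poly_carrier)
  moreover have "normalize (map h (poly_mult [\<one>, \<ominus> a] (poly_with_roots as)))
      = poly_mult (map h [\<one>, \<ominus> a]) (map h (poly_with_roots as))"
    using sub[OF p] sub[OF linear_in_poly_ring[OF a]] by (intro h.poly_mult_hom') auto
  ultimately show ?case
    using Cons a by (simp add: poly_with_roots_Cons univ_poly_mult del: poly_mult.simps)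
qed

lemma eval_poly_with_roots:
  assumes "set as \<subseteq> carrier R" "b \<in> carrier R"
  shows "eval (poly_with_roots as) b = \<zero> \<longleftrightarrow> b \<in> set as"
proof -
  have "is_root (poly_with_roots as) b \<longleftrightarrow> b \<in># roots (poly_with_roots as)"
    using roots_mem_iff_is_root poly_with_roots_props(1)[OF assms(1)] by blast
  then show ?thesis
    using poly_with_roots_props[OF assms(1)] assms(2) by (simp add: is_root_def)
qed

end

section \<open>Fixed fields and Galois closures\<close>

locale automorphism_set = field E for E :: "'a ring" (structure) +
  fixes \<Gamma> :: "('a \<Rightarrow> 'a) set"
  assumes hom: "\<gamma> \<in> \<Gamma> \<Longrightarrow> \<gamma> \<in> ring_hom E E"
begin

definition fixed :: "'a set" where
  "fixed = {a \<in> carrier E. \<forall>\<gamma>\<in>\<Gamma>. \<gamma> a = a}"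

lemma a_inv_fixed: "\<gamma> \<in> \<Gamma> \<Longrightarrow> a \<in> carrier E \<Longrightarrow> \<gamma> (\<ominus> a) = \<ominus> \<gamma> a"
proof -
  assume "\<gamma> \<in> \<Gamma>" "a \<in> carrier E"
  then interpret h: ring_hom_ring E E \<gamma> by (intro ring_hom_ringI2 is_ring hom)
  show ?thesis using \<open>a \<in> carrier E\<close> by simp
qed

lemma subfield_fixed: "subfield fixed E"
proof (rule subfieldI')
  show "subring fixed E"
    unfolding fixed_def
    by (rule subringI)
      (auto simp: ring_hom_one[OF hom] ring_hom_mult[OF hom] ring_hom_add[OF hom]
        a_inv_fixed, metis+)
next
  fix k assume k: "k \<in> fixed - {\<zero>}"
  then have kc: "k \<in> carrier E" "k \<noteq> \<zero>" by (auto simp: fixed_def)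
  then have inv: "inv k \<in> carrier E" "inv k \<otimes> k = \<one>"
    by (auto simp: field_Units)
  have "\<gamma> (inv k) = inv k" if g: "\<gamma> \<in> \<Gamma>" for \<gamma>
  proof -
    have gk: "\<gamma> k = k" using k g by (auto simp: fixed_def)
    have "\<gamma> (inv k) \<otimes> k = \<one>"
      using ring_hom_mult[OF hom[OF g] inv(1) kc(1)] inv(2) ring_hom_one[OF hom[OF g]] gk by simp
    moreover have "\<gamma> (inv k) \<in> carrier E" using ring_hom_closed[OF hom[OF g] inv(1)] .
    ultimately show ?thesis
      using inv kc m_rcancel[of k "\<gamma> (inv k)" "inv k"] by simp
  qed
  then show "inv k \<in> fixed" using inv by (simp add: fixed_def)
qed

text \<open>As \<open>\<Gamma>\<close> permutes \<open>S\<close>, it permutes the linear factors of the product of all \<open>X - b\<close> for \<open>b \<in> S\<close>, so the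
  coefficients of this product are fixed.\<close>
lemma invariant_root_poly:
  assumes S: "finite S" "S \<subseteq> carrier E" "\<And>\<gamma>. \<gamma> \<in> \<Gamma> \<Longrightarrow> inj_on \<gamma> S \<and> \<gamma> ` S \<subseteq> S"
  obtains p where "p \<in> carrier (poly_ring E)" "p \<in> carrier (fixed[X])" "p \<noteq> []"
    "splitted p" "roots p = mset_set S" "\<And>b. b \<in> carrier E \<Longrightarrow> eval p b = \<zero> \<longleftrightarrow> b \<in> S"
proof -
  obtain as where as: "set as = S" "distinct as" using finite_distinct_list[OF S(1)] by blast
  let ?p = "poly_with_roots as"
  have asc: "set as \<subseteq> carrier E" using as S(2) by simp
  have pc: "?p \<in> carrier (poly_ring E)" using poly_with_roots_props(1)[OF asc] .
  have fix_p: "map \<gamma> ?p = ?p" if g: "\<gamma> \<in> \<Gamma>" for \<gamma>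
  proof -
    have "\<gamma> ` S = S" using S(1) S(3)[OF g] by (simp add: endo_inj_surj)
    then have "mset (map \<gamma> as) = mset as"
      using as S(3)[OF g] by (intro set_eq_iff_mset_eq_distinct[THEN iffD1]) (auto simp: distinct_map)
    then show ?thesis
      using map_poly_with_roots[OF hom[OF g] asc] poly_with_roots_mset_cong[OF asc] by metis
  qed
  have sub: "set ?p \<subseteq> carrier E"
    using pc polynomial_incl univ_poly_carrier by blast
  have "set ?p \<subseteq> fixed"
    using fix_p sub unfolding fixed_def
    by (auto simp: map_eq_conv intro: list.map_cong) (metis map_idI map_eq_conv list.map_ident)
  moreover have "lead_coeff ?p \<noteq> \<zero>"
    using pc poly_with_roots_props(2)[OF asc] unfolding univ_poly_carrier[symmetric] polynomial_def by auto
  ultimately have "?p \<in> carrier (fixed[X])"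
    unfolding univ_poly_carrier[symmetric] polynomial_def by auto
  moreover have "roots ?p = mset_set S"
    using poly_with_roots_props(3)[OF asc] as mset_set_set by metis
  ultimately show ?thesis
    using that[OF pc] poly_with_roots_props[OF asc] splitted_poly_with_roots[OF asc]
      eval_poly_with_roots[OF asc] as by blast
qed

text \<open>An endomorphism over the fixed field maps a root of a polynomial with fixed coefficients to a root.\<close>
lemma moved_within_invariant_set:
  assumes S: "finite S" "S \<subseteq> carrier E" "\<And>\<gamma>. \<gamma> \<in> \<Gamma> \<Longrightarrow> inj_on \<gamma> S \<and> \<gamma> ` S \<subseteq> S"
    and \<psi>: "\<psi> \<in> ring_hom E E" "\<And>a. a \<in> fixed \<Longrightarrow> \<psi> a = a" and b: "b \<in> S"
  shows "\<psi> b \<in> S"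
proof -
  obtain p where p: "p \<in> carrier (poly_ring E)" "p \<in> carrier (fixed[X])"
    "\<And>b. b \<in> carrier E \<Longrightarrow> eval p b = \<zero> \<longleftrightarrow> b \<in> S"
    using invariant_root_poly[OF S] by metis
  interpret h: ring_hom_ring E E \<psi> using ring_hom_ringI2[OF is_ring is_ring \<psi>(1)] .
  have bc: "b \<in> carrier E" using b S(2) by auto
  have "set p \<subseteq> fixed" using p(2) unfolding univ_poly_carrier[symmetric] polynomial_def by auto
  then have "map \<psi> p = p" using \<psi>(2) by (auto intro: map_idI)
  moreover have "\<psi> (eval p b) = eval (map \<psi> p) (\<psi> b)"
    by (rule h.eval_hom[OF carrier_is_subring bc p(1)])
  ultimately have "eval p (\<psi> b) = \<zero>" using p(3)[OF bc] b by simp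
  then show ?thesis using p(3)[of "\<psi> b"] ring_hom_closed[OF \<psi>(1) bc] by simp
qed

text \<open>The minimal polynomial divides the polynomial with the elements of \<open>S\<close> as simple roots, from which it
  inherits that it splits and is separable.\<close>
lemma Irr_of_invariant_set:
  assumes S: "finite S" "S \<subseteq> carrier E" "\<And>\<gamma>. \<gamma> \<in> \<Gamma> \<Longrightarrow> inj_on \<gamma> S \<and> \<gamma> ` S \<subseteq> S" and b: "b \<in> S"
  shows "(algebraic over fixed) b" "splitted (Irr fixed b)" "count (roots (Irr fixed b)) a \<le> 1"
    "Irr fixed b \<in> carrier (fixed[X])" "is_root (Irr fixed b) b"
proof -
  obtain p where p: "p \<in> carrier (poly_ring E)" "p \<in> carrier (fixed[X])" "p \<noteq> []" "splitted p" "roots p = mset_set S"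
    "\<And>b. b \<in> carrier E \<Longrightarrow> eval p b = \<zero> \<longleftrightarrow> b \<in> S"
    using invariant_root_poly[OF S] by metis
  have bc: "b \<in> carrier E" using b S(2) by auto
  have ev: "eval p b = \<zero>" using p(6)[OF bc] b by simp
  show alg: "(algebraic over fixed) b" using algebraicI[OF p(2,3) ev] unfolding over_def .
  have div: "Irr fixed b pdivides p"
    by (rule Irr_minimal[OF subfield_fixed bc alg p(2) ev])
  have I: "Irr fixed b \<in> carrier (fixed[X])" "pirreducible fixed (Irr fixed b)" "eval (Irr fixed b) b = \<zero>"
    using IrrE[OF subfield_fixed bc alg] by auto
  show "Irr fixed b \<in> carrier (fixed[X])" by (rule I(1))
  have Ic: "Irr fixed b \<in> carrier (poly_ring E)"
    using carrier_polynomial_shell[OF subfieldE(1)[OF subfield_fixed] I(1)] .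
  have "Irr fixed b \<noteq> []" using pirreducibleE(1)[OF subfieldE(1)[OF subfield_fixed] I(1,2)] .
  then show "is_root (Irr fixed b) b" using I(3) bc by (simp add: is_root_def)
  show "splitted (Irr fixed b)" using pdivides_imp_splitted[OF Ic p(1,3,4) div] .
  have "count (roots (Irr fixed b)) a \<le> count (mset_set S) a"
    using pdivides_imp_roots_incl[OF Ic p(1,3) div] p(5) by (metis mset_subset_eq_count)
  also have "\<dots> \<le> 1" using S(1) by (simp add: count_mset_set')
  finally show "count (roots (Irr fixed b)) a \<le> 1" .
qed

end

text \<open>To be thought of as a field of rational functions in infinitely many variables \<open>x i\<close>, on which
  permutations of \<open>{1..n}\<close> act by substitution. The element \<open>\<theta>\<close> is one that no two permutations move in the same
  way.\<close>
locale permuted_generators = field E for E :: "'a ring" (structure) +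
  fixes n :: nat and x :: "nat \<Rightarrow> 'a" and act :: "(nat \<Rightarrow> nat) \<Rightarrow> 'a \<Rightarrow> 'a" and \<theta> :: 'a
  assumes x_carrier: "x i \<in> carrier E"
    and generated: "generate_field E (range x) = carrier E"
    and act_hom: "\<pi> permutes {1..n} \<Longrightarrow> act \<pi> \<in> ring_hom E E"
    and act_x: "\<pi> permutes {1..n} \<Longrightarrow> act \<pi> (x i) = x (\<pi> i)"
    and theta: "\<theta> \<in> carrier E"
    and theta_inj: "\<pi> permutes {1..n} \<Longrightarrow> \<rho> permutes {1..n} \<Longrightarrow> act \<pi> \<theta> = act \<rho> \<theta> \<Longrightarrow> \<pi> = \<rho>"
    and x_inj: "inj x"
begin

lemma hom_eqI:
  assumes "f \<in> ring_hom E E" "g \<in> ring_hom E E" "\<And>i. f (x i) = g (x i)" "a \<in> carrier E"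
  shows "f a = g a"
proof -
  interpret f: ring_hom_ring E E f using ring_hom_ringI2[OF is_ring is_ring assms(1)] .
  interpret g: ring_hom_ring E E g using ring_hom_ringI2[OF is_ring is_ring assms(2)] .
  have "a \<in> generate_field E (range x)" using assms(4) generated by simp
  then have "a \<in> carrier E \<and> f a = g a"
  proof (induction rule: generate_field.induct)
    case (m_inv h)
    have h: "h \<in> carrier E" "h \<noteq> \<zero>" "f h = g h" using m_inv by auto
    then have i: "inv h \<in> carrier E" "inv h \<otimes> h = \<one>" by (auto simp: field_Units)
    have fi: "f (inv h) \<otimes> f h = \<one>"
      using f.hom_mult[OF i(1) h(1)] unfolding i(2) by simp
    have gi: "g (inv h) \<otimes> f h = \<one>"
      using g.hom_mult[OF i(1) h(1)] h(3) unfolding i(2) by simp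
    have "f h \<noteq> \<zero>" using gi g.hom_closed[OF i(1)] by (metis r_null one_not_zero)
    then have "f (inv h) = g (inv h)"
      using fi gi m_rcancel[of "f h" "f (inv h)" "g (inv h)"] i h by simp
    then show ?case using i by simp
  qed (use x_carrier assms(3) in auto)
  then show ?thesis by simp
qed

lemma act_id: "a \<in> carrier E \<Longrightarrow> act id a = a"
  using hom_eqI[OF act_hom[OF permutes_id] id_ring_hom, of a] act_x[OF permutes_id] by simp

lemma act_comp:
  assumes "\<pi> permutes {1..n}" "\<rho> permutes {1..n}" "a \<in> carrier E"
  shows "act (\<pi> \<circ> \<rho>) a = act \<pi> (act \<rho> a)"
proof -
  have p: "\<pi> \<circ> \<rho> permutes {1..n}" using permutes_compose assms by blast
  have "act \<pi> \<circ> act \<rho> \<in> ring_hom E E"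
    by (rule ring_hom_trans[OF act_hom[OF assms(2)] act_hom[OF assms(1)]])
  moreover have "act (\<pi> \<circ> \<rho>) (x i) = (act \<pi> \<circ> act \<rho>) (x i)" for i
    using act_x[OF p] act_x[OF assms(2)] act_x[OF assms(1)] by simp
  ultimately show ?thesis
    using hom_eqI[OF act_hom[OF p] _ _ assms(3)] by auto
qed

lemma act_inv:
  assumes "\<pi> permutes {1..n}" "a \<in> carrier E"
  shows "act (inv' \<pi>) (act \<pi> a) = a" "act \<pi> (act (inv' \<pi>) a) = a"
  using act_comp[OF permutes_inv[OF assms(1)] assms] act_comp[OF assms(1) permutes_inv[OF assms(1)] assms(2)]
    act_id[OF assms(2)] permutes_inv_o[OF assms(1)] by simp_all

lemma act_inj: "\<pi> permutes {1..n} \<Longrightarrow> inj_on (act \<pi>) (carrier E)"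
  by (metis act_inv(1) inj_onI)

definition aut :: "(nat \<Rightarrow> nat) \<Rightarrow> 'a \<Rightarrow> 'a" where
  "aut \<pi> = restrict (act \<pi>) (carrier E)"

lemma aut_Bij: "\<pi> permutes {1..n} \<Longrightarrow> aut \<pi> \<in> Bij (carrier E)"
proof -
  assume p: "\<pi> permutes {1..n}"
  have "bij_betw (act \<pi>) (carrier E) (carrier E)"
    by (rule bij_betwI[where g="act (inv' \<pi>)"])
      (auto simp: act_inv[OF p] ring_hom_closed[OF act_hom[OF p]] ring_hom_closed[OF act_hom[OF permutes_inv[OF p]]])
  then show ?thesis unfolding aut_def Bij_def by (simp add: bij_betw_restrict_eq)
qed

lemma aut_hom: "\<pi> permutes {1..n} \<Longrightarrow> aut \<pi> \<in> ring_hom E E"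
  using act_hom unfolding ring_hom_def aut_def by auto

lemma aut_mult:
  assumes "\<pi> permutes {1..n}" "\<rho> permutes {1..n}"
  shows "aut (\<pi> \<circ> \<rho>) = aut \<pi> \<otimes>\<^bsub>BijGroup (carrier E)\<^esub> aut \<rho>"
proof -
  have "aut (\<pi> \<circ> \<rho>) = compose (carrier E) (aut \<pi>) (aut \<rho>)"
    unfolding aut_def compose_def
    using ring_hom_closed[OF act_hom[OF assms(2)]] act_comp[OF assms] by (auto simp: fun_eq_iff)
  then show ?thesis using aut_Bij assms by (simp add: BijGroup_def)
qed

lemma aut_inj: "inj_on aut {\<pi>. \<pi> permutes {1..n}}"
  using theta theta_inj unfolding aut_def by (auto intro!: inj_onI dest!: fun_cong[where x=\<theta>])

context
  fixes G assumes G: "subgroup G (sym_group n)"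
begin

lemma G_perm: "g \<in> G \<Longrightarrow> g permutes {1..n}"
  using subgroup.subset[OF G] sym_group_carrier by blast

lemma G_id: "id \<in> G" using subgroup.one_closed[OF G] by (simp add: sym_group_one)

lemma G_comp: "g \<in> G \<Longrightarrow> h \<in> G \<Longrightarrow> g \<circ> h \<in> G"
  using subgroup.m_closed[OF G] by (simp add: sym_group_mult)

interpretation AG: automorphism_set E "act ` G"
  by unfold_locales (use act_hom G_perm in auto)

text \<open>Orbits are finite invariant sets, so that every element of \<open>E\<close> is algebraic and separable over the fixed
  field.\<close>
lemma invariant_finite_sets:
  assumes "b \<in> carrier E"
  shows "finite ((\<lambda>g. act g b) ` G)" "(\<lambda>g. act g b) ` G \<subseteq> carrier E" "b \<in> (\<lambda>g. act g b) ` G"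
    "\<gamma> \<in> act ` G \<Longrightarrow> inj_on \<gamma> ((\<lambda>g. act g b) ` G) \<and> \<gamma> ` ((\<lambda>g. act g b) ` G) \<subseteq> (\<lambda>g. act g b) ` G"
proof -
  have "G \<subseteq> {p. p permutes {1..n}}" using G_perm by blast
  then show "finite ((\<lambda>g. act g b) ` G)"
    using finite_permutations[of "{1..n}"] finite_subset by blast
  show sub: "(\<lambda>g. act g b) ` G \<subseteq> carrier E"
    using ring_hom_closed[OF act_hom[OF G_perm] assms] by auto
  show "b \<in> (\<lambda>g. act g b) ` G" using G_id act_id[OF assms] by (metis imageI)
  assume "\<gamma> \<in> act ` G"
  then obtain h where h: "h \<in> G" "\<gamma> = act h" by blast
  have "inj_on \<gamma> ((\<lambda>g. act g b) ` G)"
    using act_inj[OF G_perm[OF h(1)]] sub h(2) by (simp add: inj_on_subset)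
  moreover have "\<gamma> (act g b) \<in> (\<lambda>g. act g b) ` G" if "g \<in> G" for g
    using act_comp[OF G_perm[OF h(1)] G_perm[OF that] assms] G_comp[OF h(1) that] h(2) by (metis imageI)
  ultimately show "inj_on \<gamma> ((\<lambda>g. act g b) ` G) \<and> \<gamma> ` ((\<lambda>g. act g b) ` G) \<subseteq> (\<lambda>g. act g b) ` G"
    by blast
qed

lemma outer_var_fixed:
  assumes "i \<notin> {1..n}"
  shows "x i \<in> AG.fixed"
proof -
  have "act g (x i) = x i" if "g \<in> G" for g
    using act_x[OF G_perm[OF that]] permutes_not_in[OF G_perm[OF that] assms] by simp
  then show ?thesis using x_carrier by (auto simp: AG.fixed_def)
qed

text \<open>Artin's theorem. An automorphism over the fixed field moves the generators within the invariant set
  \<open>x ` {1..n}\<close> and fixes the others, so it is given by a permutation. It moves \<open>\<theta>\<close> within the orbit of \<open>\<theta>\<close>,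
  which shows that the permutation lies in \<open>G\<close>.\<close>
lemma carrier_galois_group: "carrier (galois_group E AG.fixed) = aut ` G"
proof
  show "aut ` G \<subseteq> carrier (galois_group E AG.fixed)"
    unfolding galois_group_def using aut_Bij aut_hom G_perm
    by (auto simp: AG.fixed_def aut_def)
next
  show "carrier (galois_group E AG.fixed) \<subseteq> aut ` G"
  proof
    fix \<psi> assume "\<psi> \<in> carrier (galois_group E AG.fixed)"
    then have s: "\<psi> \<in> Bij (carrier E)" "\<psi> \<in> ring_hom E E" "\<And>a. a \<in> AG.fixed \<Longrightarrow> \<psi> a = a"
      by (auto simp: galois_group_def)
    have xs: "finite (x ` {1..n})" "x ` {1..n} \<subseteq> carrier E"
      "\<And>\<gamma>. \<gamma> \<in> act ` G \<Longrightarrow> inj_on \<gamma> (x ` {1..n}) \<and> \<gamma> ` x ` {1..n} \<subseteq> x ` {1..n}"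
      subgoal by simp
      subgoal using x_carrier by auto
      subgoal for \<gamma>
        using act_inj[OF G_perm] x_carrier act_x[OF G_perm] permutes_in_image[OF G_perm]
        by (auto simp del: permutes_in_image atLeastAtMost_iff intro: inj_on_subset)
      done
    have sx: "\<exists>j\<in>{1..n}. \<psi> (x i) = x j" if "i \<in> {1..n}" for i
      using AG.moved_within_invariant_set[OF xs s(2,3), of "x i"] that by blast
    obtain q where q: "\<And>i. i \<in> {1..n} \<Longrightarrow> q i \<in> {1..n} \<and> \<psi> (x i) = x (q i)"
      using sx by metis
    define p where "p i = (if i \<in> {1..n} then q i else i)" for i
    have p: "p i \<in> {1..n} \<and> \<psi> (x i) = x (p i)" if "i \<in> {1..n}" for i
      using q[OF that] that unfolding p_def by auto
    have sinj: "inj_on \<psi> (carrier E)" using s(1) by (simp add: Bij_def bij_betw_def)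
    have "inj_on p {1..n}"
    proof (rule inj_onI)
      fix i j assume ij: "i \<in> {1..n}" "j \<in> {1..n}" "p i = p j"
      then have "\<psi> (x i) = \<psi> (x j)" using p by metis
      then show "i = j" using inj_onD[OF sinj _ x_carrier x_carrier] injD[OF x_inj] by blast
    qed
    then have "bij_betw p {1..n} {1..n}"
      using p endo_inj_surj[of "{1..n}" p] unfolding bij_betw_def by blast
    then have pp: "p permutes {1..n}"
      by (rule bij_imp_permutes) (auto simp: p_def)
    have "\<psi> (x i) = x (p i)" for i
    proof (cases "i \<in> {1..n}")
      case False
      then have "x i \<in> AG.fixed"
        by (rule outer_var_fixed)
      then show ?thesis using s(3) False by (simp only: p_def if_False)
    qed (use p in blast)
    then have eq: "\<psi> a = act p a" if "a \<in> carrier E" for a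
      using hom_eqI[OF s(2) act_hom[OF pp] _ that] act_x[OF pp] by simp
    have "\<psi> \<theta> \<in> (\<lambda>g. act g \<theta>) ` G"
      using AG.moved_within_invariant_set[OF invariant_finite_sets(1,2)[OF theta] invariant_finite_sets(4)[OF theta] s(2,3)
          invariant_finite_sets(3)[OF theta]] .
    then obtain g where g: "g \<in> G" "act p \<theta> = act g \<theta>" using eq[OF theta] by auto
    then have "p = g" using theta_inj[OF pp G_perm] by blast
    then have "\<psi> = aut g"
      using eq Bij_imp_extensional[OF s(1)] unfolding aut_def
      by (intro extensionalityI[of _ "carrier E"]) auto
    then show "\<psi> \<in> aut ` G" using g by blast
  qed
qed

lemma finite_dimension_carrier: "finite_dimension AG.fixed (carrier E)"
proof -
  let ?xs = "map x [1..<Suc n]"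
  have set_xs: "set ?xs = x ` {1..n}" by (auto simp del: upt_Suc)
  then have c: "set ?xs \<subseteq> carrier E" using x_carrier by auto
  have alg: "(algebraic over AG.fixed) y" if "y \<in> set ?xs" for y
    using AG.Irr_of_invariant_set(1)[OF invariant_finite_sets(1,2,4,3)] c that by blast
  have sf: "subfield (finite_extension AG.fixed ?xs) E"
    using finite_extension_is_subfield[OF AG.subfield_fixed c alg] .
  have "set ?xs \<subseteq> finite_extension AG.fixed ?xs"
    using finite_extension_mem[OF subfieldE(1)[OF AG.subfield_fixed] c] .
  moreover have "x i \<in> AG.fixed" if "i \<notin> {1..n}" for i
    using that by (rule outer_var_fixed)
  ultimately have "range x \<subseteq> finite_extension AG.fixed ?xs"
    using finite_extension_incl[OF subfieldE(3)[OF AG.subfield_fixed] c] set_xs by blast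
  moreover have "range x \<subseteq> carrier E" using x_carrier by blast
  ultimately have "carrier E \<subseteq> finite_extension AG.fixed ?xs"
    using generate_field_min_subfield1[OF _ sf, of "range x"] unfolding generated by blast
  then have "finite_extension AG.fixed ?xs = carrier E" using subfieldE(3)[OF sf] by blast
  then show ?thesis using finite_extension_finite_dimension(1)[OF AG.subfield_fixed c alg] by simp
qed

end

text \<open>\<open>K\<close> is the fixed field of \<open>G\<close> and \<open>L\<close> that of the stabiliser of \<open>i0\<close>. By transitivity all of \<open>x 1, \<dots>, x n\<close>
  are conjugates of \<open>x i0 \<in> L\<close> over \<open>K\<close>, so the conjugates of the elements of \<open>L\<close> generate \<open>E\<close>.\<close>
lemma galois_closure_of_transitive_group:
  assumes G: "subgroup G (sym_group n)" and tr: "\<forall>i\<in>{1..n}. \<forall>j\<in>{1..n}. \<exists>g\<in>G. g i = j" and i0: "i0 \<in> {1..n}"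
  shows "\<exists>K L. is_galois_closure E K L \<and> aut ` G = carrier (galois_group E K) \<and>
     aut ` {g\<in>G. g i0 = i0} = carrier (galois_group E L)"
proof -
  interpret AG: automorphism_set E "act ` G"
    by unfold_locales (use act_hom G_perm[OF G] in auto)
  let ?H = "{g\<in>G. g i0 = i0}"
  have H: "subgroup ?H (sym_group n)"
  proof -
    show ?thesis
    proof (rule group.finite_subgroupI[OF sym_group_is_group])
      have "carrier (sym_group n) = {p. p permutes {1..n}}" using sym_group_carrier by blast
      then show "finite (carrier (sym_group n))" using finite_permutations[of "{1..n}"] by simp
    qed (use subgroup.subset[OF G] G_id[OF G] G_comp[OF G] in \<open>auto simp: sym_group_mult\<close>)
  qed
  interpret AH: automorphism_set E "act ` ?H"
    by unfold_locales (use act_hom G_perm[OF G] in auto)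
  let ?K = "AG.fixed" and ?L = "AH.fixed"
  have sub: "?K \<subseteq> ?L" by (auto simp: AG.fixed_def AH.fixed_def)
  have Lc: "?L \<subseteq> carrier E" by (auto simp: AH.fixed_def)
  have "subgroup ?L (add_monoid E)"
    using subring.axioms(1)[OF subfieldE(1)[OF AH.subfield_fixed]] .
  then have "subalgebra ?K ?L E"
    using sub subringE(6)[OF subfieldE(1)[OF AH.subfield_fixed]]
    by (auto simp: subalgebra_def subalgebra_axioms_def)
  then have fd: "finite_dimension ?K ?L"
    using subalbegra_incl_imp_finite_dimension[OF AG.subfield_fixed finite_dimension_carrier[OF G] _ Lc] by blast
  have sep: "splitted (Irr ?K y) \<and> (\<forall>a\<in>carrier E. count (roots (Irr ?K y)) a \<le> 1)" if "y \<in> ?L" for y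
    using AG.Irr_of_invariant_set(2,3)[OF invariant_finite_sets(1,2,4,3)[OF G]] that Lc by blast
  have xL: "x i0 \<in> ?L"
    using x_carrier act_x[OF G_perm[OF G]] by (auto simp: AH.fixed_def)
  have xroot: "x j \<in> {a \<in> carrier E. is_root (Irr ?K (x i0)) a}" if j: "j \<in> {1..n}" for j
  proof -
    obtain g where g: "g \<in> G" "g i0 = j" using tr i0 j by blast
    interpret h: ring_hom_ring E E "act g" using ring_hom_ringI2[OF is_ring is_ring act_hom[OF G_perm[OF G g(1)]]] .
    have xc: "x i0 \<in> carrier E" using x_carrier by blast
    have I: "Irr ?K (x i0) \<in> carrier (?K[X])" "is_root (Irr ?K (x i0)) (x i0)"
      using AG.Irr_of_invariant_set(4,5)[OF invariant_finite_sets(1,2,4,3)[OF G xc]] by blast+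
    have "set (Irr ?K (x i0)) \<subseteq> ?K" using I(1) unfolding univ_poly_carrier[symmetric] polynomial_def by auto
    then have m: "map (act g) (Irr ?K (x i0)) = Irr ?K (x i0)" using g(1) by (auto simp: AG.fixed_def intro!: map_idI)
    have "eval (Irr ?K (x i0)) (act g (x i0)) = act g (eval (Irr ?K (x i0)) (x i0))"
      using h.eval_hom[OF carrier_is_subring xc carrier_polynomial_shell[OF subfieldE(1)[OF AG.subfield_fixed] I(1)]] m
      by simp
    then have "is_root (Irr ?K (x i0)) (act g (x i0))"
      using I(2) xc by (simp add: is_root_def)
    then show ?thesis using act_x[OF G_perm[OF G g(1)]] g(2) x_carrier by simp
  qed
  let ?C = "\<Union>y\<in>?L. {a \<in> carrier E. is_root (Irr ?K y) a}"
  have Cc: "?C \<subseteq> carrier E" by auto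
  have "x j \<in> ?C" for j
  proof (cases "j \<in> {1..n}")
    case True
    then show ?thesis using xL xroot by blast
  next
    case False
    have "act g (x j) = x j" if "g \<in> G" for g
      using act_x[OF G_perm[OF G that]] permutes_not_in[OF G_perm[OF G that] False] by simp
    then have "x j \<in> ?L" using x_carrier by (auto simp: AH.fixed_def)
    then show ?thesis
      using AG.Irr_of_invariant_set(5)[OF invariant_finite_sets(1,2,4,3)[OF G x_carrier]] x_carrier by blast
  qed
  then have "range x \<subseteq> ?C" by blast
  then have "range x \<subseteq> generate_field E ?C" using generate_field.incl by (metis (no_types, lifting) subset_iff)
  then have "carrier E \<subseteq> generate_field E ?C"
    using generate_field_min_subfield1[OF _ generate_field_is_subfield[OF Cc], of "range x"] generated x_carrier by auto
  then have gen: "generate_field E ?C = carrier E" using generate_field_incl[OF Cc] by blast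
  have "is_galois_closure E ?K ?L"
    unfolding is_galois_closure_def
    using field_axioms AG.subfield_fixed AH.subfield_fixed sub fd sep gen by blast
  then show ?thesis
    using carrier_galois_group[OF G] carrier_galois_group[OF H] by blast
qed

lemma galois_closure_pair_iso:
  assumes G: "transitive_perm_group n G" and i0: "i0 \<in> {1..n}"
  shows "\<exists>K L. is_galois_closure E K L \<and>
     pair_iso (perm_group n G) (point_stabiliser n G i0) (galois_group E K) (carrier (galois_group E L))"
proof -
  have sg: "subgroup G (sym_group n)" using G by (simp add: transitive_perm_group_def)
  obtain K L where KL: "is_galois_closure E K L" "aut ` G = carrier (galois_group E K)"
     "aut ` {g\<in>G. g i0 = i0} = carrier (galois_group E L)"
    using galois_closure_of_transitive_group[of G i0] G i0 unfolding transitive_perm_group_def by blast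
  have "aut \<in> iso (perm_group n G) (galois_group E K)"
  proof (rule isoI)
    show "aut \<in> hom (perm_group n G) (galois_group E K)"
      using KL(2) aut_mult G_perm[OF sg] by (auto simp: hom_def perm_group_def sym_group_mult galois_group_def)
    show "bij_betw aut (carrier (perm_group n G)) (carrier (galois_group E K))"
      using KL(2) inj_on_subset[OF aut_inj] G_perm[OF sg] by (auto simp: bij_betw_def perm_group_def)
  qed
  moreover have "point_stabiliser n G i0 = {g\<in>G. g i0 = i0}"
    by (simp add: stabilizer_def perm_group_def)
  ultimately show ?thesis using KL unfolding pair_iso_def by metis
qed

end

section \<open>Rational functions with permuted variables\<close>

lemma poly_mapping_add_induct [case_names zero single add]:
  fixes p :: "'a \<Rightarrow>\<^sub>0 'b::comm_monoid_add"
  assumes "P 0" "\<And>k v. P (Poly_Mapping.single k v)" "\<And>p q. P p \<Longrightarrow> P q \<Longrightarrow> P (p + q)"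
  shows "P p"
proof (induction p rule: update_induct)
  case const
  show ?case by (rule assms(1))
next
  case (update f a b)
  have "Poly_Mapping.update a b f = f + Poly_Mapping.single a b"
    using update(1)
    by (intro poly_mapping_eqI) (auto simp: lookup_update lookup_add lookup_single when_def in_keys_iff)
  then show ?case using update assms by simp
qed

text \<open>Given through representatives; for an injective ring homomorphism the choice does not matter.\<close>
definition fract_map :: "('a::idom \<Rightarrow> 'a) \<Rightarrow> 'a fract \<Rightarrow> 'a fract" where
  "fract_map f q = (SOME r. \<exists>a b. b \<noteq> 0 \<and> q = Fract a b \<and> r = Fract (f a) (f b))"

locale injective_ring_hom =
  fixes f :: "'a::idom \<Rightarrow> 'a"
  assumes add: "f (a + b) = f a + f b" and mult: "f (a * b) = f a * f b"
    and one: "f 1 = 1" and inj: "inj f"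
begin

lemma zero: "f 0 = 0"
  by (metis add add_0 add_cancel_right_right)

lemma nonzero: "a \<noteq> 0 \<Longrightarrow> f a \<noteq> 0"
  using inj zero by (metis injD)

lemma fract_map_Fract:
  assumes "b \<noteq> 0"
  shows "fract_map f (Fract a b) = Fract (f a) (f b)"
proof -
  have "Fract (f a') (f b') = Fract (f a) (f b)" if "b' \<noteq> 0" "Fract a b = Fract a' b'" for a' b'
    using that assms nonzero mult by (metis eq_fract(1))
  then show ?thesis
    unfolding fract_map_def using assms by (intro some_equality) blast+
qed

lemma fract_map_hom:
  "fract_map f (p + q) = fract_map f p + fract_map f q"
  "fract_map f (p * q) = fract_map f p * fract_map f q"
  "fract_map f 1 = 1"
proof -
  obtain a b where p: "p = Fract a b" "b \<noteq> 0" by (cases p)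
  obtain c d where q: "q = Fract c d" "d \<noteq> 0" by (cases q)
  show "fract_map f (p + q) = fract_map f p + fract_map f q"
    using p q by (simp add: fract_map_Fract nonzero mult add)
  show "fract_map f (p * q) = fract_map f p * fract_map f q"
    using p q by (simp add: fract_map_Fract nonzero mult)
  show "fract_map f 1 = 1"
    unfolding One_fract_def by (subst fract_map_Fract) (simp_all add: one)
qed

end

text \<open>Polynomials in the variables \<open>0, 1, 2, \<dots>\<close> with integer coefficients. A monomial maps each variable to its
  exponent.\<close>
type_synonym mpoly = "(nat \<Rightarrow>\<^sub>0 nat) \<Rightarrow>\<^sub>0 int"

text \<open>The coefficient of a monomial \<open>m\<close> in the image is the coefficient of \<open>m \<circ> \<pi>\<close>; so the variable \<open>i\<close> goes to
  the variable \<open>\<pi> i\<close>.\<close>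
definition permute_vars :: "(nat \<Rightarrow> nat) \<Rightarrow> mpoly \<Rightarrow> mpoly" where
  "permute_vars \<pi> = Poly_Mapping.map_key (Poly_Mapping.map_key \<pi>)"

lemma map_key_inv:
  assumes "bij \<pi>"
  shows "Poly_Mapping.map_key \<pi> (Poly_Mapping.map_key (inv' \<pi>) m) = m"
    "Poly_Mapping.map_key (inv' \<pi>) (Poly_Mapping.map_key \<pi> m) = m"
proof -
  have i: "inj \<pi>" "inj (inv' \<pi>)" using assms by (auto simp: bij_is_inj bij_imp_bij_inv)
  show "Poly_Mapping.map_key \<pi> (Poly_Mapping.map_key (inv' \<pi>) m) = m"
    by (rule poly_mapping_eqI) (simp add: map_key.rep_eq i inv_f_f)
  show "Poly_Mapping.map_key (inv' \<pi>) (Poly_Mapping.map_key \<pi> m) = m"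
    by (rule poly_mapping_eqI) (simp add: map_key.rep_eq i surj_f_inv_f[OF bij_is_surj[OF assms]])
qed

lemma inj_map_key: "bij (\<pi> :: 'a \<Rightarrow> 'a) \<Longrightarrow> inj (Poly_Mapping.map_key \<pi>)"
  by (rule inj_on_inverseI[where g="Poly_Mapping.map_key (inv' \<pi>)"]) (rule map_key_inv(2))

lemma permute_vars_single:
  assumes "bij \<pi>"
  shows "permute_vars \<pi> (Poly_Mapping.single m v) = Poly_Mapping.single (Poly_Mapping.map_key (inv' \<pi>) m) v"
  unfolding permute_vars_def
  using map_key_single[OF inj_map_key[OF assms], of "Poly_Mapping.map_key (inv' \<pi>) m" v]
  by (simp add: map_key_inv[OF assms])

lemma permute_vars_add: "bij \<pi> \<Longrightarrow> permute_vars \<pi> (p + q) = permute_vars \<pi> p + permute_vars \<pi> q"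
  unfolding permute_vars_def by (rule map_key_plus[OF inj_map_key])

lemma permute_vars_zero: "bij \<pi> \<Longrightarrow> permute_vars \<pi> 0 = 0"
  unfolding permute_vars_def by (rule map_key_zero[OF inj_map_key])

lemma permute_vars_mult:
  assumes "bij \<pi>"
  shows "permute_vars \<pi> (p * q) = permute_vars \<pi> p * permute_vars \<pi> q"
proof (induction p rule: poly_mapping_add_induct)
  case (single k v)
  show ?case
  proof (induction q rule: poly_mapping_add_induct)
    case (single k' v')
    have "inj (inv' \<pi>)" using assms by (simp add: bij_is_inj bij_imp_bij_inv)
    then show ?case by (simp add: permute_vars_single assms mult_single map_key_plus)
  qed (simp_all add: permute_vars_zero permute_vars_add assms distrib_left)
qed (simp_all add: permute_vars_zero permute_vars_add assms distrib_right)

lemma injective_ring_hom_permute_vars: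
  assumes "bij \<pi>"
  shows "injective_ring_hom (permute_vars \<pi>)"
proof
  have "inj (inv' \<pi>)" using assms by (simp add: bij_is_inj bij_imp_bij_inv)
  then show "permute_vars \<pi> 1 = 1"
    using permute_vars_single[OF assms, of 0 1] by simp
  have "bij (Poly_Mapping.map_key \<pi> :: (nat \<Rightarrow>\<^sub>0 nat) \<Rightarrow> _)"
    by (rule bijI'[OF inj_eq[OF inj_map_key[OF assms]]]) (metis map_key_inv(1)[OF assms])
  then show "inj (permute_vars \<pi>)"
    unfolding permute_vars_def by (rule inj_map_key)
qed (simp_all add: permute_vars_add permute_vars_mult assms)

definition monom_fract :: "(nat \<Rightarrow>\<^sub>0 nat) \<Rightarrow> mpoly fract" where
  "monom_fract m = Fract (Poly_Mapping.single m 1) 1"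

definition ratvar :: "nat \<Rightarrow> mpoly fract" where
  "ratvar i = monom_fract (Poly_Mapping.single i 1)"

definition permute_ratvars :: "(nat \<Rightarrow> nat) \<Rightarrow> mpoly fract \<Rightarrow> mpoly fract" where
  "permute_ratvars \<pi> = fract_map (permute_vars \<pi>)"

lemma single_one_eq_iff:
  "Poly_Mapping.single m (1::int) = Poly_Mapping.single m' 1 \<longleftrightarrow> m = m'"
  by (metis keys_single singleton_inject zero_neq_one)

lemma monom_fract_eq_iff: "monom_fract m = monom_fract m' \<longleftrightarrow> m = m'"
  by (simp add: monom_fract_def eq_fract single_one_eq_iff)

lemma inj_ratvar: "inj ratvar"
proof (rule injI)
  fix i j assume "ratvar i = ratvar j"
  then have "Poly_Mapping.single i (1::nat) = Poly_Mapping.single j 1"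
    by (simp add: ratvar_def monom_fract_eq_iff)
  then show "i = j" by (metis keys_single singleton_inject zero_neq_one)
qed

lemma permute_monom_fract:
  assumes "bij \<pi>"
  shows "permute_ratvars \<pi> (monom_fract m) = monom_fract (Poly_Mapping.map_key (inv' \<pi>) m)"
proof -
  interpret injective_ring_hom "permute_vars \<pi>" by (rule injective_ring_hom_permute_vars[OF assms])
  show ?thesis
    unfolding permute_ratvars_def monom_fract_def
    by (subst fract_map_Fract) (simp_all add: one permute_vars_single[OF assms])
qed

lemma permute_ratvar: "bij \<pi> \<Longrightarrow> permute_ratvars \<pi> (ratvar i) = ratvar (\<pi> i)"
  unfolding ratvar_def using permute_monom_fract map_key_single[of "inv' \<pi>" "\<pi> i" "1::nat"]
  by (simp add: bij_is_inj bij_imp_bij_inv)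

lemma permute_ratvars_hom:
  assumes "bij \<pi>"
  shows "permute_ratvars \<pi> (p + q) = permute_ratvars \<pi> p + permute_ratvars \<pi> q"
    "permute_ratvars \<pi> (p * q) = permute_ratvars \<pi> p * permute_ratvars \<pi> q"
    "permute_ratvars \<pi> 1 = 1"
  using injective_ring_hom.fract_map_hom[OF injective_ring_hom_permute_vars[OF assms]]
  unfolding permute_ratvars_def by auto

text \<open>The monomial \<open>x\<^sub>1 x\<^sub>2\<^sup>2 \<dots> x\<^sub>n\<^sup>n\<close>. Its exponents are distinct, so a permutation of the variables can be
  recovered from what it does to this monomial.\<close>
definition asym_monom :: "nat \<Rightarrow> mpoly fract" where
  "asym_monom n = monom_fract (\<Sum>i\<in>{1..n}. Poly_Mapping.single i i)"

lemma asym_monom_trivial_stabiliser: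
  assumes p: "\<pi> permutes {1..n}" and r: "\<rho> permutes {1..n}"
    and eq: "permute_ratvars \<pi> (asym_monom n) = permute_ratvars \<rho> (asym_monom n)"
  shows "\<pi> = \<rho>"
proof -
  let ?m = "\<Sum>i\<in>{1..n}. Poly_Mapping.single i i"
  have b: "bij \<pi>" "bij \<rho>" using p r permutes_bij by blast+
  have i: "inj (inv' \<pi>)" "inj (inv' \<rho>)" using b by (auto simp: bij_is_inj bij_imp_bij_inv)
  have l: "Poly_Mapping.lookup ?m j = (if j \<in> {1..n} then j else 0)" for j
    by (simp add: lookup_sum lookup_single when_def)
  have "Poly_Mapping.map_key (inv' \<pi>) ?m = Poly_Mapping.map_key (inv' \<rho>) ?m"
    using eq by (simp add: asym_monom_def permute_monom_fract b monom_fract_eq_iff)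
  then have "Poly_Mapping.lookup (Poly_Mapping.map_key (inv' \<pi>) ?m) j
      = Poly_Mapping.lookup (Poly_Mapping.map_key (inv' \<rho>) ?m) j" for j
    by (rule arg_cong)
  then have e: "Poly_Mapping.lookup ?m (inv' \<pi> j) = Poly_Mapping.lookup ?m (inv' \<rho> j)" for j
    by (simp only: map_key.rep_eq[OF i(1)] map_key.rep_eq[OF i(2)] comp_apply)
  have "inv' \<pi> j = inv' \<rho> j" for j
  proof (cases "j \<in> {1..n}")
    case True
    then have "inv' \<pi> j \<in> {1..n}" "inv' \<rho> j \<in> {1..n}"
      using permutes_in_image[OF permutes_inv[OF p]] permutes_in_image[OF permutes_inv[OF r]] by blast+
    then show ?thesis using e[of j] unfolding l by simp
  next
    case False
    then show ?thesis using permutes_not_in[OF permutes_inv[OF p]] permutes_not_in[OF permutes_inv[OF r]] by simp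
  qed
  then have "inv' \<pi> = inv' \<rho>" by blast
  then show ?thesis using b by (metis inv_inv_eq)
qed

text \<open>Used for the set \<open>D\<close> of those rational functions whose copies in another type lie in the subfield
  generated by the copies of the variables.\<close>
lemma ratfun_generated:
  assumes "\<And>i. ratvar i \<in> D" "1 \<in> D" "\<And>a b. a \<in> D \<Longrightarrow> b \<in> D \<Longrightarrow> a + b \<in> D"
    "\<And>a b. a \<in> D \<Longrightarrow> b \<in> D \<Longrightarrow> a * b \<in> D" "\<And>a. a \<in> D \<Longrightarrow> - a \<in> D"
    "\<And>a. a \<in> D \<Longrightarrow> a \<noteq> 0 \<Longrightarrow> inverse a \<in> D"
  shows "q \<in> D"
proof -
  have zero: "0 \<in> D" using assms(2,3,5) by (metis add.right_inverse)
  have mult1: "Fract (a * b) 1 = Fract a 1 * Fract b 1" and add1: "Fract (a + b) 1 = Fract a 1 + Fract b 1" for a b :: mpoly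
    by simp_all
  have pw: "a ^ k \<in> D" if "a \<in> D" for a k
    by (induction k) (use that assms in auto)
  have powsingle: "monom_fract (Poly_Mapping.single i k) = ratvar i ^ k" for i k
  proof (induction k)
    case 0
    show ?case by (simp add: monom_fract_def One_fract_def)
  next
    case (Suc k)
    have "Poly_Mapping.single (Poly_Mapping.single i (Suc k)) (1::int)
        = Poly_Mapping.single (Poly_Mapping.single i 1) 1 * Poly_Mapping.single (Poly_Mapping.single i k) 1"
      by (simp add: mult_single single_add[symmetric])
    then show ?case using Suc by (simp add: monom_fract_def ratvar_def mult1)
  qed
  have mon: "monom_fract m \<in> D" for m
  proof (induction m rule: poly_mapping_add_induct)
    case zero
    show ?case using assms(2) by (simp add: monom_fract_def One_fract_def)
  next
    case (single i k)
    then show ?case using powsingle pw assms(1) by simp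
  next
    case (add p q)
    have "monom_fract (p + q) = monom_fract p * monom_fract q"
      by (simp add: monom_fract_def mult_single)
    then show ?case using add assms(4) by simp
  qed
  have ints: "of_int k \<in> D" for k :: int
  proof (induction k rule: int_induct[where k=0])
    case base
    show ?case using zero by simp
  next
    case (step1 i)
    then show ?case using assms(3)[OF _ assms(2), of "of_int i"] by simp
  next
    case (step2 i)
    then show ?case using assms(3)[OF _ assms(5)[OF assms(2)], of "of_int i"] by simp
  qed
  have poly: "Fract a 1 \<in> D" for a :: mpoly
  proof (induction a rule: poly_mapping_add_induct)
    case zero
    show ?case using \<open>0 \<in> D\<close> by (simp add: Zero_fract_def)
  next
    case (single m v)
    have of: "of_int v = Fract (of_int v :: mpoly) 1"
      by (cases v rule: int_diff_cases) (simp add: of_nat_fract)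
    have "Poly_Mapping.single m v = Poly_Mapping.single 0 v * Poly_Mapping.single m 1"
      by (simp add: mult_single)
    then have "Poly_Mapping.single m v = of_int v * Poly_Mapping.single m 1"
      using single_of_int[of v, where 'a="nat \<Rightarrow>\<^sub>0 nat" and 'b=int] by simp
    then have "Fract (Poly_Mapping.single m v) 1 = of_int v * monom_fract m"
      by (simp add: of monom_fract_def)
    then show ?case using assms(4)[OF ints mon] by simp
  next
    case (add p q)
    then show ?case using assms(3) add1 by metis
  qed
  obtain a b where q: "q = Fract a b" "b \<noteq> 0" by (cases q)
  then have "q = Fract a 1 * inverse (Fract b 1)" "Fract b 1 \<noteq> 0"
    by (simp_all add: Zero_fract_def eq_fract)
  then show ?thesis using poly assms(4,6) by metis
qed

text \<open>A finitely supported function is determined by its graph on the support, a finite set of pairs.\<close>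
lemma countable_poly_mapping:
  assumes "countable (UNIV :: 'a set)" "countable (UNIV :: 'b::zero set)"
  shows "countable (UNIV :: ('a \<Rightarrow>\<^sub>0 'b) set)"
proof -
  let ?g = "\<lambda>p :: 'a \<Rightarrow>\<^sub>0 'b. (\<lambda>k. (k, Poly_Mapping.lookup p k)) ` Poly_Mapping.keys p"
  have "inj ?g"
  proof (rule injI, rule poly_mapping_eqI)
    fix p q k assume e: "?g p = ?g q"
    have "(k, v) \<in> ?g r \<longleftrightarrow> v \<noteq> 0 \<and> Poly_Mapping.lookup r k = v" for r :: "'a \<Rightarrow>\<^sub>0 'b" and v
      by (auto simp: in_keys_iff)
    then show "Poly_Mapping.lookup p k = Poly_Mapping.lookup q k" using e by metis
  qed
  moreover have "countable (UNIV :: ('a \<times> 'b) set)"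
    using assms by (metis UNIV_Times_UNIV countable_SIGMA)
  then have "countable {A. finite A \<and> A \<subseteq> (UNIV :: ('a \<times> 'b) set)}"
    by (rule countable_Collect_finite_subset)
  then have "countable (range ?g)" by (rule countable_subset[rotated]) auto
  ultimately show ?thesis using countable_image_inj_on by blast
qed

lemma countable_ratfun: "countable (UNIV :: mpoly fract set)"
proof -
  have "countable (UNIV :: mpoly set)"
    by (intro countable_poly_mapping) auto
  then have "countable (UNIV :: (mpoly \<times> mpoly) set)"
    by (metis UNIV_Times_UNIV countable_SIGMA)
  moreover have "range (\<lambda>(a, b). Fract a b :: mpoly fract) = UNIV"
    by (auto simp: image_def intro: Fract_cases)
  ultimately show ?thesis by (metis countable_image)
qed

lemma ratfun_embedding:
  assumes "infinite (UNIV :: 'u set)"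
  shows "\<exists>\<iota> :: mpoly fract \<Rightarrow> 'u. inj \<iota>"
proof -
  obtain f :: "nat \<Rightarrow> 'u" where "inj f" using infinite_countable_subset[OF assms] by blast
  moreover obtain g :: "mpoly fract \<Rightarrow> nat" where "inj g" using countable_ratfun by (auto simp: countable_def)
  ultimately show ?thesis by (metis inj_compose)
qed

section \<open>Transitive permutation groups as Galois groups\<close>

text \<open>The universe of the field extensions is an arbitrary type, into which a field of rational functions is
  copied.\<close>
definition transported_field :: "('a::{comm_ring_1} \<Rightarrow> 'u) \<Rightarrow> 'u ring" where
  "transported_field \<iota> = \<lparr>carrier = range \<iota>, monoid.mult = (\<lambda>a b. \<iota> (inv' \<iota> a * inv' \<iota> b)), one = \<iota> 1,
     ring.zero = \<iota> 0, add = (\<lambda>a b. \<iota> (inv' \<iota> a + inv' \<iota> b))\<rparr>"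

context
  fixes \<iota> :: "'a::Fields.field \<Rightarrow> 'u" assumes inj: "inj \<iota>"
begin

lemma transported_simps:
  "carrier (transported_field \<iota>) = range \<iota>"
  "\<one>\<^bsub>transported_field \<iota>\<^esub> = \<iota> 1" "\<zero>\<^bsub>transported_field \<iota>\<^esub> = \<iota> 0"
  "\<iota> a \<otimes>\<^bsub>transported_field \<iota>\<^esub> \<iota> b = \<iota> (a * b)" "\<iota> a \<oplus>\<^bsub>transported_field \<iota>\<^esub> \<iota> b = \<iota> (a + b)"
  by (simp_all add: transported_field_def inv_f_f[OF inj])

lemma field_transported_field: "field (transported_field \<iota>)"
proof -
  have "cring (transported_field \<iota>)"
  proof (rule cringI)
    show "abelian_group (transported_field \<iota>)"
    proof (rule abelian_groupI)
      fix x assume "x \<in> carrier (transported_field \<iota>)"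
      then obtain a where "x = \<iota> a" by (auto simp: transported_simps)
      then show "\<exists>y\<in>carrier (transported_field \<iota>). y \<oplus>\<^bsub>transported_field \<iota>\<^esub> x = \<zero>\<^bsub>transported_field \<iota>\<^esub>"
        by (intro bexI[of _ "\<iota> (- a)"]) (simp_all add: transported_simps)
    qed (auto simp: transported_simps algebra_simps)
    show "Group.comm_monoid (transported_field \<iota>)"
      by (rule comm_monoidI) (auto simp: transported_simps algebra_simps)
  qed (auto simp: transported_simps algebra_simps)
  then interpret cring "transported_field \<iota>" .
  have "Units (transported_field \<iota>) = carrier (transported_field \<iota>) - {\<zero>\<^bsub>transported_field \<iota>\<^esub>}"
  proof
    show "Units (transported_field \<iota>) \<subseteq> carrier (transported_field \<iota>) - {\<zero>\<^bsub>transported_field \<iota>\<^esub>}"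
      by (auto simp: Units_def transported_simps inj_eq[OF inj])
  next
    show "carrier (transported_field \<iota>) - {\<zero>\<^bsub>transported_field \<iota>\<^esub>} \<subseteq> Units (transported_field \<iota>)"
    proof
      fix x assume "x \<in> carrier (transported_field \<iota>) - {\<zero>\<^bsub>transported_field \<iota>\<^esub>}"
      then obtain a where a: "x = \<iota> a" "a \<noteq> 0" by (auto simp: transported_simps)
      then show "x \<in> Units (transported_field \<iota>)"
        unfolding Units_def by (auto simp: transported_simps intro!: exI[of _ "inverse a"])
    qed
  qed
  then show ?thesis by (rule cring_fieldI)
qed

lemma transported_a_inv: "\<ominus>\<^bsub>transported_field \<iota>\<^esub> (\<iota> a) = \<iota> (- a)"
proof -
  interpret field "transported_field \<iota>" by (rule field_transported_field)
  show ?thesis by (rule minus_equality) (simp_all add: transported_simps)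
qed

lemma transported_m_inv: "a \<noteq> 0 \<Longrightarrow> inv\<^bsub>transported_field \<iota>\<^esub> (\<iota> a) = \<iota> (inverse a)"
proof -
  interpret field "transported_field \<iota>" by (rule field_transported_field)
  assume "a \<noteq> 0"
  then show ?thesis by (intro comm_inv_char) (simp_all add: transported_simps)
qed

lemma ring_hom_transported:
  assumes "\<And>a b. f (a + b) = f a + f b" "\<And>a b. f (a * b) = f a * f b" "f 1 = 1"
  shows "(\<lambda>u. \<iota> (f (inv' \<iota> u))) \<in> ring_hom (transported_field \<iota>) (transported_field \<iota>)"
  by (rule ring_hom_memI) (auto simp: transported_simps inv_f_f[OF inj] assms)

end

text \<open>\<open>E\<close> is a copy of a field of rational functions whose variables are permuted by \<open>G\<close>.\<close>
theorem transitive_group_is_galois_group: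
  assumes inf: "infinite (UNIV :: 'u set)" and G: "transitive_perm_group n G" and i0: "i0 \<in> {1..n}"
  shows "\<exists>(E :: 'u ring) K L. is_galois_closure E K L \<and>
     pair_iso (perm_group n G) (point_stabiliser n G i0) (galois_group E K) (carrier (galois_group E L))"
proof -
  obtain \<iota> :: "mpoly fract \<Rightarrow> 'u" where \<iota>: "inj \<iota>" using ratfun_embedding[OF inf] by blast
  let ?E = "transported_field \<iota>"
  interpret E: field ?E by (rule field_transported_field[OF \<iota>])
  let ?act = "\<lambda>\<pi> u. \<iota> (permute_ratvars \<pi> (inv' \<iota> u))"
  note simps = transported_simps[OF \<iota>]
  interpret permuted_generators ?E n "\<lambda>i. \<iota> (ratvar i)" ?act "\<iota> (asym_monom n)"
  proof unfold_locales
    let ?D = "generate_field ?E (range (\<lambda>i. \<iota> (ratvar i)))"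
    have "q \<in> {q. \<iota> q \<in> ?D}" for q
    proof (rule ratfun_generated)
      show "ratvar i \<in> {q. \<iota> q \<in> ?D}" for i by (auto intro: generate_field.incl)
      show "1 \<in> {q. \<iota> q \<in> ?D}" using generate_field.one[of ?E] simps by simp
      show "a + b \<in> {q. \<iota> q \<in> ?D}"
        if "a \<in> {q. \<iota> q \<in> ?D}" "b \<in> {q. \<iota> q \<in> ?D}" for a b
        using generate_field.eng_add[of "\<iota> a" ?E _ "\<iota> b"] that simps by simp
      show "a * b \<in> {q. \<iota> q \<in> ?D}"
        if "a \<in> {q. \<iota> q \<in> ?D}" "b \<in> {q. \<iota> q \<in> ?D}" for a b
        using generate_field.eng_mult[of "\<iota> a" ?E _ "\<iota> b"] that simps by simp
      show "- a \<in> {q. \<iota> q \<in> ?D}" if "a \<in> {q. \<iota> q \<in> ?D}" for a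
        using generate_field.a_inv[of "\<iota> a" ?E] that transported_a_inv[OF \<iota>] by simp
      show "inverse a \<in> {q. \<iota> q \<in> ?D}" if "a \<in> {q. \<iota> q \<in> ?D}" "a \<noteq> 0" for a
        using generate_field.m_inv[of "\<iota> a" ?E] that transported_m_inv[OF \<iota>] simps inj_eq[OF \<iota>] by simp
    qed
    then have "carrier ?E \<subseteq> ?D" using simps by auto
    moreover have "?D \<subseteq> carrier ?E" by (rule E.generate_field_incl) (auto simp: simps)
    ultimately show "?D = carrier ?E" by blast
  next
    fix \<pi> assume p: "\<pi> permutes {1..n}"
    show "?act \<pi> \<in> ring_hom ?E ?E"
      by (rule ring_hom_transported[OF \<iota>]) (simp_all add: permute_ratvars_hom permutes_bij[OF p])
    show "?act \<pi> (\<iota> (ratvar i)) = \<iota> (ratvar (\<pi> i))" for i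
      by (simp add: inv_f_f[OF \<iota>] permute_ratvar permutes_bij[OF p])
    fix \<rho> assume r: "\<rho> permutes {1..n}" and eq: "?act \<pi> (\<iota> (asym_monom n)) = ?act \<rho> (\<iota> (asym_monom n))"
    then have "permute_ratvars \<pi> (asym_monom n) = permute_ratvars \<rho> (asym_monom n)"
      by (simp add: inv_f_f[OF \<iota>] inj_eq[OF \<iota>])
    then show "\<pi> = \<rho>" by (rule asym_monom_trivial_stabiliser[OF p r])
  next
    show "inj (\<lambda>i. \<iota> (ratvar i))" using \<iota> inj_ratvar by (auto simp: inj_def)
  qed (auto simp: simps)
  show ?thesis using galois_closure_pair_iso[OF G i0] by blast
qed

section \<open>Transitive permutation groups up to conjugation\<close>

lemma transitive_groupD:
  assumes "transitive_perm_group n G"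
  shows "g \<in> G \<Longrightarrow> g permutes {1..n}" "id \<in> G" "g \<in> G \<Longrightarrow> h \<in> G \<Longrightarrow> g \<circ> h \<in> G" "g \<in> G \<Longrightarrow> inv' g \<in> G"
    "i \<in> {1..n} \<Longrightarrow> j \<in> {1..n} \<Longrightarrow> \<exists>g\<in>G. g i = j" "subgroup G (sym_group n)"
    "group (perm_group n G)"
proof -
  show sub: "subgroup G (sym_group n)" using assms by (simp add: transitive_perm_group_def)
  interpret S: group "sym_group n" by (rule sym_group_is_group)
  interpret G: subgroup G "sym_group n" by (rule sub)
  show perm: "g permutes {1..n}" if "g \<in> G" for g using G.subset that sym_group_carrier by blast
  show "id \<in> G" using G.one_closed by (simp add: sym_group_one)
  show "g \<circ> h \<in> G" if "g \<in> G" "h \<in> G" for g h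
    using G.m_closed[OF that] by (simp add: sym_group_mult)
  show "inv' g \<in> G" if g: "g \<in> G"
  proof -
    have "inv\<^bsub>sym_group n\<^esub> g = inv' g"
      using perm[OF g] by (intro S.inv_equality)
        (simp_all add: sym_group_mult sym_group_one sym_group_carrier permutes_inv permutes_inv_o)
    then show ?thesis using G.m_inv_closed[OF g] by simp
  qed
  show "i \<in> {1..n} \<Longrightarrow> j \<in> {1..n} \<Longrightarrow> \<exists>g\<in>G. g i = j"
    using assms by (simp add: transitive_perm_group_def)
  show "group (perm_group n G)"
    unfolding perm_group_def by (rule S.subgroup_imp_group[OF sub])
qed

lemma perm_group_simps:
  "carrier (perm_group n G) = G" "g \<otimes>\<^bsub>perm_group n G\<^esub> h = g \<circ> h" "\<one>\<^bsub>perm_group n G\<^esub> = id"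
  by (simp_all add: perm_group_def sym_group_mult sym_group_one)

lemma point_stabiliser_eq: "point_stabiliser n G x = {g \<in> G. g x = x}"
  by (simp add: stabilizer_def perm_group_simps)

lemma subgroup_sym_groupI:
  assumes "\<And>g. g \<in> G \<Longrightarrow> g permutes {1..n}" "G \<noteq> {}" "\<And>g h. g \<in> G \<Longrightarrow> h \<in> G \<Longrightarrow> g \<circ> h \<in> G"
  shows "subgroup G (sym_group n)"
proof (rule group.finite_subgroupI[OF sym_group_is_group])
  have "carrier (sym_group n) = {p. p permutes {1..n}}" using sym_group_carrier by blast
  then show "finite (carrier (sym_group n))" "G \<subseteq> carrier (sym_group n)"
    using finite_permutations[of "{1..n}"] assms(1) by auto
qed (use assms in \<open>auto simp: sym_group_mult\<close>)

text \<open>\<open>\<beta> i\<close> is \<open>\<alpha> g y0\<close> for any \<open>g\<close> with \<open>g i0 = i\<close>. As the stabilisers of \<open>i0\<close> and \<open>y0\<close> agree, this does not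
  depend on \<open>g\<close>, and \<open>\<beta>\<close> is injective.\<close>
lemma equivariant_bijection:
  assumes G: "transitive_perm_group n G" and i0: "i0 \<in> {1..n}"
    and y0: "y0 \<in> Y" and closed: "\<And>g y. g \<in> G \<Longrightarrow> y \<in> Y \<Longrightarrow> \<alpha> g y \<in> Y"
    and comp: "\<And>g h y. g \<in> G \<Longrightarrow> h \<in> G \<Longrightarrow> y \<in> Y \<Longrightarrow> \<alpha> (g \<circ> h) y = \<alpha> g (\<alpha> h y)"
    and id: "\<And>y. y \<in> Y \<Longrightarrow> \<alpha> id y = y"
    and trans: "\<And>y. y \<in> Y \<Longrightarrow> \<exists>g\<in>G. \<alpha> g y0 = y"
    and stab: "\<And>g. g \<in> G \<Longrightarrow> \<alpha> g y0 = y0 \<longleftrightarrow> g i0 = i0"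
  obtains \<beta> where "bij_betw \<beta> {1..n} Y" "\<beta> i0 = y0" "\<And>g i. g \<in> G \<Longrightarrow> i \<in> {1..n} \<Longrightarrow> \<beta> (g i) = \<alpha> g (\<beta> i)"
proof -
  note GD = transitive_groupD[OF G]
  have key: "\<alpha> g y0 = \<alpha> h y0 \<longleftrightarrow> g i0 = h i0" if g: "g \<in> G" and h: "h \<in> G" for g h
  proof -
    have k: "inv' h \<circ> g \<in> G" using GD g h by blast
    have hk: "h \<circ> (inv' h \<circ> g) = g" using permutes_inv_o(1)[OF GD(1)[OF h]] by (simp add: comp_assoc[symmetric])
    have kh: "inv' h \<circ> h = id" using permutes_inv_o(2)[OF GD(1)[OF h]] .
    have "\<alpha> g y0 = \<alpha> h y0 \<longleftrightarrow> \<alpha> (inv' h \<circ> g) y0 = y0"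
    proof
      assume "\<alpha> g y0 = \<alpha> h y0"
      then have "\<alpha> (inv' h \<circ> g) y0 = \<alpha> (inv' h \<circ> h) y0"
        using comp[OF GD(4)[OF h] g y0] comp[OF GD(4)[OF h] h y0] by simp
      then show "\<alpha> (inv' h \<circ> g) y0 = y0" using kh id[OF y0] by simp
    next
      assume "\<alpha> (inv' h \<circ> g) y0 = y0"
      then show "\<alpha> g y0 = \<alpha> h y0" using comp[OF h k y0] hk by simp
    qed
    also have "\<dots> \<longleftrightarrow> (inv' h \<circ> g) i0 = i0" by (rule stab[OF k])
    also have "\<dots> \<longleftrightarrow> g i0 = h i0" using permutes_inv_eq[OF GD(1)[OF h]] by auto
    finally show ?thesis .
  qed
  obtain r where r: "\<And>i. i \<in> {1..n} \<Longrightarrow> r i \<in> G \<and> r i i0 = i" using GD(5)[OF i0] by metis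
  define \<beta> where "\<beta> i = \<alpha> (r i) y0" for i
  have im: "g i0 \<in> {1..n}" if "g \<in> G" for g using permutes_in_image[OF GD(1)[OF that]] i0 by blast
  have \<beta>g: "\<beta> (g i0) = \<alpha> g y0" if "g \<in> G" for g
    using key[of "r (g i0)" g] r[OF im[OF that]] that by (simp add: \<beta>_def)
  have bij: "bij_betw \<beta> {1..n} Y"
    unfolding bij_betw_def
  proof
    show "inj_on \<beta> {1..n}"
      by (rule inj_onI) (metis \<beta>_def key r)
    show "\<beta> ` {1..n} = Y"
    proof
      show "\<beta> ` {1..n} \<subseteq> Y" using r closed y0 by (auto simp: \<beta>_def)
      show "Y \<subseteq> \<beta> ` {1..n}" using trans \<beta>g im by (metis image_eqI subsetI)
    qed
  qed
  have eqv: "\<beta> (g i) = \<alpha> g (\<beta> i)" if g: "g \<in> G" and i: "i \<in> {1..n}" for g i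
    using \<beta>g[of "g \<circ> r i"] GD(3)[OF g, of "r i"] r[OF i] comp[OF g, of "r i" y0] y0 by (simp add: \<beta>_def)
  have "\<beta> i0 = y0" using \<beta>g[OF GD(2)] id[OF y0] by simp
  then show ?thesis using that bij eqv by blast
qed

definition conj_by :: "(nat \<Rightarrow> nat) \<Rightarrow> (nat \<Rightarrow> nat) \<Rightarrow> nat \<Rightarrow> nat" where
  "conj_by c g = c \<circ> g \<circ> inv' c"

lemma conj_by_comp: "bij c \<Longrightarrow> conj_by c (g \<circ> h) = conj_by c g \<circ> conj_by c h"
  by (auto simp: conj_by_def fun_eq_iff bij_is_inj inv_f_f)

lemma conj_by_conj_by: "bij c \<Longrightarrow> bij d \<Longrightarrow> conj_by c (conj_by d g) = conj_by (c \<circ> d) g"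
  by (simp add: conj_by_def o_inv_distrib comp_assoc)

lemma conj_by_inv: "bij c \<Longrightarrow> conj_by (inv' c) (conj_by c g) = g"
  by (simp add: conj_by_def fun_eq_iff bij_is_inj inv_inv_eq inv_f_f)

lemma inj_conj_by: "bij c \<Longrightarrow> inj (conj_by c)"
  by (rule inj_on_inverseI[where g="conj_by (inv' c)"]) (rule conj_by_inv)

lemma conj_by_permutes: "c permutes S \<Longrightarrow> g permutes S \<Longrightarrow> conj_by c g permutes S"
  by (simp add: conj_by_def permutes_compose permutes_inv)

lemma conj_by_apply: "c permutes S \<Longrightarrow> conj_by c g (c i) = c (g i)"
  by (simp add: conj_by_def permutes_inverses)

lemma transitive_conj_by:
  assumes G: "transitive_perm_group n G" and c: "c permutes {1..n}"
  shows "transitive_perm_group n (conj_by c ` G)"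
  unfolding transitive_perm_group_def
proof (intro conjI ballI)
  note GD = transitive_groupD[OF G]
  have b: "bij c" using c permutes_bij by blast
  show "subgroup (conj_by c ` G) (sym_group n)"
  proof (rule subgroup_sym_groupI)
    show "conj_by c ` G \<noteq> {}" using GD(2) by blast
    show "g \<circ> h \<in> conj_by c ` G" if "g \<in> conj_by c ` G" "h \<in> conj_by c ` G" for g h
      using that GD(3) conj_by_comp[OF b] by (smt (verit) image_iff)
  qed (use conj_by_permutes[OF c] GD(1) in auto)
  fix i j assume "i \<in> {1..n}" "j \<in> {1..n}"
  then have "inv' c i \<in> {1..n}" "inv' c j \<in> {1..n}" using permutes_in_image[OF permutes_inv[OF c]] by blast+
  then obtain g where "g \<in> G" "g (inv' c i) = inv' c j" using GD(5) by blast
  then show "\<exists>g\<in>conj_by c ` G. g i = j"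
    using permutes_inverses[OF c] by (intro bexI[of _ "conj_by c g"]) (auto simp: conj_by_def)
qed

text \<open>An isomorphism matching point stabilisers identifies the two actions on \<open>{1..n}\<close>, and the identification
  is the conjugating permutation. Conversely, conjugation by \<open>c\<close> takes the stabiliser of \<open>1\<close> to that of \<open>c 1\<close>.\<close>
lemma perm_iso_rel_iff:
  assumes n: "n > 0"
  shows "(G, H) \<in> perm_iso_rel n \<longleftrightarrow>
    transitive_perm_group n G \<and> transitive_perm_group n H \<and> (\<exists>c. c permutes {1..n} \<and> H = conj_by c ` G)"
proof (intro iffI)
  assume "(G, H) \<in> perm_iso_rel n"
  then obtain x y \<phi> where G: "transitive_perm_group n G" and H: "transitive_perm_group n H"
    and x: "x \<in> {1..n}" and y: "y \<in> {1..n}" and \<phi>: "\<phi> \<in> iso (perm_group n G) (perm_group n H)"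
    "\<phi> ` point_stabiliser n G x = point_stabiliser n H y"
    unfolding perm_iso_rel_def pair_iso_def by blast
  note GD = transitive_groupD[OF G] and HD = transitive_groupD[OF H]
  have hom: "\<phi> (g \<circ> h) = \<phi> g \<circ> \<phi> h" if "g \<in> G" "h \<in> G" for g h
    using \<phi>(1) that by (auto simp: iso_def hom_def perm_group_simps)
  have bij: "bij_betw \<phi> G H" using \<phi>(1) by (simp add: iso_def perm_group_simps)
  have inH: "\<phi> g \<in> H" if "g \<in> G" for g using bij that bij_betwE by blast
  interpret \<phi>: group_hom "perm_group n G" "perm_group n H" \<phi>
    using GD(7) HD(7) \<phi>(1) by (simp add: group_hom_def group_hom_axioms_def iso_def)
  have id: "\<phi> id = id" using \<phi>.hom_one by (simp add: perm_group_simps)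
  have stab: "\<phi> g y = y \<longleftrightarrow> g x = x" if g: "g \<in> G" for g
  proof
    assume "\<phi> g y = y"
    then obtain h where "h \<in> G" "h x = x" "\<phi> g = \<phi> h" using \<phi>(2) inH[OF g]
      by (auto simp: point_stabiliser_eq)
    then show "g x = x" using bij g by (metis bij_betw_def inj_onD)
  qed (use \<phi>(2) g in \<open>auto simp: point_stabiliser_eq\<close>)
  obtain \<beta> where \<beta>: "bij_betw \<beta> {1..n} {1..n}" "\<And>g i. g \<in> G \<Longrightarrow> i \<in> {1..n} \<Longrightarrow> \<beta> (g i) = \<phi> g (\<beta> i)"
  proof (rule equivariant_bijection[OF G x y, of \<phi>])
    show "\<phi> g i \<in> {1..n}" if "g \<in> G" "i \<in> {1..n}" for g i
      using permutes_in_image[OF HD(1)[OF inH[OF that(1)]]] that(2) by blast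
    show "\<exists>g\<in>G. \<phi> g y = j" if j: "j \<in> {1..n}" for j
    proof -
      obtain h where "h \<in> H" "h y = j" using HD(5)[OF y j] by blast
      moreover have "\<phi> ` G = H" using bij by (simp add: bij_betw_def)
      ultimately show ?thesis by blast
    qed
  qed (simp_all add: hom id stab)
  define c where "c i = (if i \<in> {1..n} then \<beta> i else i)" for i
  have c: "c permutes {1..n}"
  proof (rule bij_imp_permutes)
    show "bij_betw c {1..n} {1..n}" using \<beta>(1) by (rule bij_betw_cong[THEN iffD1, rotated]) (simp add: c_def)
  qed (auto simp: c_def)
  have "conj_by c g = \<phi> g" if g: "g \<in> G" for g
  proof
    fix i
    have perms: "conj_by c g permutes {1..n}" "\<phi> g permutes {1..n}"
      using conj_by_permutes[OF c] GD(1) HD(1) inH g by blast+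
    show "conj_by c g i = \<phi> g i"
    proof (cases "i \<in> {1..n}")
      case True
      then have j: "inv' c i \<in> {1..n}" "c (inv' c i) = i"
        using permutes_in_image[OF permutes_inv[OF c]] permutes_inverses[OF c] by blast+
      then have "g (inv' c i) \<in> {1..n}" using permutes_in_image[OF GD(1)[OF g]] by blast
      then show ?thesis using \<beta>(2)[OF g j(1)] j by (simp add: conj_by_def c_def split: if_splits)
    qed (use permutes_not_in perms in metis)
  qed
  then have "conj_by c ` G = \<phi> ` G" by simp
  then have "H = conj_by c ` G" using bij by (simp add: bij_betw_def)
  then show "transitive_perm_group n G \<and> transitive_perm_group n H \<and> (\<exists>c. c permutes {1..n} \<and> H = conj_by c ` G)"
    using G H c by blast
next
  assume "transitive_perm_group n G \<and> transitive_perm_group n H \<and> (\<exists>c. c permutes {1..n} \<and> H = conj_by c ` G)"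
  then obtain c where G: "transitive_perm_group n G" and H: "transitive_perm_group n H"
    and c: "c permutes {1..n}" "H = conj_by c ` G" by blast
  have b: "bij c" using c permutes_bij by blast
  have i: "conj_by c \<in> iso (perm_group n G) (perm_group n H)"
    using inj_on_subset[OF inj_conj_by[OF b]] c(2)
    by (auto simp: iso_def hom_def perm_group_simps conj_by_comp[OF b] bij_betw_def)
  have one: "1 \<in> {1..n}" "c 1 \<in> {1..n}" using n permutes_in_image[OF c(1)] by auto
  have "c (g (1::nat)) = c 1 \<longleftrightarrow> g 1 = 1" for g using b by (metis bij_is_inj injD)
  then have "conj_by c ` point_stabiliser n G 1 = point_stabiliser n H (c 1)"
    using c by (auto simp: point_stabiliser_eq conj_by_apply[OF c(1)])
  then show "(G, H) \<in> perm_iso_rel n"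
    unfolding perm_iso_rel_def pair_iso_def using G H i one by blast
qed

lemma equiv_perm_iso_rel:
  assumes "n > 0"
  shows "equiv {G. transitive_perm_group n G} (perm_iso_rel n)"
proof (rule equivI)
  note iff = perm_iso_rel_iff[OF assms]
  show "refl_on {G. transitive_perm_group n G} (perm_iso_rel n)"
  proof (rule refl_onI)
    fix G assume G: "G \<in> {G. transitive_perm_group n G}"
    have "G = conj_by id ` G" by (simp add: conj_by_def)
    then show "(G, G) \<in> perm_iso_rel n" using G permutes_id iff by blast
  qed
  show "perm_iso_rel n \<subseteq> {G. transitive_perm_group n G} \<times> {G. transitive_perm_group n G}"
    by (auto simp: perm_iso_rel_def)
  show "sym (perm_iso_rel n)"
  proof (rule symI)
    fix G H assume "(G, H) \<in> perm_iso_rel n"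
    then obtain c where c: "c permutes {1..n}" "H = conj_by c ` G" "transitive_perm_group n G" "transitive_perm_group n H"
      by (auto simp: iff)
    have "G = conj_by (inv' c) ` H" using conj_by_inv[OF permutes_bij[OF c(1)]] c(2) by (force simp: image_image)
    then show "(H, G) \<in> perm_iso_rel n" using c permutes_inv[OF c(1)] by (auto simp: iff)
  qed
  show "trans (perm_iso_rel n)"
  proof (rule transI)
    fix G H K assume "(G, H) \<in> perm_iso_rel n" "(H, K) \<in> perm_iso_rel n"
    then obtain c d where c: "c permutes {1..n}" "H = conj_by c ` G" "transitive_perm_group n G" "transitive_perm_group n K"
      and d: "d permutes {1..n}" "K = conj_by d ` H"
      by (auto simp: iff)
    have "K = conj_by (d \<circ> c) ` G"
      using conj_by_conj_by[OF permutes_bij[OF d(1)] permutes_bij[OF c(1)]] c(2) d(2) by (simp add: image_image)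
    then show "(G, K) \<in> perm_iso_rel n" using c d permutes_compose[OF c(1) d(1)] by (auto simp: iff)
  qed
qed

section \<open>Byott's translation for cyclic type\<close>

text \<open>The residues modulo \<open>n\<close> are represented by \<open>{1..n}\<close>, the set permuted by the symmetric group; so \<open>n\<close>
  stands for the class of \<open>0\<close>.\<close>
definition affine_map :: "nat \<Rightarrow> int \<Rightarrow> int \<Rightarrow> (nat \<Rightarrow> nat) \<Rightarrow> bool" where
  "affine_map n a t g \<longleftrightarrow> g permutes {1..n} \<and> (\<forall>i\<in>{1..n}. [int (g i) = a * int i + t] (mod int n))"

definition affine_perms :: "nat \<Rightarrow> (nat \<Rightarrow> nat) set" where
  "affine_perms n = {g. \<exists>a t. affine_map n a t g}"

text \<open>The shift by \<open>1\<close> and back produces the representative in \<open>{1..n}\<close> rather than in \<open>{0..<n}\<close>.\<close>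
definition resid :: "nat \<Rightarrow> int \<Rightarrow> nat" where
  "resid n z = nat ((z - 1) mod int n) + 1"

lemma resid_range: "n > 0 \<Longrightarrow> resid n z \<in> {1..n}"
  by (auto simp: resid_def Suc_le_eq nat_less_iff)

lemma resid_cong: "n > 0 \<Longrightarrow> [int (resid n z) = z] (mod int n)"
proof -
  assume "n > 0"
  then have "int (resid n z) = (z - 1) mod int n + 1" by (simp add: resid_def)
  then show ?thesis by (simp add: cong_def mod_add_left_eq)
qed

lemma cong_imp_eq:
  assumes "i \<in> {1..n}" "j \<in> {1..n}" "[int i = int j] (mod int n)"
  shows "i = j"
proof -
  have "[int i - 1 = int j - 1] (mod int n)" using assms(3) by (rule cong_diff) simp
  then have "int i - 1 = int j - 1" using assms(1,2) by (simp add: cong_def)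
  then show ?thesis by simp
qed

lemma resid_eqI: "n > 0 \<Longrightarrow> i \<in> {1..n} \<Longrightarrow> [z = int i] (mod int n) \<Longrightarrow> resid n z = i"
  by (rule cong_imp_eq[OF resid_range _ cong_trans[OF resid_cong]])

lemma resid_eq_iff: "n > 0 \<Longrightarrow> resid n y = resid n z \<longleftrightarrow> [y = z] (mod int n)"
  by (metis cong_sym cong_trans resid_cong resid_eqI resid_range)

lemma galois_group_is_group:
  assumes "field E" "K \<subseteq> carrier E"
  shows "group (galois_group E K)"
  unfolding galois_group_def
proof (rule group.subgroup_imp_group[OF group_BijGroup], rule group.subgroupI[OF group_BijGroup])
  interpret field E by fact
  let ?A = "{\<psi> \<in> Bij (carrier E). \<psi> \<in> ring_hom E E \<and> (\<forall>a\<in>K. \<psi> a = a)}"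
  show "?A \<subseteq> carrier (BijGroup (carrier E))" by (auto simp: BijGroup_def)
  have "(\<lambda>a\<in>carrier E. a) \<in> ring_hom E E" by (rule ring_hom_memI) auto
  then have "(\<lambda>a\<in>carrier E. a) \<in> ?A" using id_Bij assms(2) by auto
  then show "?A \<noteq> {}" by blast
  show "inv\<^bsub>BijGroup (carrier E)\<^esub> f \<in> ?A" if f: "f \<in> ?A" for f
  proof -
    have bij: "bij_betw f (carrier E) (carrier E)" using f by (simp add: Bij_def)
    then have "f \<in> ring_iso E E" using f by (simp add: ring_iso_def)
    then have "inv_into (carrier E) f \<in> ring_iso E E" by (rule ring_iso_set_sym[OF ring_axioms])
    then have h: "inv_into (carrier E) f \<in> ring_hom E E" by (simp add: ring_iso_def)
    have "(\<lambda>x\<in>carrier E. inv_into (carrier E) f x) \<in> ring_hom E E"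
      using h unfolding ring_hom_def by auto
    moreover have "inv_into (carrier E) f a = a" if "a \<in> K" for a
    proof (rule inv_into_f_eq)
      show "inj_on f (carrier E)" using bij by (simp add: bij_betw_def)
      show "a \<in> carrier E" using that assms(2) by blast
      show "f a = a" using f that by blast
    qed
    moreover have "inv\<^bsub>BijGroup (carrier E)\<^esub> f = (\<lambda>x\<in>carrier E. inv_into (carrier E) f x)"
      using f by (intro inv_BijGroup) simp
    moreover have "(\<lambda>x\<in>carrier E. inv_into (carrier E) f x) \<in> Bij (carrier E)"
      using f by (intro restrict_inv_into_Bij) simp
    ultimately show ?thesis using assms(2) by (simp add: subset_iff)
  qed
  show "f \<otimes>\<^bsub>BijGroup (carrier E)\<^esub> g \<in> ?A" if f: "f \<in> ?A" and g: "g \<in> ?A" for f g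
  proof -
    have e: "f \<otimes>\<^bsub>BijGroup (carrier E)\<^esub> g = compose (carrier E) f g" using f g
      by (simp add: BijGroup_def)
    have "compose (carrier E) f g \<in> ring_hom E E"
      using f g unfolding ring_hom_def compose_def by (auto simp: Pi_def)
    moreover have "compose (carrier E) f g \<in> Bij (carrier E)" using f g by (intro compose_Bij) simp_all
    moreover have "compose (carrier E) f g a = a" if "a \<in> K" for a
      using f g that assms(2) by (auto simp: compose_def)
    ultimately show ?thesis unfolding e by simp
  qed
qed

text \<open>The isomorphism \<open>\<phi>\<close> turns left translation of the cosets of \<open>H\<close> into an action of \<open>G\<close>, for which the coset
  \<open>H\<close> has the same stabiliser as \<open>i0\<close>.\<close>
lemma coset_bijection:
  assumes G: "transitive_perm_group n G" and i0: "i0 \<in> {1..n}" and \<Gamma>: "group \<Gamma>"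
    and \<phi>: "\<phi> \<in> iso (perm_group n G) \<Gamma>" "\<phi> ` point_stabiliser n G i0 = H"
  obtains \<beta> where "bij_betw \<beta> {1..n} (lcosets\<^bsub>\<Gamma>\<^esub> H)"
    "\<And>g i. g \<in> G \<Longrightarrow> i \<in> {1..n} \<Longrightarrow> \<beta> (g i) = left_translation \<Gamma> H (\<phi> g) (\<beta> i)"
    "\<And>\<gamma> C. \<gamma> \<in> carrier \<Gamma> \<Longrightarrow> C \<in> lcosets\<^bsub>\<Gamma>\<^esub> H \<Longrightarrow> left_translation \<Gamma> H \<gamma> C \<in> lcosets\<^bsub>\<Gamma>\<^esub> H"
    "\<And>\<gamma>. \<gamma> \<in> carrier \<Gamma> \<Longrightarrow> left_translation \<Gamma> H \<gamma> \<in> Bij (lcosets\<^bsub>\<Gamma>\<^esub> H)"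
proof -
  note GD = transitive_groupD[OF G]
  interpret \<Gamma>: group \<Gamma> by fact
  interpret \<phi>: group_hom "perm_group n G" \<Gamma> \<phi>
    using GD(7) \<Gamma> \<phi>(1) by (simp add: group_hom_def group_hom_axioms_def iso_def)
  have bij: "bij_betw \<phi> G (carrier \<Gamma>)" using \<phi>(1) by (simp add: iso_def perm_group_simps)
  have "subgroup (point_stabiliser n G i0) (perm_group n G)"
  proof (rule group.subgroupI[OF GD(7)])
    show "inv\<^bsub>perm_group n G\<^esub> g \<in> point_stabiliser n G i0" if "g \<in> point_stabiliser n G i0" for g
    proof -
      have g: "g \<in> G" "g i0 = i0" using that by (auto simp: point_stabiliser_eq)
      have "inv\<^bsub>perm_group n G\<^esub> g \<in> G" using group.inv_closed[OF GD(7), of g] g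
        by (simp add: perm_group_simps)
      moreover have "inv\<^bsub>perm_group n G\<^esub> g \<circ> g = id" using group.l_inv[OF GD(7), of g] g
        by (simp add: perm_group_simps)
      ultimately show ?thesis using g by (auto simp: point_stabiliser_eq fun_eq_iff) metis
    qed
  qed (use GD in \<open>auto simp: point_stabiliser_eq perm_group_simps\<close>)
  then have H: "subgroup H \<Gamma>" using \<phi>.subgroup_img_is_subgroup \<phi>(2) by blast
  let ?Y = "lcosets\<^bsub>\<Gamma>\<^esub> H" and ?\<tau> = "left_translation \<Gamma> H"
  have Hc: "H \<subseteq> carrier \<Gamma>" using subgroup.subset[OF H] .
  have Y: "C \<in> ?Y \<longleftrightarrow> (\<exists>a\<in>carrier \<Gamma>. C = a <#\<^bsub>\<Gamma>\<^esub> H)" for C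
    by (auto simp: LCOSETS_def)
  have tau: "?\<tau> \<gamma> (a <#\<^bsub>\<Gamma>\<^esub> H) = (\<gamma> \<otimes>\<^bsub>\<Gamma>\<^esub> a) <#\<^bsub>\<Gamma>\<^esub> H"
    if "\<gamma> \<in> carrier \<Gamma>" "a \<in> carrier \<Gamma>" for \<gamma> a
    using that Y \<Gamma>.lcos_m_assoc[OF Hc] unfolding left_translation_def by auto
  have closed: "?\<tau> \<gamma> C \<in> ?Y" if "\<gamma> \<in> carrier \<Gamma>" "C \<in> ?Y" for \<gamma> C
    using that tau[of \<gamma>] Y \<Gamma>.m_closed by fastforce
  have comp: "?\<tau> (\<gamma> \<otimes>\<^bsub>\<Gamma>\<^esub> \<delta>) C = ?\<tau> \<gamma> (?\<tau> \<delta> C)"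
    if "\<gamma> \<in> carrier \<Gamma>" "\<delta> \<in> carrier \<Gamma>" "C \<in> ?Y" for \<gamma> \<delta> C
    using that tau Y by (auto simp: \<Gamma>.m_assoc)
  have one: "?\<tau> \<one>\<^bsub>\<Gamma>\<^esub> C = C" if C: "C \<in> ?Y" for C
  proof -
    obtain a where a: "a \<in> carrier \<Gamma>" "C = a <#\<^bsub>\<Gamma>\<^esub> H" using C Y by blast
    then show ?thesis using tau[OF \<Gamma>.one_closed a(1)] by simp
  qed
  have Bij: "?\<tau> \<gamma> \<in> Bij ?Y" if g: "\<gamma> \<in> carrier \<Gamma>" for \<gamma>
  proof -
    have "bij_betw (?\<tau> \<gamma>) ?Y ?Y"
    proof (rule bij_betwI[where g="?\<tau> (inv\<^bsub>\<Gamma>\<^esub> \<gamma>)"])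
      show "?\<tau> (inv\<^bsub>\<Gamma>\<^esub> \<gamma>) (?\<tau> \<gamma> C) = C" if "C \<in> ?Y" for C
        using comp[of "inv\<^bsub>\<Gamma>\<^esub> \<gamma>" \<gamma> C] one g that by simp
      show "?\<tau> \<gamma> (?\<tau> (inv\<^bsub>\<Gamma>\<^esub> \<gamma>) C) = C" if "C \<in> ?Y" for C
        using comp[of \<gamma> "inv\<^bsub>\<Gamma>\<^esub> \<gamma>" C] one g that by simp
    qed (use closed g in auto)
    then show ?thesis unfolding Bij_def left_translation_def by simp
  qed
  have HY: "H \<in> ?Y" using Y \<Gamma>.lcos_mult_one[OF Hc] by (metis \<Gamma>.one_closed)
  have tauH: "?\<tau> \<gamma> H = \<gamma> <#\<^bsub>\<Gamma>\<^esub> H" if "\<gamma> \<in> carrier \<Gamma>" for \<gamma>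
    using HY by (simp add: left_translation_def)
  have stabH: "\<gamma> <#\<^bsub>\<Gamma>\<^esub> H = H \<longleftrightarrow> \<gamma> \<in> H"
    if "\<gamma> \<in> carrier \<Gamma>" for \<gamma>
  proof
    assume "\<gamma> <#\<^bsub>\<Gamma>\<^esub> H = H"
    moreover have "\<gamma> \<in> \<gamma> <#\<^bsub>\<Gamma>\<^esub> H" using subgroup.one_closed[OF H] that
      by (force simp: l_coset_def)
    ultimately show "\<gamma> \<in> H" by simp
  next
    assume "\<gamma> \<in> H"
    then show "\<gamma> <#\<^bsub>\<Gamma>\<^esub> H = H"
      using \<Gamma>.l_repr_independence[of \<gamma> "\<one>\<^bsub>\<Gamma>\<^esub>" H] \<Gamma>.lcos_mult_one[OF Hc] H
      by simp
  qed
  have inG: "\<phi> g \<in> carrier \<Gamma>" if "g \<in> G" for g using bij that bij_betwE by blast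
  have hom: "\<phi> (g \<circ> h) = \<phi> g \<otimes>\<^bsub>\<Gamma>\<^esub> \<phi> h" if "g \<in> G" "h \<in> G" for g h
    using \<phi>.hom_mult[of g h] that by (simp add: perm_group_simps)
  have phi_id: "\<phi> id = \<one>\<^bsub>\<Gamma>\<^esub>" using \<phi>.hom_one by (simp add: perm_group_simps)
  have phiH: "\<phi> g \<in> H \<longleftrightarrow> g i0 = i0" if g: "g \<in> G" for g
  proof
    assume "\<phi> g \<in> H"
    then obtain h where "h \<in> G" "h i0 = i0" "\<phi> g = \<phi> h" using \<phi>(2) by (auto simp: point_stabiliser_eq)
    then show "g i0 = i0" using bij g by (metis bij_betw_def inj_onD)
  qed (use \<phi>(2) g in \<open>auto simp: point_stabiliser_eq\<close>)
  obtain \<beta> where "bij_betw \<beta> {1..n} ?Y" "\<And>g i. g \<in> G \<Longrightarrow> i \<in> {1..n} \<Longrightarrow> \<beta> (g i) = ?\<tau> (\<phi> g) (\<beta> i)"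
  proof (rule equivariant_bijection[OF G i0 HY, of "\<lambda>g. ?\<tau> (\<phi> g)"])
    show "\<exists>g\<in>G. ?\<tau> (\<phi> g) H = C" if C: "C \<in> ?Y" for C
    proof -
      obtain \<gamma> where "\<gamma> \<in> carrier \<Gamma>" "C = \<gamma> <#\<^bsub>\<Gamma>\<^esub> H" using C Y by blast
      moreover then obtain g where "g \<in> G" "\<phi> g = \<gamma>" using bij by (metis bij_betw_def imageE)
      ultimately show ?thesis using tauH[of \<gamma>] by (intro bexI[of _ g]) simp_all
    qed
  qed (simp_all add: closed inG hom comp phi_id one tauH stabH phiH)
  then show ?thesis using that closed Bij by blast
qed

lemma BijGroup_mult_apply:
  "f \<in> Bij Y \<Longrightarrow> g \<in> Bij Y \<Longrightarrow> C \<in> Y \<Longrightarrow> (f \<otimes>\<^bsub>BijGroup Y\<^esub> g) C = f (g C)"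
  by (simp add: BijGroup_def compose_def)

lemma permutes_between_bijections:
  assumes \<beta>: "bij_betw \<beta> {1..n::nat} Y" and \<beta>': "bij_betw \<beta>' {1..n} Y"
  obtains c where "c permutes {1..n}" "\<And>i. i \<in> {1..n} \<Longrightarrow> \<beta>' (c i) = \<beta> i"
proof -
  define c where "c i = (if i \<in> {1..n} then inv_into {1..n} \<beta>' (\<beta> i) else i)" for i
  have "bij_betw (inv_into {1..n} \<beta>' \<circ> \<beta>) {1..n} {1..n}"
    using bij_betw_trans[OF \<beta> bij_betw_inv_into[OF \<beta>']] .
  then have "bij_betw c {1..n} {1..n}"
    by (rule bij_betw_cong[THEN iffD1, rotated]) (simp add: c_def)
  then have "c permutes {1..n}" by (rule bij_imp_permutes) (auto simp: c_def)
  moreover have "\<beta>' (c i) = \<beta> i" if "i \<in> {1..n}" for i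
    using that bij_betw_inv_into_right[OF \<beta>'] bij_betwE[OF \<beta>] by (simp add: c_def)
  ultimately show ?thesis using that by blast
qed

text \<open>Let \<open>P\<close> generate \<open>N\<close>. By regularity, every element of \<open>Y\<close> is \<open>P\<^sup>i y0\<close> for a unique \<open>i\<close> modulo \<open>n\<close>; this is
  \<open>\<beta>\<close>. If \<open>\<tau>\<close> normalises \<open>N\<close>, then \<open>\<tau> P = P\<^sup>a \<tau>\<close> for some \<open>a\<close>, and \<open>\<tau> y0 = P\<^sup>t y0\<close> for some \<open>t\<close>; so \<open>\<tau>\<close> maps
  \<open>P\<^sup>i y0\<close> to \<open>P\<^sup>a\<^sup>i\<^sup>+\<^sup>t y0\<close>.\<close>
lemma normaliser_of_regular_cyclic_is_affine:
  assumes n: "n > 0" and sub: "subgroup N (BijGroup Y)" and reg: "regular_on N Y"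
    and cyc: "BijGroup Y \<lparr>carrier := N\<rparr> \<cong> integer_mod_group n" and y0: "y0 \<in> Y"
  obtains \<beta> where "bij_betw \<beta> {1..n} Y"
    "\<And>\<tau>. \<tau> \<in> Bij Y \<Longrightarrow> (\<forall>f\<in>N. \<tau> \<otimes>\<^bsub>BijGroup Y\<^esub> f \<otimes>\<^bsub>BijGroup Y\<^esub> inv\<^bsub>BijGroup Y\<^esub> \<tau> \<in> N) \<Longrightarrow>
      \<exists>a t. \<forall>i\<in>{1..n}. \<tau> (\<beta> i) = \<beta> (resid n (a * int i + t))"
proof -
  interpret B: group "BijGroup Y" by (rule group_BijGroup)
  have NB: "N \<subseteq> Bij Y" using subgroup.subset[OF sub] by (simp add: BijGroup_def)
  have gN: "group (BijGroup Y \<lparr>carrier := N\<rparr>)" by (rule B.subgroup_imp_group[OF sub])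
  obtain \<psi> where \<psi>: "\<psi> \<in> iso (integer_mod_group n) (BijGroup Y \<lparr>carrier := N\<rparr>)"
    using group.iso_sym[OF gN cyc] by (auto simp: is_iso_def)
  have cZ: "carrier (integer_mod_group n) = {0..<int n}" using n by (simp add: carrier_integer_mod_group)
  define P where "P z = \<psi> (z mod int n)" for z
  have zc: "z mod int n \<in> carrier (integer_mod_group n)" for z using n by (simp add: cZ)
  have bij: "bij_betw \<psi> {0..<int n} N" using \<psi> by (simp add: iso_def cZ)
  have PN: "P z \<in> N" for z using bij_betwE[OF bij] zc[of z] by (simp add: P_def cZ)
  have PB: "P z \<in> Bij Y" for z using PN NB by blast
  have PY: "P z C \<in> Y" if "C \<in> Y" for z C using Bij_imp_funcset[OF PB] that by blast
  have Padd: "P (y + z) C = P y (P z C)" if "C \<in> Y" for y z C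
  proof -
    have "\<psi> ((y mod int n) \<otimes>\<^bsub>integer_mod_group n\<^esub> (z mod int n))
        = \<psi> (y mod int n) \<otimes>\<^bsub>BijGroup Y \<lparr>carrier := N\<rparr>\<^esub> \<psi> (z mod int n)"
      using \<psi> zc by (intro hom_mult) (simp_all add: iso_def)
    then have "P (y + z) = P y \<otimes>\<^bsub>BijGroup Y\<^esub> P z" by (simp add: P_def mod_add_eq)
    then show ?thesis using BijGroup_mult_apply[OF PB PB that] by simp
  qed
  have Psurj: "\<exists>z. f = P z" if "f \<in> N" for f
  proof -
    obtain z where "z \<in> {0..<int n}" "f = \<psi> z" using bij \<open>f \<in> N\<close> by (metis bij_betw_def imageE)
    then show ?thesis by (auto simp: P_def intro!: exI[of _ z])
  qed
  have Pcong: "P y = P z \<longleftrightarrow> [y = z] (mod int n)" for y z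
    using inj_on_eq_iff[OF bij_betw_imp_inj_on[OF bij]] zc[of y] zc[of z]
    unfolding P_def cong_def cZ by blast
  have uniq: "f = g" if "f \<in> N" "g \<in> N" "f C = g C" "C \<in> Y" for f g C
  proof -
    have "g C \<in> Y" using that NB Bij_imp_funcset by blast
    then show ?thesis using reg that unfolding regular_on_def by metis
  qed
  define \<beta> where "\<beta> i = P (int i) y0" for i
  have \<beta>r: "\<beta> (resid n z) = P z y0" for z
    using Pcong[of "int (resid n z)" z] resid_cong[OF n] by (simp add: \<beta>_def)
  have \<beta>bij: "bij_betw \<beta> {1..n} Y"
    unfolding bij_betw_def
  proof
    show "inj_on \<beta> {1..n}"
    proof (rule inj_onI)
      fix i j assume ij: "i \<in> {1..n}" "j \<in> {1..n}" "\<beta> i = \<beta> j"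
      then have "P (int i) = P (int j)" using uniq[OF PN PN _ y0] by (simp add: \<beta>_def)
      then show "i = j" using cong_imp_eq[OF ij(1,2)] Pcong by blast
    qed
    show "\<beta> ` {1..n} = Y"
    proof
      show "\<beta> ` {1..n} \<subseteq> Y" using PY[OF y0] by (auto simp: \<beta>_def)
      show "Y \<subseteq> \<beta> ` {1..n}"
      proof
        fix C assume "C \<in> Y"
        then obtain f where "f \<in> N" "f y0 = C" using reg y0 unfolding regular_on_def by metis
        then obtain z where "P z y0 = C" using Psurj by blast
        then have "C = \<beta> (resid n z)" using \<beta>r by simp
        then show "C \<in> \<beta> ` {1..n}" using resid_range[OF n] by blast
      qed
    qed
  qed
  have "\<exists>a t. \<forall>i\<in>{1..n}. \<tau> (\<beta> i) = \<beta> (resid n (a * int i + t))"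
    if \<tau>: "\<tau> \<in> Bij Y" and norm: "\<forall>f\<in>N. \<tau> \<otimes>\<^bsub>BijGroup Y\<^esub> f \<otimes>\<^bsub>BijGroup Y\<^esub> inv\<^bsub>BijGroup Y\<^esub> \<tau> \<in> N" for \<tau>
  proof -
    have \<tau>c: "\<tau> \<in> carrier (BijGroup Y)" "P 1 \<in> carrier (BijGroup Y)" using \<tau> PB
      by (simp_all add: BijGroup_def)
    obtain a where a: "\<tau> \<otimes>\<^bsub>BijGroup Y\<^esub> P 1 \<otimes>\<^bsub>BijGroup Y\<^esub> inv\<^bsub>BijGroup Y\<^esub> \<tau> = P a"
      using norm PN Psurj by metis
    have "\<tau> \<otimes>\<^bsub>BijGroup Y\<^esub> P 1 = P a \<otimes>\<^bsub>BijGroup Y\<^esub> \<tau>"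
      unfolding a[symmetric] using \<tau>c by (simp add: B.m_assoc)
    then have step: "\<tau> (P 1 C) = P a (\<tau> C)" if "C \<in> Y" for C
      using BijGroup_mult_apply[OF \<tau> PB that] BijGroup_mult_apply[OF PB \<tau> that] by metis
    have \<tau>Y: "\<tau> C \<in> Y" if "C \<in> Y" for C using Bij_imp_funcset[OF \<tau>] that by blast
    have P0: "P 0 C = C" if "C \<in> Y" for C
    proof -
      have "P 0 (P 0 C) = P 0 C" using Padd[OF that, of 0 0] by simp
      moreover have "inj_on (P 0) Y" using PB[of 0] by (simp add: Bij_def bij_betw_def)
      ultimately show ?thesis using PY that by (metis inj_onD)
    qed
    have pow: "\<tau> (P (int k) C) = P (a * int k) (\<tau> C)" if "C \<in> Y" for k C
    proof (induction k)
      case 0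
      show ?case using P0 that \<tau>Y by simp
    next
      case (Suc k)
      have "\<tau> (P (int (Suc k)) C) = \<tau> (P 1 (P (int k) C))" using Padd[OF that, of 1 "int k"] by simp
      also have "\<dots> = P a (P (a * int k) (\<tau> C))" using step[OF PY[OF that]] Suc by simp
      also have "\<dots> = P (a * int (Suc k)) (\<tau> C)" using Padd[OF \<tau>Y[OF that]] by (simp add: algebra_simps)
      finally show ?case .
    qed
    obtain f where "f \<in> N" "f y0 = \<tau> y0" using reg y0 \<tau>Y[OF y0] unfolding regular_on_def by metis
    then obtain t where t: "\<tau> y0 = P t y0" using Psurj by metis
    have "\<tau> (\<beta> i) = \<beta> (resid n (a * int i + t))" for i
      using pow[OF y0, of i] Padd[OF y0] \<beta>r t by (simp add: \<beta>_def)
    then show ?thesis by blast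
  qed
  then show ?thesis using that \<beta>bij by blast
qed

lemma affine_if_realised:
  fixes u :: "'u itself"
  assumes n: "n > 0" and G: "transitive_perm_group n G"
    and real: "realised_by_hopf_galois u n G (integer_mod_group n)"
  shows "\<exists>c. c permutes {1..n} \<and> conj_by c ` G \<subseteq> affine_perms n"
proof -
  note GD = transitive_groupD[OF G]
  obtain E :: "'u ring" and K L i0 where i0: "i0 \<in> {1..n}" and gc: "is_galois_closure E K L"
    and pi: "pair_iso (perm_group n G) (point_stabiliser n G i0) (galois_group E K) (carrier (galois_group E L))"
    and hg: "admits_hopf_galois_structure E K L (integer_mod_group n)"
    using real unfolding realised_by_hopf_galois_def by blast
  define \<Gamma> where "\<Gamma> = galois_group E K"
  define H where "H = carrier (galois_group E L)"
  obtain \<phi> where \<phi>: "\<phi> \<in> iso (perm_group n G) \<Gamma>" "\<phi> ` point_stabiliser n G i0 = H"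
    using pi unfolding pair_iso_def \<Gamma>_def H_def by blast
  have "field E" "K \<subseteq> carrier E" using gc unfolding is_galois_closure_def by (auto dest: subfieldE(3))
  then have \<Gamma>: "group \<Gamma>" unfolding \<Gamma>_def by (rule galois_group_is_group)
  let ?Y = "lcosets\<^bsub>\<Gamma>\<^esub> H" and ?\<tau> = "left_translation \<Gamma> H"
  obtain \<beta> where \<beta>: "bij_betw \<beta> {1..n} ?Y"
    "\<And>g i. g \<in> G \<Longrightarrow> i \<in> {1..n} \<Longrightarrow> \<beta> (g i) = ?\<tau> (\<phi> g) (\<beta> i)"
    and \<tau>B: "\<And>\<gamma>. \<gamma> \<in> carrier \<Gamma> \<Longrightarrow> ?\<tau> \<gamma> \<in> Bij ?Y"
    using coset_bijection[OF G i0 \<Gamma> \<phi>] by metis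
  obtain N where N: "greither_pareigis_subgroup \<Gamma> H N" and cyc: "BijGroup ?Y \<lparr>carrier := N\<rparr> \<cong> integer_mod_group n"
    using hg unfolding admits_hopf_galois_structure_def Let_def \<Gamma>_def H_def by blast
  have N': "subgroup N (BijGroup ?Y)" "regular_on N ?Y"
    "\<And>g. g \<in> carrier \<Gamma> \<Longrightarrow> \<forall>f\<in>N. ?\<tau> g \<otimes>\<^bsub>BijGroup ?Y\<^esub> f \<otimes>\<^bsub>BijGroup ?Y\<^esub> inv\<^bsub>BijGroup ?Y\<^esub> (?\<tau> g) \<in> N"
    using N unfolding greither_pareigis_subgroup_def Let_def by auto
  have y0: "\<beta> i0 \<in> ?Y" using bij_betwE[OF \<beta>(1)] i0 by blast
  obtain \<beta>' where \<beta>': "bij_betw \<beta>' {1..n} ?Y"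
    "\<And>\<tau>. \<tau> \<in> Bij ?Y \<Longrightarrow> (\<forall>f\<in>N. \<tau> \<otimes>\<^bsub>BijGroup ?Y\<^esub> f \<otimes>\<^bsub>BijGroup ?Y\<^esub> inv\<^bsub>BijGroup ?Y\<^esub> \<tau> \<in> N) \<Longrightarrow>
      \<exists>a t. \<forall>i\<in>{1..n}. \<tau> (\<beta>' i) = \<beta>' (resid n (a * int i + t))"
    using normaliser_of_regular_cyclic_is_affine[OF n N'(1,2) cyc y0] by metis
  obtain c where c: "c permutes {1..n}" "\<And>i. i \<in> {1..n} \<Longrightarrow> \<beta>' (c i) = \<beta> i"
    using permutes_between_bijections[OF \<beta>(1) \<beta>'(1)] by metis
  have "conj_by c g \<in> affine_perms n" if g: "g \<in> G" for g
  proof -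
    have \<phi>g: "\<phi> g \<in> carrier \<Gamma>" using \<phi>(1) g by (auto simp: iso_def hom_def perm_group_simps)
    obtain a t where at: "\<And>i. i \<in> {1..n} \<Longrightarrow> ?\<tau> (\<phi> g) (\<beta>' i) = \<beta>' (resid n (a * int i + t))"
      using \<beta>'(2)[OF \<tau>B[OF \<phi>g] N'(3)[OF \<phi>g]] by blast
    have "[int (conj_by c g j) = a * int j + t] (mod int n)" if j: "j \<in> {1..n}" for j
    proof -
      let ?i = "inv' c j"
      have i: "?i \<in> {1..n}" "c ?i = j"
        using permutes_in_image[OF permutes_inv[OF c(1)]] permutes_inverses[OF c(1)] j by blast+
      have gi: "g ?i \<in> {1..n}" using permutes_in_image[OF GD(1)[OF g]] i by blast
      have "\<beta>' (c (g ?i)) = ?\<tau> (\<phi> g) (\<beta>' j)"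
        using c(2)[OF gi] \<beta>(2)[OF g i(1)] c(2)[OF i(1)] i(2) by simp
      also have "\<dots> = \<beta>' (resid n (a * int j + t))" by (rule at[OF j])
      finally have "c (g ?i) = resid n (a * int j + t)"
        using \<beta>'(1) resid_range[OF n] permutes_in_image[OF c(1)] gi by (meson bij_betw_def inj_onD)
      then show ?thesis using resid_cong[OF n] by (simp add: conj_by_def)
    qed
    then show ?thesis using conj_by_permutes[OF c(1) GD(1)[OF g]] unfolding affine_perms_def affine_map_def by blast
  qed
  then show ?thesis using c(1) by blast
qed

text \<open>\<open>N\<close> consists of the translations; an affine permutation with multiplier \<open>a\<close> conjugates the translation by
  \<open>z\<close> to the translation by \<open>a * z\<close>.\<close>
lemma regular_cyclic_of_translations:
  assumes n: "n > 0" and \<beta>: "bij_betw \<beta> {1..n} Y"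
  obtains N where "subgroup N (BijGroup Y)" "regular_on N Y" "BijGroup Y \<lparr>carrier := N\<rparr> \<cong> integer_mod_group n"
    "\<And>\<tau> a t. \<tau> \<in> Bij Y \<Longrightarrow> \<forall>i\<in>{1..n}. \<tau> (\<beta> i) = \<beta> (resid n (a * int i + t)) \<Longrightarrow>
      \<forall>f\<in>N. \<tau> \<otimes>\<^bsub>BijGroup Y\<^esub> f \<otimes>\<^bsub>BijGroup Y\<^esub> inv\<^bsub>BijGroup Y\<^esub> \<tau> \<in> N"
proof -
  interpret B: group "BijGroup Y" by (rule group_BijGroup)
  have bc: "carrier (BijGroup Y) = Bij Y" by (simp add: BijGroup_def)
  define P where "P z = (\<lambda>C\<in>Y. \<beta> (resid n (int (inv_into {1..n} \<beta> C) + z)))" for z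
  have \<beta>Y: "\<beta> i \<in> Y" if "i \<in> {1..n}" for i using bij_betwE[OF \<beta>] that by blast
  have \<beta>rY: "\<beta> (resid n z) \<in> Y" for z using \<beta>Y resid_range[OF n] by blast
  have \<beta>req: "\<beta> (resid n y) = \<beta> (resid n z) \<longleftrightarrow> [y = z] (mod int n)" for y z
    using inj_on_eq_iff[OF bij_betw_imp_inj_on[OF \<beta>] resid_range[OF n] resid_range[OF n]] resid_eq_iff[OF n]
    by blast
  have Y: "\<exists>z. C = \<beta> (resid n z)" if C: "C \<in> Y" for C
  proof -
    obtain i where i: "i \<in> {1..n}" "C = \<beta> i" using \<beta> C by (metis bij_betw_def imageE)
    then show ?thesis using resid_eqI[OF n i(1) cong_refl] by metis
  qed
  have P: "P z (\<beta> (resid n y)) = \<beta> (resid n (y + z))" for y z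
  proof -
    have "inv_into {1..n} \<beta> (\<beta> (resid n y)) = resid n y"
      using \<beta> resid_range[OF n] by (metis bij_betw_def inv_into_f_f)
    moreover have "[int (resid n y) + z = y + z] (mod int n)" using resid_cong[OF n] by (rule cong_add) simp
    ultimately show ?thesis using \<beta>rY \<beta>req by (simp add: P_def)
  qed
  have PY: "P z C \<in> Y" if "C \<in> Y" for z C using Y[OF that] P \<beta>rY by metis
  have Padd: "P y (P z C) = P (y + z) C" if "C \<in> Y" for y z C
    using Y[OF that] P by (metis add.assoc add.commute)
  have P0: "P 0 C = C" if "C \<in> Y" for C using Y[OF that] P by (metis add.right_neutral)
  have PB: "P z \<in> Bij Y" for z
  proof -
    have "bij_betw (P z) Y Y"
      by (rule bij_betwI[where g="P (- z)"]) (auto simp: PY Padd P0)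
    then show ?thesis by (simp add: Bij_def P_def)
  qed
  have Bij_eqI: "f = g" if "f \<in> Bij Y" "g \<in> Bij Y" "\<And>C. C \<in> Y \<Longrightarrow> f C = g C" for f g
    using that Bij_imp_extensional by (metis extensionalityI)
  have Pmult: "P y \<otimes>\<^bsub>BijGroup Y\<^esub> P z = P (y + z)" for y z
  proof (rule Bij_eqI)
    show "P y \<otimes>\<^bsub>BijGroup Y\<^esub> P z \<in> Bij Y" using B.m_closed[of "P y" "P z"] PB bc by simp
  qed (simp_all add: PB BijGroup_mult_apply Padd)
  have Pone: "\<one>\<^bsub>BijGroup Y\<^esub> = P 0"
    by (rule Bij_eqI) (use B.one_closed bc PB P0 in \<open>auto simp: BijGroup_def\<close>)
  have Pinv: "inv\<^bsub>BijGroup Y\<^esub> (P z) = P (- z)" for z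
    by (rule B.inv_equality) (simp_all add: Pmult Pone PB bc)
  have Pcong: "P y = P z \<longleftrightarrow> [y = z] (mod int n)" for y z
  proof
    assume "P y = P z"
    then have "\<beta> (resid n (0 + y)) = \<beta> (resid n (0 + z))" using P[of _ 0] by metis
    then show "[y = z] (mod int n)" using \<beta>req by simp
  next
    assume "[y = z] (mod int n)"
    then have "[x + y = x + z] (mod int n)" for x by (rule cong_add[OF cong_refl])
    then show "P y = P z" using Y P \<beta>req by (intro Bij_eqI PB) metis
  qed
  let ?N = "range P"
  have sub: "subgroup ?N (BijGroup Y)"
    by (rule B.subgroupI) (use PB bc in \<open>auto simp: Pinv Pmult\<close>)
  have reg: "regular_on ?N Y"
    unfolding regular_on_def
  proof (intro ballI)
    fix C D assume "C \<in> Y" "D \<in> Y"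
    then obtain y z where yz: "C = \<beta> (resid n y)" "D = \<beta> (resid n z)" using Y by metis
    show "\<exists>!f \<in> ?N. f C = D"
    proof (rule ex1I[of _ "P (z - y)"])
      show "P (z - y) \<in> ?N \<and> P (z - y) C = D" using P yz by simp
      fix f assume "f \<in> ?N \<and> f C = D"
      then obtain w where w: "f = P w" "P w C = D" by blast
      then have "[y + w = z] (mod int n)" using P yz \<beta>req by simp
      then have "[y + w - y = z - y] (mod int n)" by (rule cong_diff) simp
      then show "f = P (z - y)" using w Pcong by simp
    qed
  qed
  have cZ: "carrier (integer_mod_group n) = {0..<int n}" using n by (simp add: carrier_integer_mod_group)
  have "P \<in> iso (integer_mod_group n) (BijGroup Y \<lparr>carrier := ?N\<rparr>)"
  proof (rule isoI)
    show "P \<in> hom (integer_mod_group n) (BijGroup Y \<lparr>carrier := ?N\<rparr>)"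
      by (auto simp: hom_def Pmult Pcong)
    have "inj_on P {0..<int n}" by (auto simp: inj_on_def Pcong cong_def)
    moreover have "P ` {0..<int n} = ?N"
    proof -
      have "P z = P (z mod int n)" "z mod int n \<in> {0..<int n}" for z using n by (simp_all add: Pcong)
      then show ?thesis by blast
    qed
    ultimately show "bij_betw P (carrier (integer_mod_group n)) (carrier (BijGroup Y \<lparr>carrier := ?N\<rparr>))"
      by (simp add: bij_betw_def cZ)
  qed
  then have cyc: "BijGroup Y \<lparr>carrier := ?N\<rparr> \<cong> integer_mod_group n"
    using group.iso_sym[OF group_integer_mod_group] by (auto simp: is_iso_def)
  have norm: "\<forall>f\<in>?N. \<tau> \<otimes>\<^bsub>BijGroup Y\<^esub> f \<otimes>\<^bsub>BijGroup Y\<^esub> inv\<^bsub>BijGroup Y\<^esub> \<tau> \<in> ?N"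
    if \<tau>: "\<tau> \<in> Bij Y" and at: "\<forall>i\<in>{1..n}. \<tau> (\<beta> i) = \<beta> (resid n (a * int i + t))" for \<tau> a t
  proof
    fix f assume "f \<in> ?N"
    then obtain z where f: "f = P z" by blast
    have \<tau>c: "\<tau> \<in> carrier (BijGroup Y)" and Pc: "P y \<in> carrier (BijGroup Y)" for y using \<tau> PB bc
      by auto
    have \<tau>r: "\<tau> (\<beta> (resid n y)) = \<beta> (resid n (a * y + t))" for y
    proof -
      have "[a * int (resid n y) + t = a * y + t] (mod int n)"
        using resid_cong[OF n] by (intro cong_add cong_mult) auto
      then show ?thesis using at resid_range[OF n] \<beta>req by metis
    qed
    have "\<tau> \<otimes>\<^bsub>BijGroup Y\<^esub> P z = P (a * z) \<otimes>\<^bsub>BijGroup Y\<^esub> \<tau>"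
    proof (rule Bij_eqI)
      show "\<tau> \<otimes>\<^bsub>BijGroup Y\<^esub> P z \<in> Bij Y" "P (a * z) \<otimes>\<^bsub>BijGroup Y\<^esub> \<tau> \<in> Bij Y"
        using B.m_closed PB \<tau> bc by metis+
      fix C assume C: "C \<in> Y"
      then obtain y where y: "C = \<beta> (resid n y)" using Y by blast
      have "\<tau> (P z C) = P (a * z) (\<tau> C)" unfolding y P \<tau>r by (simp add: algebra_simps)
      then show "(\<tau> \<otimes>\<^bsub>BijGroup Y\<^esub> P z) C = (P (a * z) \<otimes>\<^bsub>BijGroup Y\<^esub> \<tau>) C"
        by (simp add: BijGroup_mult_apply \<tau> PB C)
    qed
    then have "\<tau> \<otimes>\<^bsub>BijGroup Y\<^esub> f \<otimes>\<^bsub>BijGroup Y\<^esub> inv\<^bsub>BijGroup Y\<^esub> \<tau> = P (a * z)"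
      unfolding f using \<tau>c Pc[of "a * z"] by (simp add: B.m_assoc)
    then show "\<tau> \<otimes>\<^bsub>BijGroup Y\<^esub> f \<otimes>\<^bsub>BijGroup Y\<^esub> inv\<^bsub>BijGroup Y\<^esub> \<tau> \<in> ?N"
      by simp
  qed
  show ?thesis by (rule that[OF sub reg cyc]) (rule norm; assumption)
qed

lemma realised_if_affine:
  assumes inf: "infinite (UNIV :: 'u set)" and n: "n > 0" and G: "transitive_perm_group n G"
    and c: "c permutes {1..n}" "conj_by c ` G \<subseteq> affine_perms n"
  shows "realised_by_hopf_galois TYPE('u) n G (integer_mod_group n)"
proof -
  note GD = transitive_groupD[OF G]
  have i0: "1 \<in> {1..n}" using n by auto
  obtain E :: "'u ring" and K L where gc: "is_galois_closure E K L" and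
    pi: "pair_iso (perm_group n G) (point_stabiliser n G 1) (galois_group E K) (carrier (galois_group E L))"
    using transitive_group_is_galois_group[OF inf G i0] by blast
  define \<Gamma> where "\<Gamma> = galois_group E K"
  define H where "H = carrier (galois_group E L)"
  obtain \<phi> where \<phi>: "\<phi> \<in> iso (perm_group n G) \<Gamma>" "\<phi> ` point_stabiliser n G 1 = H"
    using pi unfolding pair_iso_def \<Gamma>_def H_def by blast
  have "field E" "K \<subseteq> carrier E" using gc unfolding is_galois_closure_def by (auto dest: subfieldE(3))
  then have \<Gamma>: "group \<Gamma>" unfolding \<Gamma>_def by (rule galois_group_is_group)
  let ?Y = "lcosets\<^bsub>\<Gamma>\<^esub> H" and ?\<tau> = "left_translation \<Gamma> H"
  obtain \<beta> where \<beta>: "bij_betw \<beta> {1..n} ?Y"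
    "\<And>g i. g \<in> G \<Longrightarrow> i \<in> {1..n} \<Longrightarrow> \<beta> (g i) = ?\<tau> (\<phi> g) (\<beta> i)"
    and \<tau>B: "\<And>\<gamma>. \<gamma> \<in> carrier \<Gamma> \<Longrightarrow> ?\<tau> \<gamma> \<in> Bij ?Y"
    using coset_bijection[OF G i0 \<Gamma> \<phi>] by metis
  define \<beta>' where "\<beta>' = \<beta> \<circ> inv' c"
  have ci: "inv' c permutes {1..n}" using permutes_inv[OF c(1)] .
  have \<beta>': "bij_betw \<beta>' {1..n} ?Y"
    unfolding \<beta>'_def by (rule bij_betw_trans[OF permutes_imp_bij[OF ci] \<beta>(1)])
  obtain N where N: "subgroup N (BijGroup ?Y)" "regular_on N ?Y" "BijGroup ?Y \<lparr>carrier := N\<rparr> \<cong> integer_mod_group n"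
    and norm: "\<And>\<tau> a t. \<tau> \<in> Bij ?Y \<Longrightarrow> \<forall>i\<in>{1..n}. \<tau> (\<beta>' i) = \<beta>' (resid n (a * int i + t)) \<Longrightarrow>
      \<forall>f\<in>N. \<tau> \<otimes>\<^bsub>BijGroup ?Y\<^esub> f \<otimes>\<^bsub>BijGroup ?Y\<^esub> inv\<^bsub>BijGroup ?Y\<^esub> \<tau> \<in> N"
    using regular_cyclic_of_translations[OF n \<beta>'] by metis
  have "\<forall>f\<in>N. ?\<tau> \<gamma> \<otimes>\<^bsub>BijGroup ?Y\<^esub> f \<otimes>\<^bsub>BijGroup ?Y\<^esub> inv\<^bsub>BijGroup ?Y\<^esub> (?\<tau> \<gamma>) \<in> N"
    if \<gamma>: "\<gamma> \<in> carrier \<Gamma>" for \<gamma>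
  proof -
    have "\<phi> ` G = carrier \<Gamma>" using \<phi>(1) by (simp add: iso_def bij_betw_def perm_group_simps)
    then obtain g where g: "g \<in> G" "\<gamma> = \<phi> g" using \<gamma> by blast
    obtain a t where at: "\<And>i. i \<in> {1..n} \<Longrightarrow> [int (conj_by c g i) = a * int i + t] (mod int n)"
      using c(2) g(1) unfolding affine_perms_def affine_map_def by blast
    have "?\<tau> \<gamma> (\<beta>' i) = \<beta>' (resid n (a * int i + t))" if i: "i \<in> {1..n}" for i
    proof -
      have j: "inv' c i \<in> {1..n}" using permutes_in_image[OF ci] i by blast
      have ji: "conj_by c g i \<in> {1..n}"
        using permutes_in_image[OF conj_by_permutes[OF c(1) GD(1)[OF g(1)]]] i by blast
      have "?\<tau> \<gamma> (\<beta>' i) = \<beta> (g (inv' c i))" using \<beta>(2)[OF g(1) j] g(2)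
        by (simp add: \<beta>'_def)
      also have "\<dots> = \<beta>' (conj_by c g i)" by (simp add: \<beta>'_def conj_by_def permutes_inverses[OF c(1)])
      also have "conj_by c g i = resid n (a * int i + t)"
        using resid_eqI[OF n ji cong_sym[OF at[OF i]]] by simp
      finally show ?thesis .
    qed
    then show ?thesis using norm[OF \<tau>B[OF \<gamma>]] by blast
  qed
  then have "greither_pareigis_subgroup \<Gamma> H N"
    unfolding greither_pareigis_subgroup_def Let_def using N by blast
  then have "admits_hopf_galois_structure E K L (integer_mod_group n)"
    unfolding admits_hopf_galois_structure_def Let_def using N(3) \<Gamma>_def H_def by blast
  then show ?thesis unfolding realised_by_hopf_galois_def using gc pi i0 by blast
qed

text \<open>Byott's translation for cyclic groups: the holomorph of \<open>\<int>/n\<close> is the group of affine permutations.\<close>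
theorem realised_perm_groups_cyclic:
  assumes "infinite (UNIV :: 'u set)" "n > 0"
  shows "realised_perm_groups TYPE('u) n (integer_mod_group n) =
    {G. transitive_perm_group n G \<and> (\<exists>c. c permutes {1..n} \<and> conj_by c ` G \<subseteq> affine_perms n)}"
  unfolding realised_perm_groups_def using affine_if_realised realised_if_affine assms by blast

section \<open>Squarefree numbers and subgroups of the integers\<close>

lemma squarefree_cofactor:
  fixes n :: nat
  assumes "squarefree n" "n = a * b"
  shows "coprime a b"
proof (rule coprimeI)
  fix c assume "c dvd a" "c dvd b"
  then have "c ^ 2 dvd n" unfolding assms(2) power2_eq_square by (rule mult_dvd_mono)
  then show "is_unit c" using assms(1) by (simp only: squarefree_def)
qed

lemma squarefree_dvdI:
  fixes d :: nat and z :: int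
  assumes "squarefree d" "\<And>q. Factorial_Ring.prime q \<Longrightarrow> q dvd d \<Longrightarrow> int q dvd z"
  shows "int d dvd z"
  using assms
proof (induction d rule: less_induct)
  case (less d)
  show ?case
  proof (cases "d = 1")
    case False
    then obtain q where q: "Factorial_Ring.prime q" "q dvd d" using prime_factor_nat by blast
    then obtain e where e: "d = q * e" by auto
    have d0: "d > 0" using less.prems(1) by (intro gr0I) simp
    have e0: "e > 0" "e < d" using d0 e prime_gt_1_nat[OF q(1)] by auto
    have "squarefree e" using less.prems(1) e squarefree_mono[of e d] by simp
    then have ez: "int e dvd z" using less.IH[OF e0(2)] less.prems(2) e by simp
    have "coprime q e" by (rule squarefree_cofactor[OF less.prems(1) e])
    then have "coprime (int q) (int e)" by simp
    then show ?thesis using divides_mult[of "int q" z "int e"] less.prems(2)[OF q] ez e by simp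
  qed simp
qed

text \<open>A subgroup of the integers is generated by its least positive element.\<close>
lemma int_subgroup_multiples:
  fixes T :: "int set"
  assumes n: "n > 0" "int n \<in> T" and add: "\<And>s t. s \<in> T \<Longrightarrow> t \<in> T \<Longrightarrow> s + t \<in> T" and neg: "\<And>s. s \<in> T \<Longrightarrow> - s \<in> T"
  obtains d where "d > 0" "d dvd n" "T = {t. int d dvd t}"
proof -
  have zero: "0 \<in> T" using add[OF n(2) neg[OF n(2)]] by simp
  have mult_nat: "s * int m \<in> T" if "s \<in> T" for s m
  proof (induction m)
    case (Suc m)
    show ?case using add[OF Suc that] by (simp add: algebra_simps)
  qed (simp add: zero)
  have mult: "s * k \<in> T" if "s \<in> T" for s k
  proof (cases "k \<ge> 0")
    case True
    then show ?thesis using mult_nat[OF that, of "nat k"] by simp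
  next
    case False
    then show ?thesis using neg[OF mult_nat[OF that, of "nat (- k)"]] by simp
  qed
  define d where "d = (LEAST m::nat. m > 0 \<and> int m \<in> T)"
  have d: "d > 0" "int d \<in> T" using LeastI[of "\<lambda>m. m > 0 \<and> int m \<in> T" n] n by (auto simp: d_def)
  have T: "T = {t. int d dvd t}"
  proof (intro equalityI subsetI)
    fix t assume t: "t \<in> T"
    have "t mod int d = t + - (int d * (t div int d))" by (simp add: minus_mult_div_eq_mod[symmetric])
    then have r: "t mod int d \<in> T" using add[OF t neg[OF mult[OF d(2)]]] by simp
    have "t mod int d = 0"
    proof (rule ccontr)
      assume nz: "t mod int d \<noteq> 0"
      have b: "0 \<le> t mod int d" "t mod int d < int d" using d(1) by simp_all
      have "0 < nat (t mod int d) \<and> int (nat (t mod int d)) \<in> T" using r nz b by simp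
      then have "d \<le> nat (t mod int d)"
        using Least_le[of "\<lambda>m. m > 0 \<and> int m \<in> T" "nat (t mod int d)"] unfolding d_def[symmetric] by blast
      then show False using b nz by linarith
    qed
    then show "t \<in> {t. int d dvd t}" by auto
  next
    fix t assume "t \<in> {t. int d dvd t}"
    then show "t \<in> T" using mult[OF d(2)] by auto
  qed
  have "d dvd n" using n(2) T by simp
  then show ?thesis using that d(1) T by blast
qed

section \<open>Torsion and subgroups of finite abelian groups\<close>

definition (in monoid) torsion :: "nat \<Rightarrow> 'a set" where
  "torsion k = {x \<in> carrier G. x [^] k = \<one>}"

definition (in monoid) subgroups_in :: "'a set \<Rightarrow> 'a set set" where
  "subgroups_in A = {H. subgroup H G \<and> H \<subseteq> A}"

locale finite_comm_group = comm_group +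
  assumes finite_carrier: "finite (carrier G)"
begin

lemma torsion_subgroup: "subgroup (torsion k) G"
  by (rule subgroupI) (auto simp: torsion_def nat_pow_inv pow_mult_distrib m_comm)

lemma mem_torsion_iff: "x \<in> torsion k \<longleftrightarrow> x \<in> carrier G \<and> ord x dvd k"
  using pow_eq_id by (auto simp: torsion_def)

lemma torsion_mono: "k dvd m \<Longrightarrow> torsion k \<subseteq> torsion m"
  by (auto simp: mem_torsion_iff)

lemma subgroup_int_pow: "subgroup H G \<Longrightarrow> x \<in> H \<Longrightarrow> x [^] (i::int) \<in> H"
  by (meson subgroup_int_pow_closed)

lemma subgroup_nat_pow: "subgroup H G \<Longrightarrow> x \<in> H \<Longrightarrow> x [^] (i::nat) \<in> H"
  using subgroup_int_pow[of H x "int i"] by (simp add: int_pow_int)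

lemma finite_subgroup: "subgroup H G \<Longrightarrow> finite H"
  using subgroup.subset finite_carrier finite_subset by blast

lemma finite_subgroups_in: "finite (subgroups_in A)"
proof (rule finite_subset)
  show "subgroups_in A \<subseteq> Pow (carrier G)" by (auto simp: subgroups_in_def dest: subgroup.subset)
qed (simp add: finite_carrier)

text \<open>The exponents are the two summands in a Bezout identity for \<open>a\<close> and \<open>b\<close>.\<close>
lemma coprime_split:
  assumes "coprime a b" "x \<in> torsion (a * b)"
  shows "\<exists>(i::int) (j::int). x = x [^] i \<otimes> x [^] j \<and> x [^] i \<in> torsion a \<and> x [^] j \<in> torsion b"
proof -
  have x: "x \<in> carrier G" "x [^] (a * b) = \<one>" using assms(2) by (auto simp: torsion_def)
  obtain u v where uv: "u * int a + v * int b = 1"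
    using assms(1) bezout_int[of "int a" "int b"] by auto
  have one: "x [^] (int a * int b * k) = \<one>" for k :: int
  proof -
    have "x [^] (int a * int b * k) = (x [^] (int (a * b))) [^] k" using x by (simp add: int_pow_pow)
    also have "\<dots> = \<one>" unfolding int_pow_int using x by (simp add: int_pow_one)
    finally show ?thesis .
  qed
  have "x = x [^] (v * int b + u * int a)" using uv x(1) by (simp add: add.commute)
  also have "\<dots> = x [^] (v * int b) \<otimes> x [^] (u * int a)" using x(1) by (simp add: int_pow_mult)
  finally have "x = x [^] (v * int b) \<otimes> x [^] (u * int a)" .
  moreover have "(x [^] (v * int b)) [^] a = \<one>"
    using one[of v] x(1) int_pow_pow[of x "v * int b" "int a"] by (simp add: int_pow_int mult.commute mult.left_commute)
  moreover have "(x [^] (u * int a)) [^] b = \<one>"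
    using one[of u] x(1) int_pow_pow[of x "u * int a" "int b"] by (simp add: int_pow_int mult.commute mult.left_commute)
  ultimately show ?thesis using x(1) unfolding torsion_def
    by (intro exI[of _ "v * int b"] exI[of _ "u * int a"] conjI CollectI int_pow_closed)
qed

lemma torsion_Int:
  assumes "coprime a b" "x \<in> torsion a" "x \<in> torsion b"
  shows "x = \<one>"
proof -
  have x: "x \<in> carrier G" and dvd: "ord x dvd a" "ord x dvd b" using assms by (simp_all add: mem_torsion_iff)
  have "ord x dvd 1" using coprime_common_divisor[OF assms(1) dvd] .
  then show ?thesis using x ord_eq_1 by simp
qed

lemma card_set_mult:
  assumes A: "subgroup A G" and B: "subgroup B G" and int: "A \<inter> B = {\<one>}"
  shows "card (A <#> B) = card A * card B"
proof -
  interpret A: subgroup A G by fact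
  interpret B: subgroup B G by fact
  have inj: "inj_on (\<lambda>(a, b). a \<otimes> b) (A \<times> B)"
  proof (rule inj_onI, clarify)
    fix a b a' b' assume ab: "a \<in> A" "b \<in> B" "a' \<in> A" "b' \<in> B" "a \<otimes> b = a' \<otimes> b'"
    then have c: "a \<in> carrier G" "b \<in> carrier G" "a' \<in> carrier G" "b' \<in> carrier G"
      using A.subset B.subset by blast+
    have "inv a' \<otimes> a = b' \<otimes> inv b"
      using ab(5) c by (metis inv_closed inv_solve_left inv_solve_right m_assoc m_closed)
    moreover have "inv a' \<otimes> a \<in> A" "b' \<otimes> inv b \<in> B" using ab by auto
    ultimately have "inv a' \<otimes> a = \<one>" "b' \<otimes> inv b = \<one>" using int by auto
    then show "a = a' \<and> b = b'" using c by (metis inv_closed inv_equality inv_inv inv_comm)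
  qed
  have "A <#> B = (\<lambda>(a, b). a \<otimes> b) ` (A \<times> B)" by (auto simp: set_mult_def)
  then show ?thesis using card_image[OF inj] by (simp add: card_cartesian_product)
qed

text \<open>Coprime parts of a subgroup are powers of its elements, hence belong to the subgroup.\<close>
lemma subgroup_split:
  assumes "coprime a b" "subgroup H G" "H \<subseteq> torsion (a * b)"
  shows "H = (H \<inter> torsion a) <#> (H \<inter> torsion b)"
proof
  show "H \<subseteq> (H \<inter> torsion a) <#> (H \<inter> torsion b)"
  proof
    fix x assume x: "x \<in> H"
    then obtain i j :: int where ij: "x = x [^] i \<otimes> x [^] j" "x [^] i \<in> torsion a" "x [^] j \<in> torsion b"
      using coprime_split[OF assms(1)] assms(3) by blast
    then show "x \<in> (H \<inter> torsion a) <#> (H \<inter> torsion b)"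
      using subgroup_int_pow[OF assms(2) x] unfolding set_mult_def by blast
  qed
  show "(H \<inter> torsion a) <#> (H \<inter> torsion b) \<subseteq> H"
    using subgroup.m_closed[OF assms(2)] by (auto simp: set_mult_def)
qed

lemma card_subgroup_split:
  assumes "coprime a b" "subgroup H G" "H \<subseteq> torsion (a * b)"
  shows "card H = card (H \<inter> torsion a) * card (H \<inter> torsion b)"
proof -
  have "\<one> \<in> H \<inter> torsion a \<inter> (H \<inter> torsion b)"
    using subgroup.one_closed[OF assms(2)] by (simp add: torsion_def)
  then have "(H \<inter> torsion a) \<inter> (H \<inter> torsion b) = {\<one>}"
    using torsion_Int[OF assms(1)] by blast
  then show ?thesis
    using subgroup_split[OF assms] card_set_mult[of "H \<inter> torsion a" "H \<inter> torsion b"]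
      subgroups_Inter_pair[OF assms(2) torsion_subgroup] by metis
qed

lemma set_mult_comm:
  assumes "A \<subseteq> carrier G" "B \<subseteq> carrier G"
  shows "A <#> B \<subseteq> B <#> A"
proof
  fix x assume "x \<in> A <#> B"
  then obtain a b where ab: "a \<in> A" "b \<in> B" "x = a \<otimes> b" unfolding set_mult_def by blast
  then have "x = b \<otimes> a" using assms m_comm[of a b] by blast
  then show "x \<in> B <#> A" using ab unfolding set_mult_def by blast
qed

lemma set_mult_Int_torsion:
  assumes "coprime a b" "subgroup A G" "subgroup B G" "A \<subseteq> torsion a" "B \<subseteq> torsion b"
  shows "(A <#> B) \<inter> torsion a = A"
proof
  interpret A: subgroup A G by fact
  interpret B: subgroup B G by fact
  show "(A <#> B) \<inter> torsion a \<subseteq> A"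
  proof
    fix x assume x: "x \<in> (A <#> B) \<inter> torsion a"
    then obtain y z where yz: "y \<in> A" "z \<in> B" "x = y \<otimes> z" by (auto simp: set_mult_def)
    then have c: "y \<in> carrier G" "z \<in> carrier G" using A.subset B.subset by blast+
    have "inv y \<otimes> x \<in> torsion a"
      using subgroup.m_closed[OF torsion_subgroup] subgroup.m_inv_closed[OF torsion_subgroup] x yz assms(4) by blast
    moreover have "inv y \<otimes> x = z" using yz c by (simp add: m_assoc[symmetric])
    ultimately have "z = \<one>" using torsion_Int[OF assms(1)] yz assms(5) by blast
    then show "x \<in> A" using yz c by simp
  qed
  show "A \<subseteq> (A <#> B) \<inter> torsion a"
  proof
    fix x assume x: "x \<in> A"
    then have "x = x \<otimes> \<one>" using A.subset by auto
    then have "x \<in> A <#> B" using x B.one_closed unfolding set_mult_def by blast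
    then show "x \<in> (A <#> B) \<inter> torsion a" using x assms(4) by blast
  qed
qed

lemma bij_betw_subgroups_split:
  assumes "coprime a b"
  shows "bij_betw (\<lambda>H. (H \<inter> torsion a, H \<inter> torsion b)) (subgroups_in (torsion (a * b)))
    (subgroups_in (torsion a) \<times> subgroups_in (torsion b))"
proof (rule bij_betwI[where g="\<lambda>(A, B). A <#> B"])
  have cop: "coprime b a" using assms by (simp add: coprime_commute)
  show "(\<lambda>H. (H \<inter> torsion a, H \<inter> torsion b)) \<in> subgroups_in (torsion (a * b)) \<rightarrow> subgroups_in (torsion a) \<times> subgroups_in (torsion b)"
    by (auto simp: subgroups_in_def intro!: subgroups_Inter_pair torsion_subgroup)
  show "(\<lambda>(A, B). A <#> B) \<in> subgroups_in (torsion a) \<times> subgroups_in (torsion b) \<rightarrow> subgroups_in (torsion (a * b))"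
  proof (clarify, simp add: subgroups_in_def, elim conjE, intro conjI)
    fix A B assume AB: "subgroup A G" "A \<subseteq> torsion a" "subgroup B G" "B \<subseteq> torsion b"
    show "subgroup (A <#> B) G" using mult_subgroups[OF AB(1,3)] .
    have "torsion a \<subseteq> torsion (a * b)" "torsion b \<subseteq> torsion (a * b)"
      by (simp_all add: torsion_mono)
    then show "A <#> B \<subseteq> torsion (a * b)"
      using AB(2,4) subgroup.m_closed[OF torsion_subgroup] unfolding set_mult_def by blast
  qed
  show "(case (H \<inter> torsion a, H \<inter> torsion b) of (A, B) \<Rightarrow> A <#> B) = H"
    if "H \<in> subgroups_in (torsion (a * b))" for H
    using subgroup_split[OF assms, of H] that by (simp add: subgroups_in_def)
  show "((case y of (A, B) \<Rightarrow> A <#> B) \<inter> torsion a, (case y of (A, B) \<Rightarrow> A <#> B) \<inter> torsion b) = y"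
    if yy: "y \<in> subgroups_in (torsion a) \<times> subgroups_in (torsion b)" for y
  proof -
    obtain A B where y: "y = (A, B)" "subgroup A G" "A \<subseteq> torsion a" "subgroup B G" "B \<subseteq> torsion b"
      using yy unfolding subgroups_in_def by blast
    have "A <#> B = B <#> A"
      using set_mult_comm[of A B] set_mult_comm[of B A] subgroup.subset[OF y(2)] subgroup.subset[OF y(4)] by blast
    then show ?thesis
      using set_mult_Int_torsion[OF assms y(2,4,3,5)] set_mult_Int_torsion[OF cop y(4,2,5,3)] y(1) by simp
  qed
qed

lemma card_subgroups_split:
  "coprime a b \<Longrightarrow> card (subgroups_in (torsion (a * b))) = card (subgroups_in (torsion a)) * card (subgroups_in (torsion b))"
  using bij_betw_same_card[OF bij_betw_subgroups_split] by (simp add: card_cartesian_product)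

lemma torsion_order: "torsion (order G) = carrier G"
  by (auto simp: mem_torsion_iff ord_dvd_group_order)

text \<open>Cauchy's theorem, as a case of Sylow's.\<close>
lemma exists_prime_order:
  assumes "subgroup H G" "Factorial_Ring.prime q" "q dvd card H"
  obtains x where "x \<in> H" "ord x = q"
proof -
  have gH: "group (G\<lparr>carrier := H\<rparr>)" by (rule subgroup_imp_group[OF assms(1)])
  have fin: "finite H" by (rule finite_subgroup[OF assms(1)])
  obtain m where m: "card H = q ^ 1 * m" using assms(3) by auto
  obtain P where P: "subgroup P (G\<lparr>carrier := H\<rparr>)" "card P = q" 
    using sylow_thm[OF assms(2) gH, of 1 m] m fin by (auto simp: order_def)
  have PG: "subgroup P G" "P \<subseteq> H" using incl_subgroup[OF assms(1) P(1)] subgroup.subset[OF P(1)] by simp_all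
  have "card P > 1" using P(2) assms(2) prime_gt_1_nat by simp
  then have "\<not> P \<subseteq> {\<one>}" using card_mono[of "{\<one>}" P] by auto
  then obtain x where x: "x \<in> P" "x \<noteq> \<one>" by blast
  have xc: "x \<in> carrier G" using x PG subgroup.subset by blast
  have gP: "group (G\<lparr>carrier := P\<rparr>)" by (rule subgroup_imp_group[OF PG(1)])
  have "x [^]\<^bsub>G\<lparr>carrier := P\<rparr>\<^esub> order (G\<lparr>carrier := P\<rparr>) = \<one>\<^bsub>G\<lparr>carrier := P\<rparr>\<^esub>"
    using group.pow_order_eq_1[OF gP] x by simp
  then have "x [^] q = \<one>" using P(2) by (simp add: order_def nat_pow_consistent[symmetric])
  then have "ord x dvd q" using xc pow_eq_id by blast
  moreover have "ord x \<noteq> 1" using x(2) xc ord_eq_1 by blast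
  ultimately have "ord x = q" using assms(2) by (metis prime_nat_iff)
  then show ?thesis using that x PG by blast
qed

text \<open>By Cauchy's theorem all prime divisors of the order of \<open>torsion a\<close> divide \<open>a\<close>, and likewise for \<open>b\<close>. As
  the orders of \<open>torsion a\<close> and \<open>torsion b\<close> have the product \<open>a * b\<close>, they divide \<open>a\<close> and \<open>b\<close>, respectively, and
  equality holds.\<close>
lemma card_torsion:
  assumes "order G = a * b" "coprime a b"
  shows "card (torsion a) = a"
proof -
  have pos: "a > 0" "b > 0"
    using assms(1) finite_carrier order_gt_0_iff_finite by (metis gr0I mult_0 mult_0_right less_irrefl)+
  have cop: "coprime (card (torsion k)) m" if "coprime k m" "m > 0" for k m
  proof (rule ccontr)
    assume "\<not> coprime (card (torsion k)) m"
    then have "gcd (card (torsion k)) m \<noteq> 1" by (simp only: coprime_iff_gcd_eq_1 not_False_eq_True)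
    then obtain q where "Factorial_Ring.prime q" "q dvd gcd (card (torsion k)) m"
      using prime_factor_nat by blast
    then have q: "Factorial_Ring.prime q" "q dvd card (torsion k)" "q dvd m" by auto
    obtain x where x: "x \<in> torsion k" "ord x = q" using exists_prime_order[OF torsion_subgroup q(1,2)] .
    then have "q dvd k" by (simp add: mem_torsion_iff)
    then have "q dvd 1" using q(3) that(1) coprime_common_divisor[of k m q] by simp
    then show False using q(1) by simp
  qed
  have prod: "card (torsion a) * card (torsion b) = a * b"
  proof -
    have "card (carrier G) = card (carrier G \<inter> torsion a) * card (carrier G \<inter> torsion b)"
      by (rule card_subgroup_split[OF assms(2) subgroup_self]) (use torsion_order assms(1) in auto)
    moreover have "carrier G \<inter> torsion k = torsion k" for k by (auto simp: torsion_def)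
    ultimately show ?thesis using assms(1) by (simp add: order_def)
  qed
  have "card (torsion a) dvd a * b" "card (torsion b) dvd a * b" using prod by (metis dvd_triv_left dvd_triv_right)+
  then have "card (torsion a) dvd a" "card (torsion b) dvd b"
    using cop[of a b] cop[of b a] assms(2) pos
    by (auto simp: coprime_commute coprime_dvd_mult_left_iff coprime_dvd_mult_right_iff)
  then have le: "card (torsion a) \<le> a" "card (torsion b) \<le> b" using pos by (auto intro: dvd_imp_le)
  show ?thesis
  proof (rule ccontr)
    assume "card (torsion a) \<noteq> a"
    then have "card (torsion a) * card (torsion b) < a * b" using le pos
    proof (intro mult_less_le_imp_less)
      show "0 < card (torsion b)" using prod pos by (intro gr0I) auto
    qed auto
    then show False using prod by simp
  qed
qed

lemma card_subgroup_dvd: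
  assumes "subgroup A G" "subgroup B G" "A \<subseteq> B"
  shows "card A dvd card B"
  using group.lagrange[OF subgroup_imp_group[OF assms(2)] subgroup_incl[OF assms]]
  by (metis dvd_triv_right order_def partial_object.select_convs(1) partial_object.update_convs(1) partial_object.surjective)

lemma ord_dvd_card:
  assumes "subgroup H G" "x \<in> H"
  shows "ord x dvd card H"
proof -
  have x: "x \<in> carrier G" using assms subgroup.subset by blast
  have "generate G {x} \<subseteq> H" by (rule generate_subgroup_incl) (use assms in auto)
  moreover have "subgroup (generate G {x}) G" by (rule generate_is_subgroup) (use x in auto)
  ultimately show ?thesis using card_subgroup_dvd[OF _ assms(1)] generate_pow_card[OF x] by simp
qed

lemma subgroup_subset_torsion_card: "subgroup H G \<Longrightarrow> H \<subseteq> torsion (card H)"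
  using ord_dvd_card subgroup.subset[of H G] by (auto simp: mem_torsion_iff)

lemma ord_mult_coprime:
  assumes x: "x \<in> carrier G" and y: "y \<in> carrier G" and cop: "coprime (ord x) (ord y)"
  shows "ord (x \<otimes> y) = ord x * ord y"
proof (rule dvd_antisym)
  show "ord (x \<otimes> y) dvd ord x * ord y" by (rule abelian_ord_mul_divides[OF x y])
  let ?k = "ord (x \<otimes> y)"
  have "x [^] ?k \<otimes> y [^] ?k = \<one>" using x y by (simp add: pow_mult_distrib[symmetric] m_comm)
  then have "x [^] ?k = inv (y [^] ?k)" using x y by (metis inv_equality nat_pow_closed)
  moreover have "x [^] ?k \<in> torsion (ord x)" "y [^] ?k \<in> torsion (ord y)"
    using subgroup_nat_pow[OF torsion_subgroup] x y by (simp_all add: mem_torsion_iff)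
  then have "x [^] ?k \<in> torsion (ord x)" "inv (y [^] ?k) \<in> torsion (ord y)"
    using subgroup.m_inv_closed[OF torsion_subgroup] by blast+
  ultimately have "x [^] ?k = \<one>" "inv (y [^] ?k) = \<one>" using torsion_Int[OF cop, of "x [^] ?k"] by simp_all
  then have "x [^] ?k = \<one>" "y [^] ?k = \<one>" using y by (simp_all add: inv_eq_1_iff)
  then show "ord x * ord y dvd ?k" using x y cop by (simp add: pow_eq_id divides_mult)
qed

text \<open>A product of elements of distinct prime orders.\<close>
lemma exists_squarefree_order:
  assumes "subgroup H G" "squarefree d" "d dvd card H"
  shows "\<exists>c\<in>H. ord c = d"
  using assms(2,3)
proof (induction d rule: less_induct)
  case (less d)
  show ?case
  proof (cases "d = 1")
    case True
    then show ?thesis using subgroup.one_closed[OF assms(1)] by (intro bexI[of _ \<one>]) simp_all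
  next
    case False
    then obtain q where q: "Factorial_Ring.prime q" "q dvd d" using prime_factor_nat by blast
    then obtain e where e: "d = q * e" by auto
    have d0: "d > 0" using less.prems(1) by (intro gr0I) simp
    have e0: "e > 0" "e < d" using d0 e prime_gt_1_nat[OF q(1)] by auto
    have cop: "coprime q e" by (rule squarefree_cofactor[OF less.prems(1) e])
    have "squarefree e" using less.prems(1) e squarefree_mono[of e d] by simp
    moreover have "e dvd card H" using less.prems(2) e dvd_mult_right by blast
    ultimately obtain c where c: "c \<in> H" "ord c = e" using less.IH[OF e0(2)] by blast
    have "q dvd card H" using q(2) less.prems(2) dvd_trans by blast
    then obtain x where x: "x \<in> H" "ord x = q" using exists_prime_order[OF assms(1) q(1)] by blast
    have "ord (x \<otimes> c) = q * e"
      using ord_mult_coprime[of x c] x c cop subgroup.subset[OF assms(1)] by auto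
    then show ?thesis using x c e subgroup.m_closed[OF assms(1)] by blast
  qed
qed

text \<open>The order of \<open>H\<close> is a multiple of \<open>d\<close> only if \<open>H\<close> contains all of \<open>torsion d\<close>, which has order \<open>d\<close>. The
  part of \<open>H\<close> in \<open>torsion f\<close> is arbitrary.\<close>
lemma card_subgroups_divisible_order:
  assumes ord: "order G = d * f" and cop: "coprime d f"
  shows "card {H. subgroup H G \<and> d dvd card H} = card (subgroups_in (torsion f))"
proof -
  let ?h = "\<lambda>H. (H \<inter> torsion d, H \<inter> torsion f)"
  have bij: "bij_betw ?h (subgroups_in (torsion (d * f))) (subgroups_in (torsion d) \<times> subgroups_in (torsion f))"
    by (rule bij_betw_subgroups_split[OF cop])
  have all: "torsion (d * f) = carrier G" using torsion_order ord by simp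
  have sub_all: "H \<subseteq> torsion (d * f)" if "subgroup H G" for H using all subgroup.subset[OF that] by simp
  have td: "card (torsion d) = d" using card_torsion[OF ord cop] .
  have tf: "card (torsion f) = f" using card_torsion[of f d] ord cop by (simp add: mult.commute coprime_commute)
  have iff: "d dvd card H \<longleftrightarrow> H \<inter> torsion d = torsion d" if H: "subgroup H G" for H
  proof
    have sd: "subgroup (H \<inter> torsion d) G" and sf: "subgroup (H \<inter> torsion f) G"
      using subgroups_Inter_pair[OF H torsion_subgroup] by blast+
    have c: "card H = card (H \<inter> torsion d) * card (H \<inter> torsion f)"
      by (rule card_subgroup_split[OF cop H sub_all[OF H]])
    {
      assume "d dvd card H"
      moreover have "card (H \<inter> torsion f) dvd f" using card_subgroup_dvd[OF sf torsion_subgroup] tf by force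
      then have "coprime d (card (H \<inter> torsion f))" using cop coprime_imp_coprime dvd_trans by blast
      ultimately have "d dvd card (H \<inter> torsion d)" using c by (simp add: coprime_dvd_mult_left_iff)
      moreover have "card (H \<inter> torsion d) > 0"
        using finite_subgroup[OF sd] subgroup.one_closed[OF sd] card_gt_0_iff by blast
      ultimately have "card (torsion d) \<le> card (H \<inter> torsion d)" using td dvd_imp_le by simp
      then show "H \<inter> torsion d = torsion d"
        using card_seteq[OF finite_subgroup[OF torsion_subgroup], of "H \<inter> torsion d" d] by blast
    }
    assume "H \<inter> torsion d = torsion d"
    then show "d dvd card H" using c td by simp
  qed
  have "{H. subgroup H G \<and> d dvd card H} = {H \<in> subgroups_in (torsion (d * f)). fst (?h H) = torsion d}"
    using iff sub_all by (auto simp: subgroups_in_def)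
  also have "bij_betw ?h \<dots> ({torsion d} \<times> subgroups_in (torsion f))"
    unfolding bij_betw_def
  proof
    show "inj_on ?h {H \<in> subgroups_in (torsion (d * f)). fst (?h H) = torsion d}"
      using bij by (auto simp: bij_betw_def intro: inj_on_subset)
    have im: "?h ` subgroups_in (torsion (d * f)) = subgroups_in (torsion d) \<times> subgroups_in (torsion f)"
      using bij by (simp add: bij_betw_def)
    have gen: "h ` {H \<in> S. fst (h H) = t} = {p \<in> h ` S. fst p = t}"
      for h :: "'a set \<Rightarrow> 'a set \<times> 'a set" and S t by blast
    have "{p \<in> A \<times> B. fst p = t} = {t} \<times> B" if "t \<in> A" for t :: "'a set" and A B :: "'a set set"
      using that by auto
    moreover have "torsion d \<in> subgroups_in (torsion d)" using torsion_subgroup by (simp add: subgroups_in_def)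
    ultimately show "?h ` {H \<in> subgroups_in (torsion (d * f)). fst (?h H) = torsion d} = {torsion d} \<times> subgroups_in (torsion f)"
      unfolding gen im by blast
  qed
  then have "card {H \<in> subgroups_in (torsion (d * f)). fst (?h H) = torsion d} = card ({torsion d} \<times> subgroups_in (torsion f))"
    by (rule bij_betw_same_card)
  finally show ?thesis by (simp add: card_cartesian_product)
qed

lemma card_subgroups_prime:
  assumes "card (torsion q) = q" "Factorial_Ring.prime q"
  shows "card (subgroups_in (torsion q)) = 2"
proof -
  have "H = {\<one>} \<or> H = torsion q" if H: "subgroup H G" "H \<subseteq> torsion q" for H
  proof -
    have "card H dvd q" using card_subgroup_dvd[OF H(1) torsion_subgroup H(2)] assms(1) by simp
    then have "card H = 1 \<or> card H = q" using assms(2) by (simp add: prime_nat_iff)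
    then show ?thesis
    proof
      assume "card H = 1"
      then show ?thesis using subgroup.one_closed[OF H(1)] by (metis card_1_singletonE singletonD)
    next
      assume "card H = q"
      then show ?thesis using card_subset_eq[OF finite_subgroup[OF torsion_subgroup] H(2)] assms(1) by simp
    qed
  qed
  then have "subgroups_in (torsion q) = {{\<one>}, torsion q}"
    using triv_subgroup torsion_subgroup subgroup.one_closed[OF torsion_subgroup] by (auto simp: subgroups_in_def)
  moreover have "{\<one>} \<noteq> torsion q"
  proof
    assume "{\<one>} = torsion q"
    then have "q = 1" using assms(1) by (metis card.empty card.insert empty_iff finite.emptyI One_nat_def)
    then show False using assms(2) by simp
  qed
  ultimately show ?thesis by simp
qed

text \<open>In a cyclic group the subgroup of order \<open>e\<close> is \<open>torsion e\<close>.\<close>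
lemma card_subgroups_cyclic:
  assumes s: "card (torsion s) = s" "s > 0" and c: "c \<in> carrier G" "ord c = s"
  shows "card (subgroups_in (torsion s)) = card {e. e dvd s}"
proof -
  have gen: "generate G {c} = torsion s"
  proof (rule card_subset_eq[OF finite_subgroup[OF torsion_subgroup]])
    show "generate G {c} \<subseteq> torsion s"
      by (rule generate_subgroup_incl[OF _ torsion_subgroup]) (use c in \<open>simp add: mem_torsion_iff\<close>)
    show "card (generate G {c}) = card (torsion s)" using generate_pow_card[OF c(1)] c(2) s(1) by simp
  qed
  have card_le: "card (torsion e) = e" if e: "e dvd s" for e
  proof -
    obtain k where k: "s = e * k" using e by auto
    then have k0: "k > 0" "e > 0" using s(2) by auto
    have ck: "ord (c [^] k) = e" using ord_pow[OF c(1), of k] c(2) k k0 by simp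
    have "generate G {c [^] k} \<subseteq> torsion e"
      by (rule generate_subgroup_incl[OF _ torsion_subgroup]) (use c ck in \<open>simp add: mem_torsion_iff\<close>)
    then have "e \<le> card (torsion e)"
      using card_mono[OF finite_subgroup[OF torsion_subgroup]] generate_pow_card[of "c [^] k"] ck c(1) by force
    moreover have "torsion e \<subseteq> (\<lambda>j. c [^] (k * j)) ` {0..<e}"
    proof
      fix y assume y: "y \<in> torsion e"
      then have "y \<in> generate G {c}" using gen torsion_mono[OF e] by blast
      then obtain i where i: "y = c [^] (i::nat)" using generate_pow_on_finite_carrier[OF finite_carrier c(1)] by blast
      have "c [^] (i * e) = \<one>" using y i c(1) by (simp add: torsion_def nat_pow_pow)
      then have "e * k dvd i * e" using pow_eq_id[OF c(1)] c(2) k by simp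
      then have "k dvd i" using k0 by (simp add: mult.commute)
      then obtain j where j: "i = k * j" by auto
      have "c [^] (k * j) = c [^] (k * (j mod e))"
      proof -
        have "k * j = k * (j mod e) + s * (j div e)" unfolding k
          by (metis add.commute distrib_left mult.assoc mult.commute mult_div_mod_eq)
        then have "c [^] (k * j) = c [^] (k * (j mod e)) \<otimes> (c [^] s) [^] (j div e)"
          using c(1) by (simp add: nat_pow_mult nat_pow_pow)
        then show ?thesis using c by (metis nat_pow_closed nat_pow_one pow_ord_eq_1 r_one)
      qed
      then show "y \<in> (\<lambda>j. c [^] (k * j)) ` {0..<e}" using i j k0 by force
    qed
    then have "card (torsion e) \<le> e" using surj_card_le[of "{0..<e}"] by simp
    ultimately show ?thesis by simp
  qed
  have "bij_betw card (subgroups_in (torsion s)) {e. e dvd s}"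
  proof (rule bij_betwI[where g=torsion])
    show "card \<in> subgroups_in (torsion s) \<rightarrow> {e. e dvd s}"
      using card_subgroup_dvd[OF _ torsion_subgroup] s(1) by (force simp: subgroups_in_def)
    show "torsion \<in> {e. e dvd s} \<rightarrow> subgroups_in (torsion s)"
      using torsion_mono torsion_subgroup by (auto simp: subgroups_in_def)
    show "torsion (card H) = H" if "H \<in> subgroups_in (torsion s)" for H
    proof -
      have H: "subgroup H G" "H \<subseteq> torsion s" using that by (auto simp: subgroups_in_def)
      have "card (torsion (card H)) = card H"
        using card_le card_subgroup_dvd[OF H(1) torsion_subgroup H(2)] s(1) by simp
      then show ?thesis
        using card_subset_eq[OF finite_subgroup[OF torsion_subgroup] subgroup_subset_torsion_card[OF H(1)]] by simp
    qed
    show "card (torsion e) = e" if "e \<in> {e. e dvd s}" for e using card_le that by simp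
  qed
  then show ?thesis by (rule bij_betw_same_card)
qed

section \<open>Elementary abelian 2-groups\<close>

fun span2 :: "'a list \<Rightarrow> 'a set" where
  "span2 [] = {\<one>}"
| "span2 (x # xs) = span2 xs \<union> (\<lambda>u. x \<otimes> u) ` span2 xs"

text \<open>Each element lies outside the span of the elements after it; over the field with two elements this is
  linear independence.\<close>
fun indep2 :: "'a list \<Rightarrow> bool" where
  "indep2 [] = True"
| "indep2 (x # xs) = (indep2 xs \<and> x \<notin> span2 xs)"

lemma square_one: "x \<in> torsion 2 \<Longrightarrow> x \<otimes> x = \<one>"
  by (auto simp: torsion_def numeral_2_eq_2)

lemma span2_subgroup:
  assumes "subgroup V G" "V \<subseteq> torsion 2" "set xs \<subseteq> V"
  shows "subgroup (span2 xs) G \<and> span2 xs \<subseteq> V \<and> set xs \<subseteq> span2 xs \<and> (indep2 xs \<longrightarrow> card (span2 xs) = 2 ^ length xs)"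
  using assms(3)
proof (induction xs)
  case Nil
  then show ?case using triv_subgroup subgroup.one_closed[OF assms(1)] by simp
next
  case (Cons x xs)
  let ?S = "span2 xs"
  have IH: "subgroup ?S G" "?S \<subseteq> V" "set xs \<subseteq> ?S" "indep2 xs \<Longrightarrow> card ?S = 2 ^ length xs" and x: "x \<in> V"
    using Cons by auto
  interpret S: subgroup ?S G by (rule IH(1))
  have xc: "x \<in> carrier G" using x subgroup.subset[OF assms(1)] by blast
  have xx: "x \<otimes> x = \<one>" using x assms(2) square_one by blast
  have sub: "subgroup (span2 (x # xs)) G"
  proof (rule finite_subgroupI[OF finite_carrier])
    show "a \<otimes> b \<in> span2 (x # xs)" if a: "a \<in> span2 (x # xs)" and b: "b \<in> span2 (x # xs)" for a b
    proof -
      have ex: "\<exists>u i. u \<in> ?S \<and> y = x [^] (i::nat) \<otimes> u \<and> (i = 0 \<or> i = 1)"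
        if y: "y \<in> span2 (x # xs)" for y
      proof (cases "y \<in> ?S")
        case True
        then show ?thesis by (intro exI[of _ y] exI[of _ 0]) simp
      next
        case False
        then obtain u where "u \<in> ?S" "y = x \<otimes> u" using y by auto
        then show ?thesis using xc by (intro exI[of _ u] exI[of _ 1]) simp
      qed
      obtain u i where u: "u \<in> ?S" "a = x [^] (i::nat) \<otimes> u" "i = 0 \<or> i = 1" using ex[OF a] by blast
      obtain v j where v: "v \<in> ?S" "b = x [^] (j::nat) \<otimes> v" "j = 0 \<or> j = 1" using ex[OF b] by blast
      have c: "u \<in> carrier G" "v \<in> carrier G" using u v by auto
      have e: "a \<otimes> b = x [^] (i + j) \<otimes> (u \<otimes> v)"
        using u v xc c by (simp add: nat_pow_mult[symmetric] m_ac)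
      have uv: "u \<otimes> v \<in> ?S" using u v by simp
      have "x [^] (i + j) = \<one> \<or> x [^] (i + j) = x" using u(3) v(3) xc xx by (auto simp: numeral_2_eq_2)
      then show ?thesis using e uv by auto
    qed
  qed (use xc in \<open>auto intro: S.one_closed\<close>)
  have V: "span2 (x # xs) \<subseteq> V" using IH(2) x subgroup.m_closed[OF assms(1)] by auto
  have mem: "set (x # xs) \<subseteq> span2 (x # xs)"
    using IH(3) S.one_closed xc by (auto intro!: image_eqI[where x=\<one>])
  have "card (span2 (x # xs)) = 2 ^ length (x # xs)" if ind: "indep2 (x # xs)"
  proof -
    have "?S \<inter> (\<lambda>u. x \<otimes> u) ` ?S = {}"
    proof -
      have False if u: "u \<in> ?S" "x \<otimes> u \<in> ?S" for u
      proof -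
        have "x \<otimes> u \<otimes> inv u \<in> ?S" by (rule S.m_closed[OF u(2) S.m_inv_closed[OF u(1)]])
        moreover have "x \<otimes> u \<otimes> inv u = x" using u xc by (simp add: m_assoc)
        ultimately have "x \<in> ?S" by (simp only:)
        then show False using ind by simp
      qed
      then show ?thesis by blast
    qed
    moreover have "card ((\<lambda>u. x \<otimes> u) ` ?S) = card ?S"
      by (rule card_image) (use xc in \<open>auto intro!: inj_onI\<close>)
    moreover have "finite ?S" using finite_subgroup[OF IH(1)] .
    ultimately show ?thesis using IH(4) ind by (simp add: card_Un_disjoint)
  qed
  then show ?case using sub V mem by blast
qed

definition indep_lists :: "'a set \<Rightarrow> nat \<Rightarrow> 'a list set" where
  "indep_lists V k = {xs. length xs = k \<and> set xs \<subseteq> V \<and> indep2 xs}"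

lemma finite_indep_lists: "finite V \<Longrightarrow> finite (indep_lists V k)"
  unfolding indep_lists_def by (rule finite_subset[OF _ finite_lists_length_eq[of V k]]) auto

text \<open>A list of \<open>k\<close> independent elements has a span of order \<open>2 ^ k\<close>, and any element outside it extends the
  list.\<close>
lemma card_indep_lists:
  assumes V: "subgroup V G" "V \<subseteq> torsion 2"
  shows "int (card (indep_lists V k)) = (\<Prod>i<k. int (card V) - 2 ^ i)"
proof (induction k)
  case 0
  have "indep_lists V 0 = {[]}" by (auto simp: indep_lists_def)
  then show ?case by simp
next
  case (Suc k)
  have fin: "finite V" by (rule finite_subgroup[OF V(1)])
  have e: "indep_lists V (Suc k) = (\<lambda>(xs, x). x # xs) ` (SIGMA xs:indep_lists V k. V - span2 xs)"
    by (auto simp: indep_lists_def length_Suc_conv image_iff)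
  have "inj_on (\<lambda>(xs, x). x # xs) (SIGMA xs:indep_lists V k. V - span2 xs)" by (auto simp: inj_on_def)
  then have "card (indep_lists V (Suc k)) = card (SIGMA xs:indep_lists V k. V - span2 xs)"
    unfolding e by (rule card_image)
  also have "\<dots> = (\<Sum>xs\<in>indep_lists V k. card (V - span2 xs))"
    by (rule card_SigmaI) (use fin finite_indep_lists in auto)
  finally have "int (card (indep_lists V (Suc k))) = (\<Sum>xs\<in>indep_lists V k. int (card (V - span2 xs)))" by simp
  also have "\<dots> = (\<Sum>xs\<in>indep_lists V k. int (card V) - 2 ^ k)"
  proof (rule sum.cong[OF refl])
    fix xs assume "xs \<in> indep_lists V k"
    then have s: "span2 xs \<subseteq> V" "card (span2 xs) = 2 ^ k"
      using span2_subgroup[OF V, of xs] by (auto simp: indep_lists_def)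
    then have "card (span2 xs) \<le> card V" using fin card_mono by blast
    then show "int (card (V - span2 xs)) = int (card V) - 2 ^ k"
      using s fin finite_subset[OF s(1) fin] by (simp add: card_Diff_subset of_nat_diff)
  qed
  finally show ?case using Suc by (simp add: mult.commute)
qed

text \<open>Double counting of the independent lists of length \<open>k\<close>: each spans a subgroup of order \<open>2 ^ k\<close>, and each
  such subgroup is spanned by the independent lists in it. In terms of vector spaces this counts subspaces by
  their bases.\<close>
lemma card_elementary_subgroups:
  assumes V: "subgroup V G" "V \<subseteq> torsion 2"
  shows "int (card {U \<in> subgroups_in V. card U = 2 ^ k}) * (\<Prod>i<k. 2 ^ k - 2 ^ i) = (\<Prod>i<k. int (card V) - 2 ^ i)"
proof -
  let ?N = "{U \<in> subgroups_in V. card U = 2 ^ k}"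
  have fin: "finite V" by (rule finite_subgroup[OF V(1)])
  have finN: "finite ?N" using finite_subgroups_in by simp
  have fibre: "{xs \<in> indep_lists V k. span2 xs = U} = indep_lists U k" if U: "U \<in> ?N" for U
  proof -
    have U': "subgroup U G" "U \<subseteq> V" "card U = 2 ^ k" using U by (auto simp: subgroups_in_def)
    show ?thesis
    proof
      show "{xs \<in> indep_lists V k. span2 xs = U} \<subseteq> indep_lists U k"
        using span2_subgroup[OF V] by (auto simp: indep_lists_def)
      show "indep_lists U k \<subseteq> {xs \<in> indep_lists V k. span2 xs = U}"
      proof
        fix xs assume xs: "xs \<in> indep_lists U k"
        then have "span2 xs \<subseteq> U" "card (span2 xs) = card U"
          using span2_subgroup[OF U'(1), of xs] U' V(2) by (auto simp: indep_lists_def)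
        then have "span2 xs = U" using card_subset_eq[OF finite_subgroup[OF U'(1)]] by blast
        then show "xs \<in> {xs \<in> indep_lists V k. span2 xs = U}" using xs U'(2) by (auto simp: indep_lists_def)
      qed
    qed
  qed
  have "span2 ` indep_lists V k \<subseteq> ?N"
    using span2_subgroup[OF V] by (auto simp: indep_lists_def subgroups_in_def)
  then have "(\<Sum>U\<in>?N. card {xs \<in> indep_lists V k. span2 xs = U}) = card (indep_lists V k)"
    using sum_fun_comp[OF finite_indep_lists[OF fin] finN, of span2 k "\<lambda>_. 1 :: nat"] by simp
  then have "int (card (indep_lists V k)) = (\<Sum>U\<in>?N. int (card (indep_lists U k)))"
    using fibre by (simp flip: of_nat_sum)
  also have "\<dots> = (\<Sum>U\<in>?N. (\<Prod>i<k. 2 ^ k - 2 ^ i))"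
  proof (rule sum.cong[OF refl])
    fix U assume "U \<in> ?N"
    then have "subgroup U G" "U \<subseteq> torsion 2" "card U = 2 ^ k" using V(2) by (auto simp: subgroups_in_def)
    then show "int (card (indep_lists U k)) = (\<Prod>i<k. 2 ^ k - 2 ^ i)" using card_indep_lists by simp
  qed
  finally show ?thesis using card_indep_lists[OF V, of k] by simp
qed

end

text \<open>The Gaussian binomial coefficient at \<open>2\<close>.\<close>
definition gauss2 :: "nat \<Rightarrow> nat \<Rightarrow> rat" where
  "gauss2 m k = (\<Prod>i=1..k. (2 ^ (m - (i - 1)) - 1) / (2 ^ i - 1))"

lemma gauss2_eq_ratio:
  assumes "k \<le> m"
  shows "gauss2 m k * (\<Prod>i<k. 2 ^ k - 2 ^ i) = (\<Prod>i<k. 2 ^ m - 2 ^ i)"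
proof -
  have a: "(\<Prod>i<k. 2 ^ m - 2 ^ i :: rat) = (\<Prod>i<k. 2 ^ i) * (\<Prod>i<k. 2 ^ (m - i) - 1)" if "k \<le> m" for m
    unfolding prod.distrib[symmetric]
  proof (rule prod.cong[OF refl])
    fix i assume "i \<in> {..<k}"
    then have "2 ^ m = (2 ^ i * 2 ^ (m - i) :: rat)" using that by (simp flip: power_add)
    then show "2 ^ m - 2 ^ i = (2 ^ i * (2 ^ (m - i) - 1) :: rat)" by (simp add: algebra_simps)
  qed
  have b: "(\<Prod>i<k. 2 ^ (m - i) - 1 :: rat) = (\<Prod>i=1..k. 2 ^ (m - (i - 1)) - 1)"
    by (rule prod.reindex_bij_witness[where i="\<lambda>i. i - 1" and j=Suc]) auto
  have c: "(\<Prod>i<k. 2 ^ (k - i) - 1 :: rat) = (\<Prod>i=1..k. 2 ^ i - 1)"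
    by (rule prod.reindex_bij_witness[where i="\<lambda>i. k - i" and j="\<lambda>i. k - i"]) auto
  have "(2::rat) ^ i \<noteq> 1" if "i \<ge> 1" for i using power_inject_exp[of "2::rat" i 0] that by simp
  then have nz: "(\<Prod>i=1..k. 2 ^ i - 1 :: rat) \<noteq> 0"
    by (simp add: prod_zero_iff)
  show ?thesis
    unfolding gauss2_def prod_dividef a[OF assms] a[OF order_refl] b c using nz by (simp add: field_simps)
qed

context finite_comm_group
begin

lemma card_elementary_subgroups_gauss2:
  assumes V: "subgroup V G" "V \<subseteq> torsion 2" "card V = 2 ^ m" and k: "k \<le> m"
  shows "of_nat (card {U \<in> subgroups_in V. card U = 2 ^ k}) = gauss2 m k"
proof -
  let ?N = "card {U \<in> subgroups_in V. card U = 2 ^ k}"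
  have "int ?N * (\<Prod>i<k. 2 ^ k - 2 ^ i) = (\<Prod>i<k. 2 ^ m - 2 ^ i)"
    using card_elementary_subgroups[OF V(1,2), of k] V(3) by simp
  then have "rat_of_int (int ?N * (\<Prod>i<k. 2 ^ k - 2 ^ i)) = rat_of_int (\<Prod>i<k. 2 ^ m - 2 ^ i)" by simp
  then have "rat_of_nat ?N * (\<Prod>i<k. 2 ^ k - 2 ^ i) = gauss2 m k * (\<Prod>i<k. 2 ^ k - 2 ^ i)"
    unfolding gauss2_eq_ratio[OF k] by simp
  moreover have "(\<Prod>i<k. 2 ^ k - 2 ^ i :: rat) \<noteq> 0" by (auto simp: prod_zero_iff)
  ultimately show ?thesis by simp
qed

lemma sum_over_elementary_subgroups:
  assumes V: "subgroup V G" "V \<subseteq> torsion 2" "card V = 2 ^ m"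
  shows "(\<Sum>U\<in>subgroups_in V. F (card U)) = (\<Sum>k=0..m. gauss2 m k * F (2 ^ k))"
proof -
  have k: "\<exists>k\<in>{0..m}. card U = 2 ^ k" if "U \<in> subgroups_in V" for U
  proof -
    have "card U dvd 2 ^ m" using that card_subgroup_dvd[of U V] V by (auto simp: subgroups_in_def)
    then show ?thesis using divides_primepow_nat[of 2 "card U" m] by auto
  qed
  have "subgroups_in V = (\<Union>k\<in>{0..m}. {U \<in> subgroups_in V. card U = 2 ^ k})" using k by blast
  then have "(\<Sum>U\<in>subgroups_in V. F (card U)) = (\<Sum>U\<in>(\<Union>k\<in>{0..m}. {U \<in> subgroups_in V. card U = 2 ^ k}). F (card U))"
    by simp
  also have "\<dots> = (\<Sum>k=0..m. \<Sum>U\<in>{U \<in> subgroups_in V. card U = 2 ^ k}. F (card U))"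
    by (rule sum.UNION_disjoint) (use finite_subgroups_in in auto)
  also have "\<dots> = (\<Sum>k=0..m. gauss2 m k * F (2 ^ k))"
    by (rule sum.cong[OF refl]) (simp add: card_elementary_subgroups_gauss2[OF V, symmetric])
  finally show ?thesis .
qed

lemma cross_cancel:
  assumes "a \<in> carrier G" "b \<in> carrier G" "p \<in> carrier G" "q \<in> carrier G" "a \<otimes> b = p \<otimes> q"
  shows "inv p \<otimes> a = q \<otimes> inv b"
proof -
  have "inv p \<otimes> a = inv p \<otimes> (a \<otimes> b) \<otimes> inv b" using assms(1-4) by (simp add: m_assoc)
  also have "\<dots> = q \<otimes> inv b" unfolding assms(5) using assms(1-4) by (simp add: m_assoc[symmetric])
  finally show ?thesis .
qed

lemma eq_if_inv_mult_one:
  assumes "p \<in> carrier G" "a \<in> carrier G" "inv p \<otimes> a = \<one>"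
  shows "a = p"
proof -
  have "a = p \<otimes> (inv p \<otimes> a)" using assms(1,2) by (simp add: m_assoc[symmetric])
  then show ?thesis using assms by simp
qed

lemma card_subgroups_elementary:
  assumes "subgroup V G" "V \<subseteq> torsion 2" "card V = 2 ^ m"
  shows "of_nat (card (subgroups_in V)) = (\<Sum>k=0..m. gauss2 m k)"
  using sum_over_elementary_subgroups[OF assms, of "\<lambda>_. 1"] by simp

text \<open>Let \<open>c\<^sub>y\<close> be the power of \<open>c\<close> that has order \<open>2 ^ y\<close>. A subgroup of the product that is not contained in
  \<open>V\<close> projects to the subgroup of order \<open>2 ^ y\<close> of the cyclic factor for some \<open>y \<ge> 1\<close>. It is generated by its
  intersection \<open>U\<close> with \<open>V\<close> and an element \<open>v \<otimes> c\<^sub>y\<close>; here \<open>v \<in> V\<close> is arbitrary, and exactly the elements of the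
  coset of \<open>v\<close> modulo \<open>U\<close> give the same subgroup. Squares of elements of \<open>V\<close> being trivial, no further
  intersection with \<open>V\<close> arises. So for every \<open>U\<close> each of the \<open>x\<close> values of \<open>y\<close> contributes as many subgroups as
  \<open>U\<close> has cosets in \<open>V\<close>; the summand \<open>1\<close> counts \<open>U\<close> itself.\<close>
lemma card_subgroups_elementary_times_cyclic:
  assumes V: "subgroup V G" "V \<subseteq> torsion 2"
    and c: "c \<in> carrier G" "ord c = 2 ^ x" and int: "V \<inter> generate G {c} = {\<one>}"
  shows "card (subgroups_in (V <#> generate G {c})) = (\<Sum>U\<in>subgroups_in V. 1 + x * (card V div card U))"
proof -
  interpret V: subgroup V G by (rule V(1))
  let ?C = "generate G {c}" and ?W = "V <#> generate G {c}"
  have gc: "g \<in> ?C \<longleftrightarrow> (\<exists>i::int. g = c [^] i)" for g unfolding generate_pow[OF c(1)] by blast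
  have subC: "subgroup ?C G" by (rule generate_is_subgroup) (use c in auto)
  have VW: "V \<subseteq> ?W" using subgroup.one_closed[OF subC] V.subset unfolding set_mult_def
    by (force intro: r_one[symmetric])
  have CV: "c [^] (i::int) \<in> V \<longleftrightarrow> c [^] i = \<one>" for i using int gc V.one_closed by blast
  have Wmem: "g \<in> ?W \<longleftrightarrow> (\<exists>v\<in>V. \<exists>i::int. g = v \<otimes> c [^] i)" for g
  proof
    assume "g \<in> ?W"
    then obtain v h where "v \<in> V" "h \<in> ?C" "g = v \<otimes> h" unfolding set_mult_def by blast
    then show "\<exists>v\<in>V. \<exists>i::int. g = v \<otimes> c [^] i" using gc[of h] by blast
  next
    assume "\<exists>v\<in>V. \<exists>i::int. g = v \<otimes> c [^] i"
    then obtain v and i :: int where "v \<in> V" "g = v \<otimes> c [^] i" by blast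
    moreover have "c [^] i \<in> ?C" using gc by blast
    ultimately show "g \<in> ?W" unfolding set_mult_def by blast
  qed
  \<comment> \<open>the element \<open>c\<^sub>y\<close> of order \<open>2 ^ y\<close>\<close>
  define cy where "cy y = c [^] ((2::nat) ^ (x - y))" for y
  have cyc: "cy y \<in> carrier G" for y using c by (simp add: cy_def)
  have cyC: "(cy y) [^] (i::int) = c [^] (2 ^ (x - y) * i)" for y i
    unfolding cy_def by (metis int_pow_int int_pow_pow c(1) of_nat_numeral of_nat_power)
  have ordcy: "ord (cy y) = 2 ^ y" if "y \<le> x" for y
  proof -
    have "(2::nat) ^ x = 2 ^ (x - y) * 2 ^ y" using that by (simp flip: power_add)
    then show ?thesis unfolding cy_def using ord_pow[OF c(1), of "2 ^ (x - y)"] c(2) by simp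
  qed
  have cy1: "(cy y) [^] (i::int) = \<one> \<longleftrightarrow> 2 ^ y dvd i" if "y \<le> x" for y i
    using int_pow_eq_id[OF cyc] ordcy[OF that] by simp
  have cyV: "(cy y) [^] (i::int) \<in> V \<longleftrightarrow> (cy y) [^] i = \<one>" for y i using CV cyC by simp
  have vpow: "v [^] (i::int) = (if even i then \<one> else v)" if "v \<in> V" for v i
  proof -
    have vc: "v \<in> carrier G" using that by simp
    have two: "v [^] (2::int) = \<one>"
      using that V(2) vc int_pow_int[of G v 2] by (auto simp: torsion_def)
    have e: "v [^] (2 * j :: int) = \<one>" for j
      using vc int_pow_pow[of v 2 j] two by (simp add: int_pow_one)
    show ?thesis
    proof (cases "even i")
      case True
      then show ?thesis using e by auto
    next
      case False
      then obtain j where "i = 2 * j + 1" by (rule oddE)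
      then show ?thesis using e vc False by (simp add: int_pow_mult)
    qed
  qed
  define gen where "gen U y v = U <#> generate G {v \<otimes> cy y}" for U y v
  have genmem: "g \<in> gen U y v \<longleftrightarrow> (\<exists>u\<in>U. \<exists>i::int. g = u \<otimes> v [^] i \<otimes> (cy y) [^] i)"
    if "v \<in> V" "subgroup U G" for g U y v
  proof -
    have vc: "v \<in> carrier G" using that by simp
    have "generate G {v \<otimes> cy y} = {(v \<otimes> cy y) [^] (i::int) | i. True}"
      using generate_pow[of "v \<otimes> cy y"] vc cyc by simp
    moreover have "(v \<otimes> cy y) [^] (i::int) = v [^] i \<otimes> (cy y) [^] i" for i
      using int_pow_mult_distrib[OF m_comm] vc cyc by blast
    ultimately have "g \<in> gen U y v \<longleftrightarrow> (\<exists>u\<in>U. \<exists>i::int. g = u \<otimes> (v [^] i \<otimes> (cy y) [^] i))"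
      unfolding gen_def set_mult_def by auto
    also have "\<dots> \<longleftrightarrow> (\<exists>u\<in>U. \<exists>i::int. g = u \<otimes> v [^] i \<otimes> (cy y) [^] i)"
      using vc cyc subgroup.mem_carrier[OF that(2)] by (intro bex_cong refl ex_cong1) (simp add: m_assoc)
    finally show ?thesis .
  qed
  have gen_sub: "subgroup (gen U y v) G" if "v \<in> V" "subgroup U G" for U y v
    unfolding gen_def
    by (rule mult_subgroups[OF that(2) generate_is_subgroup]) (use that cyc in auto)
  have gen_W: "gen U y v \<subseteq> ?W" if v: "v \<in> V" and U: "subgroup U G" "U \<subseteq> V" for U y v
  proof
    fix g assume "g \<in> gen U y v"
    then obtain u i where "u \<in> U" "g = u \<otimes> v [^] i \<otimes> (cy y) [^] (i::int)" using genmem[OF v U(1)]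
      by blast
    moreover from this have "u \<otimes> v [^] i \<in> V" using U v vpow V.m_closed V.one_closed by (auto split: if_splits)
    ultimately show "g \<in> ?W" unfolding Wmem cyC by blast
  qed
  \<comment> \<open>powers of \<open>v\<close> depend only on the parity of the exponent, which by \<open>y \<ge> 1\<close> is determined by the power of \<open>c\<^sub>y\<close>\<close>
  have comp: "w \<otimes> (cy y) [^] j \<in> gen U y v \<longleftrightarrow> w \<in> (if even j then U else (\<lambda>u. u \<otimes> v) ` U)"
    if y: "1 \<le> y" "y \<le> x" and v: "v \<in> V" and U: "subgroup U G" "U \<subseteq> V" and w: "w \<in> V" for U y v w and j :: int
  proof
    have wc: "w \<in> carrier G" and vc: "v \<in> carrier G" using w v by auto
    assume "w \<otimes> (cy y) [^] j \<in> gen U y v"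
    then obtain u i where u: "u \<in> U" and e: "w \<otimes> (cy y) [^] j = u \<otimes> v [^] i \<otimes> (cy y) [^] (i::int)"
      using genmem[OF v U(1)] by blast
    have uv: "u \<otimes> v [^] i \<in> V" using u U v vpow V.m_closed V.one_closed by (auto split: if_splits)
    have uc: "u \<otimes> v [^] i \<in> carrier G" using uv by simp
    have "inv (u \<otimes> v [^] i) \<otimes> w = (cy y) [^] i \<otimes> inv ((cy y) [^] j)"
      by (rule cross_cancel[OF _ _ _ _ e]) (use wc uc cyc in auto)
    also have "\<dots> = (cy y) [^] (i - j)" using cyc by (simp add: int_pow_diff)
    finally have eq: "inv (u \<otimes> v [^] i) \<otimes> w = (cy y) [^] (i - j)" .
    moreover have "inv (u \<otimes> v [^] i) \<otimes> w \<in> V" using uv w by simp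
    ultimately have one: "(cy y) [^] (i - j) = \<one>" using cyV by metis
    then have "2 ^ y dvd i - j" using cy1 y by blast
    moreover have "(2::int) dvd 2 ^ y" using y(1) by (simp add: dvd_power)
    ultimately have "even (i - j)" using dvd_trans by blast
    then have par: "even i \<longleftrightarrow> even j" by presburger
    have "inv (u \<otimes> v [^] i) \<otimes> w = \<one>" using eq one by simp
    then have "w = u \<otimes> v [^] i" using eq_if_inv_mult_one[OF uc wc] by blast
    then show "w \<in> (if even j then U else (\<lambda>u. u \<otimes> v) ` U)"
      using u U(2) par vpow[OF v, of i] by (auto split: if_splits)
  next
    assume "w \<in> (if even j then U else (\<lambda>u. u \<otimes> v) ` U)"
    then obtain u where "u \<in> U" "w = u \<otimes> v [^] j" using vpow[OF v, of j] U(2)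
      by (auto split: if_splits)
    then show "w \<otimes> (cy y) [^] j \<in> gen U y v" using genmem[OF v U(1)] by blast
  qed
  have genV: "gen U y v \<inter> V = U"
    if y: "1 \<le> y" "y \<le> x" and v: "v \<in> V" and U: "subgroup U G" "U \<subseteq> V" for U y v
  proof -
    have "w \<in> gen U y v \<longleftrightarrow> w \<in> U" if "w \<in> V" for w
      using comp[OF y v U that, of 0] V.mem_carrier[OF that] by (simp only: int_pow_0 r_one even_zero if_True)
    then show ?thesis using U(2) by blast
  qed
  have gen1: "w \<otimes> cy y \<in> gen U y v \<longleftrightarrow> w \<in> (\<lambda>u. u \<otimes> v) ` U"
    if y: "1 \<le> y" "y \<le> x" and v: "v \<in> V" and U: "subgroup U G" "U \<subseteq> V" and w: "w \<in> V" for U y v w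
    using comp[OF y v U w, of 1] by (simp only: int_pow_1[OF cyc] odd_one if_False)
  have gen_mono: "gen U y w \<subseteq> gen U y v"
    if v: "v \<in> V" "w \<in> V" and U: "subgroup U G" and m: "w \<otimes> cy y \<in> gen U y v" for U y v w
  proof -
    have s: "subgroup (gen U y v) G" by (rule gen_sub[OF v(1) U])
    have "generate G {w \<otimes> cy y} \<subseteq> gen U y v" by (rule generate_subgroup_incl[OF _ s]) (use m in simp)
    moreover have "U \<subseteq> gen U y v"
    proof
      fix u assume u: "u \<in> U"
      then have "u = u \<otimes> v [^] (0::int) \<otimes> (cy y) [^] (0::int)" using subgroup.subset[OF U] by auto
      then show "u \<in> gen U y v" using genmem[OF v(1) U] u by blast
    qed
    ultimately show ?thesis unfolding gen_def[of U y w] set_mult_def using subgroup.m_closed[OF s] by blast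
  qed
  have fibre: "{w \<in> V. gen U y w = gen U y v} = (\<lambda>u. u \<otimes> v) ` U"
    if y: "1 \<le> y" "y \<le> x" and v: "v \<in> V" and U: "subgroup U G" "U \<subseteq> V" for U y v
  proof
    have self: "w \<otimes> cy y \<in> gen U y w" if "w \<in> V" for w
    proof -
      have "w = \<one> \<otimes> w" using that by simp
      then have "w \<in> (\<lambda>u. u \<otimes> w) ` U" using subgroup.one_closed[OF U(1)] by (rule image_eqI)
      then show ?thesis using gen1[OF y that U that] by blast
    qed
    show "{w \<in> V. gen U y w = gen U y v} \<subseteq> (\<lambda>u. u \<otimes> v) ` U"
      using self gen1[OF y v U] by blast
    show "(\<lambda>u. u \<otimes> v) ` U \<subseteq> {w \<in> V. gen U y w = gen U y v}"
    proof
      fix w assume w: "w \<in> (\<lambda>u. u \<otimes> v) ` U"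
      then obtain u where u: "u \<in> U" "w = u \<otimes> v" by blast
      have wV: "w \<in> V" using u v U(2) by blast
      have uc: "u \<in> carrier G" "v \<in> carrier G" using u v U(2) by auto
      have "gen U y w \<subseteq> gen U y v" using gen_mono[OF v wV U(1)] gen1[OF y v U wV] w by blast
      moreover have "v = inv u \<otimes> w" using u(2) uc by (simp add: m_assoc[symmetric])
      then have "v \<in> (\<lambda>u. u \<otimes> w) ` U" using subgroup.m_inv_closed[OF U(1) u(1)] by (rule image_eqI)
      then have "gen U y v \<subseteq> gen U y w" using gen_mono[OF wV v U(1)] gen1[OF y wV U v] by blast
      ultimately show "w \<in> {w \<in> V. gen U y w = gen U y v}" using wV by blast
    qed
  qed
  have finV: "finite V" by (rule finite_subgroup[OF V(1)])
  define A where "A U y = gen U y ` V" for U y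
  have cardA: "card (A U y) = card V div card U" if y: "1 \<le> y" "y \<le> x" and U: "U \<in> subgroups_in V" for U y
  proof -
    have U': "subgroup U G" "U \<subseteq> V" using U by (auto simp: subgroups_in_def)
    have cU: "card ((\<lambda>u. u \<otimes> v) ` U) = card U" if "v \<in> V" for v
    proof (rule card_image)
      have "inj_on (\<lambda>u. u \<otimes> v) (carrier G)" using that by (intro inj_onI) simp
      then show "inj_on (\<lambda>u. u \<otimes> v) U" using subgroup.subset[OF U'(1)] inj_on_subset by blast
    qed
    have "card V = (\<Sum>H\<in>A U y. card {w \<in> V. gen U y w = H})"
      using sum_fun_comp[OF finV, of "A U y" "gen U y" "\<lambda>_. 1 :: nat"] finV by (simp add: A_def)
    also have "\<dots> = (\<Sum>H\<in>A U y. card U)"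
      by (rule sum.cong[OF refl]) (use fibre[OF y _ U'] cU in \<open>auto simp: A_def\<close>)
    finally have "card V = card (A U y) * card U" by simp
    moreover have "card U > 0" using finite_subgroup[OF U'(1)] subgroup.one_closed[OF U'(1)] card_gt_0_iff by blast
    ultimately show ?thesis by simp
  qed
  \<comment> \<open>recovers \<open>y\<close> from a subgroup: the exponents of \<open>c\<close> that occur in it\<close>
  have level: "{i::int. \<exists>v\<in>V. v \<otimes> c [^] i \<in> gen U y v0} = {i. 2 ^ (x - y) dvd i}"
    if y: "1 \<le> y" "y \<le> x" and v: "v0 \<in> V" and U: "subgroup U G" "U \<subseteq> V" for U y v0
  proof (intro equalityI subsetI)
    fix i :: int assume "i \<in> {i. \<exists>v\<in>V. v \<otimes> c [^] i \<in> gen U y v0}"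
    then obtain w where w: "w \<in> V" "w \<otimes> c [^] i \<in> gen U y v0" by blast
    then obtain u j where u: "u \<in> U" and e: "w \<otimes> c [^] i = u \<otimes> v0 [^] j \<otimes> (cy y) [^] (j::int)"
      using genmem[OF v U(1)] by blast
    have uv: "u \<otimes> v0 [^] j \<in> V" using u U v vpow V.m_closed V.one_closed by (auto split: if_splits)
    have cc: "w \<in> carrier G" "u \<otimes> v0 [^] j \<in> carrier G" using w uv by auto
    have "inv (u \<otimes> v0 [^] j) \<otimes> w = (cy y) [^] j \<otimes> inv (c [^] i)"
      by (rule cross_cancel[OF _ _ _ _ e]) (use cc cyc c in auto)
    also have "\<dots> = c [^] (2 ^ (x - y) * j - i)" using c by (simp add: cyC int_pow_diff)
    finally have "c [^] (2 ^ (x - y) * j - i) \<in> V" using uv w by (metis V.m_closed V.m_inv_closed)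
    then have "int (2 ^ x) dvd 2 ^ (x - y) * j - i" using CV int_pow_eq_id[OF c(1)] c(2) by metis
    moreover have "(2::int) ^ (x - y) dvd int (2 ^ x)" by (simp add: le_imp_power_dvd)
    ultimately have "2 ^ (x - y) dvd 2 ^ (x - y) * j - i" using dvd_trans by blast
    then show "i \<in> {i. 2 ^ (x - y) dvd i}" by (metis dvd_diff_right_iff dvd_triv_left mem_Collect_eq)
  next
    fix i :: int assume "i \<in> {i. 2 ^ (x - y) dvd i}"
    then obtain j where j: "i = 2 ^ (x - y) * j" by blast
    have "v0 [^] j \<otimes> c [^] (2 ^ (x - y) * j) = \<one> \<otimes> v0 [^] j \<otimes> (cy y) [^] j" using v
      by (simp add: cyC)
    then have "v0 [^] j \<otimes> c [^] (2 ^ (x - y) * j) \<in> gen U y v0"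
      using genmem[OF v U(1)] subgroup.one_closed[OF U(1)] by blast
    moreover have "v0 [^] j \<in> V" using vpow[OF v] v by simp
    ultimately show "i \<in> {i. \<exists>v\<in>V. v \<otimes> c [^] i \<in> gen U y v0}" unfolding j by blast
  qed
  have cover: "\<exists>U\<in>subgroups_in V. \<exists>y\<in>{1..x}. H \<in> A U y"
    if H: "subgroup H G" "H \<subseteq> ?W" "\<not> H \<subseteq> V" for H
  proof -
    \<comment> \<open>the exponents of \<open>c\<close> that occur in \<open>H\<close> form a subgroup of the integers\<close>
    define I where "I = {i::int. \<exists>v\<in>V. v \<otimes> c [^] i \<in> H}"
    have cx: "c [^] (int (2 ^ x)) = \<one>" using int_pow_eq_id[OF c(1)] c(2) by simp
    have Iadd: "i + j \<in> I" if ij: "i \<in> I" "j \<in> I" for i j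
    proof -
      obtain v w where vw: "v \<in> V" "v \<otimes> c [^] i \<in> H" "w \<in> V" "w \<otimes> c [^] j \<in> H" using ij
        by (auto simp: I_def)
      have "(v \<otimes> c [^] i) \<otimes> (w \<otimes> c [^] j) = (v \<otimes> w) \<otimes> c [^] (i + j)"
        using vw c V.mem_carrier by (simp add: int_pow_mult m_ac)
      then have "(v \<otimes> w) \<otimes> c [^] (i + j) \<in> H" using subgroup.m_closed[OF H(1) vw(2,4)] by simp
      then show ?thesis using V.m_closed[OF vw(1,3)] by (auto simp: I_def)
    qed
    have Ineg: "- i \<in> I" if i: "i \<in> I" for i
    proof -
      obtain v where v: "v \<in> V" "v \<otimes> c [^] i \<in> H" using i by (auto simp: I_def)
      have "inv (v \<otimes> c [^] i) = inv v \<otimes> c [^] (- i)" using v c V.mem_carrier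
        by (simp add: inv_mult int_pow_neg)
      then have "inv v \<otimes> c [^] (- i) \<in> H" using subgroup.m_inv_closed[OF H(1) v(2)] by simp
      then show ?thesis using v(1) by (auto simp: I_def)
    qed
    have Ix: "int (2 ^ x) \<in> I"
      using subgroup.one_closed[OF H(1)] V.one_closed cx unfolding I_def by (intro CollectI bexI[of _ \<one>]) simp_all
    obtain g where g: "g dvd 2 ^ x" "I = {i. int g dvd i}"
      using int_subgroup_multiples[OF _ Ix Iadd Ineg] by auto
    have gI: "int g \<in> I" and gdvd: "\<And>i. i \<in> I \<Longrightarrow> int g dvd i" using g(2) by auto
    obtain k where k: "k \<le> x" "g = 2 ^ k" using g(1) divides_primepow_nat[of 2 g x] by auto
    define y where "y = x - k"
    have yx: "y \<le> x" "g = 2 ^ (x - y)" using k by (auto simp: y_def)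
    have y1: "1 \<le> y"
    proof (rule ccontr)
      assume "\<not> 1 \<le> y"
      then have gx: "int g = int (2 ^ x)" using yx by simp
      have "H \<subseteq> V"
      proof
        fix h assume h: "h \<in> H"
        then obtain v i where vi: "v \<in> V" "h = v \<otimes> c [^] (i::int)" using H(2) Wmem by blast
        then have "i \<in> I" using h by (auto simp: I_def)
        then have "int (ord c) dvd i" using gdvd gx c(2) by metis
        then have "c [^] i = \<one>" using int_pow_eq_id[OF c(1)] by blast
        then show "h \<in> V" using vi by simp
      qed
      then show False using H(3) by blast
    qed
    define U where "U = H \<inter> V"
    have U: "subgroup U G" "U \<subseteq> V" using subgroups_Inter_pair[OF H(1) V(1)] by (auto simp: U_def)
    obtain v where v: "v \<in> V" "v \<otimes> c [^] int g \<in> H" using gI by (auto simp: I_def)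
    have cg: "c [^] int g = cy y" unfolding cy_def yx(2) by (simp only: int_pow_int)
    have vH: "v \<otimes> cy y \<in> H" using v(2) cg by simp
    have "gen U y v = H"
    proof
      have "generate G {v \<otimes> cy y} \<subseteq> H" by (rule generate_subgroup_incl[OF _ H(1)]) (use vH in simp)
      then show "gen U y v \<subseteq> H"
        unfolding gen_def set_mult_def U_def using subgroup.m_closed[OF H(1)] by blast
      show "H \<subseteq> gen U y v"
      proof
        fix h assume h: "h \<in> H"
        then obtain w i where wi: "w \<in> V" "h = w \<otimes> c [^] (i::int)" using H(2) Wmem by blast
        then have "i \<in> I" using h by (auto simp: I_def)
        then obtain j where j: "i = int g * j" using gdvd by blast
        have ci: "c [^] i = (cy y) [^] j" unfolding j using cyC[of y j] yx(2) by simp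
        have vj: "(v \<otimes> cy y) [^] j = v [^] j \<otimes> (cy y) [^] j"
          using int_pow_mult_distrib[OF m_comm] v(1) V.mem_carrier cyc by blast
        have vjV: "v [^] j \<in> V" using vpow[OF v(1)] v(1) by simp
        have cc: "w \<in> carrier G" "v [^] j \<in> carrier G" "(cy y) [^] j \<in> carrier G" using wi vjV cyc by auto
        have e: "h \<otimes> inv ((v \<otimes> cy y) [^] j) = w \<otimes> inv (v [^] j)"
          unfolding wi(2) ci vj using cc by (simp add: inv_mult m_ac)
        have "h \<otimes> inv ((v \<otimes> cy y) [^] j) \<in> H"
          using subgroup.m_closed[OF H(1) h subgroup.m_inv_closed[OF H(1) subgroup_int_pow[OF H(1) vH]]] .
        then have "w \<otimes> inv (v [^] j) \<in> U" using e wi(1) vjV by (simp add: U_def)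
        moreover have "h = (w \<otimes> inv (v [^] j)) \<otimes> v [^] j \<otimes> (cy y) [^] j"
          unfolding wi(2) ci using cc by (simp add: m_assoc)
        ultimately show "h \<in> gen U y v" using genmem[OF v(1) U(1)] by blast
      qed
    qed
    then have "H \<in> A U y" using v(1) by (auto simp: A_def)
    moreover have "U \<in> subgroups_in V" "y \<in> {1..x}" using U y1 yx(1) by (simp_all add: subgroups_in_def)
    ultimately show ?thesis by blast
  qed
  let ?P = "SIGMA U:subgroups_in V. {1..x}"
  have split: "subgroups_in ?W = subgroups_in V \<union> (\<Union>(U, y)\<in>?P. A U y)"
  proof
    show "subgroups_in ?W \<subseteq> subgroups_in V \<union> (\<Union>(U, y)\<in>?P. A U y)"
    proof
      fix H assume "H \<in> subgroups_in ?W"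
      then have H: "subgroup H G" "H \<subseteq> ?W" by (auto simp: subgroups_in_def)
      show "H \<in> subgroups_in V \<union> (\<Union>(U, y)\<in>?P. A U y)"
      proof (cases "H \<subseteq> V")
        case False
        then show ?thesis using cover[OF H] by blast
      qed (use H in \<open>auto simp: subgroups_in_def\<close>)
    qed
    show "subgroups_in V \<union> (\<Union>(U, y)\<in>?P. A U y) \<subseteq> subgroups_in ?W"
    proof
      fix H assume "H \<in> subgroups_in V \<union> (\<Union>(U, y)\<in>?P. A U y)"
      then consider "H \<in> subgroups_in V" | U y v where "U \<in> subgroups_in V" "v \<in> V" "H = gen U y v"
        unfolding A_def by blast
      then show "H \<in> subgroups_in ?W"
      proof cases
        case 1
        then show ?thesis using VW by (auto simp: subgroups_in_def)
      next
        case (2 U y v)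
        then have "subgroup U G" "U \<subseteq> V" by (simp_all add: subgroups_in_def)
        then show ?thesis unfolding 2(3) subgroups_in_def using gen_W[OF 2(2)] gen_sub[OF 2(2)] by simp
      qed
    qed
  qed
  have notV: "\<not> H \<subseteq> V \<and> H \<inter> V = U \<and> {i::int. \<exists>v\<in>V. v \<otimes> c [^] i \<in> H} = {i::int. 2 ^ (x - y) dvd i}"
    if UV: "U \<in> subgroups_in V" and yx: "y \<in> {1..x}" and HA: "H \<in> A U y" for U y H
  proof -
    have y: "1 \<le> y" "y \<le> x" and U: "subgroup U G" "U \<subseteq> V" using UV yx by (auto simp: subgroups_in_def)
    obtain v where v: "v \<in> V" "H = gen U y v" using HA unfolding A_def by blast
    have "v \<in> (\<lambda>u. u \<otimes> v) ` U" using subgroup.one_closed[OF U(1)] v(1)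
      by (intro image_eqI[of _ _ \<one>]) auto
    then have m: "v \<otimes> cy y \<in> H" using gen1[OF y v(1) U v(1)] v(2) by blast
    have "\<not> H \<subseteq> V"
    proof
      assume "H \<subseteq> V"
      then have "inv v \<otimes> (v \<otimes> cy y) \<in> V" using m v(1) by blast
      then have "cy y \<in> V" using v(1) cyc by (simp add: m_assoc[symmetric])
      then have "(cy y) [^] (1::int) = \<one>" using cyV[of y 1] cyc by simp
      then have "(2::int) ^ y dvd 1" using cy1[OF y(2), of 1] by blast
      then show False using y(1) by simp
    qed
    then show ?thesis using genV[OF y v(1) U] level[OF y v(1) U] v(2) by blast
  qed
  have finA: "finite (A U y)" for U y using finV by (simp add: A_def)
  have "card (subgroups_in ?W) = card (subgroups_in V) + card (\<Union>(U, y)\<in>?P. A U y)"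
    unfolding split
  proof (rule card_Un_disjoint)
    show "finite (\<Union>(U, y)\<in>?P. A U y)" using finA finite_subgroups_in by auto
    show "subgroups_in V \<inter> (\<Union>(U, y)\<in>?P. A U y) = {}"
      using notV by (auto simp: subgroups_in_def)
  qed (rule finite_subgroups_in)
  also have "card (\<Union>(U, y)\<in>?P. A U y) = (\<Sum>p\<in>?P. card (case p of (U, y) \<Rightarrow> A U y))"
  proof (rule card_UN_disjoint)
    show "\<forall>p\<in>?P. \<forall>q\<in>?P. p \<noteq> q \<longrightarrow> (case p of (U, y) \<Rightarrow> A U y) \<inter> (case q of (U, y) \<Rightarrow> A U y) = {}"
    proof (intro ballI impI)
      fix p q assume pq: "p \<in> ?P" "q \<in> ?P" "p \<noteq> q"
      obtain U y U' y' where p: "p = (U, y)" and q: "q = (U', y')" by (cases p, cases q)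
      have U: "U \<in> subgroups_in V" "U' \<in> subgroups_in V" and y: "y \<in> {1..x}" "y' \<in> {1..x}"
        using pq(1,2) p q by auto
      have False if H: "H \<in> A U y" "H \<in> A U' y'" for H
      proof -
        have e: "U = U'" using notV[OF U(1) y(1) H(1)] notV[OF U(2) y(2) H(2)] by blast
        have "{i::int. 2 ^ (x - y) dvd i} = {i. 2 ^ (x - y') dvd i}"
          using notV[OF U(1) y(1) H(1)] notV[OF U(2) y(2) H(2)] by blast
        then have dv: "(2::int) ^ (x - y) dvd i \<longleftrightarrow> 2 ^ (x - y') dvd i" for i by (metis mem_Collect_eq)
        have a: "(2::int) ^ (x - y) dvd 2 ^ (x - y')" using dv[of "2 ^ (x - y')"] by simp
        have b: "(2::int) ^ (x - y') dvd 2 ^ (x - y)" using dv[of "2 ^ (x - y)"] by simp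
        have "x - y \<le> x - y'" "x - y' \<le> x - y" using zdvd_imp_le[OF a] zdvd_imp_le[OF b] by simp_all
        then have "y = y'" using y by auto
        then show False using e pq(3) p q by simp
      qed
      then show "(case p of (U, y) \<Rightarrow> A U y) \<inter> (case q of (U, y) \<Rightarrow> A U y) = {}"
        unfolding p q by auto
    qed
  qed (use finA finite_subgroups_in in auto)
  also have "\<dots> = (\<Sum>U\<in>subgroups_in V. \<Sum>y=1..x. card (A U y))"
    by (subst sum.Sigma) (auto simp: finite_subgroups_in intro!: sum.cong)
  also have "\<dots> = (\<Sum>U\<in>subgroups_in V. x * (card V div card U))"
    by (rule sum.cong[OF refl]) (use cardA in simp)
  finally show ?thesis unfolding sum.distrib by simp
qed

lemma card_subgroups_elementary_times_cyclic_gauss2: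
  assumes V: "subgroup V G" "V \<subseteq> torsion 2" "card V = 2 ^ m"
    and c: "c \<in> carrier G" "ord c = 2 ^ x" and int: "V \<inter> generate G {c} = {\<one>}"
  shows "of_nat (card (subgroups_in (V <#> generate G {c}))) = (\<Sum>k=0..m. (2 ^ (m - k) * of_nat x + 1) * gauss2 m k)"
proof -
  have "rat_of_nat (card (subgroups_in (V <#> generate G {c}))) = (\<Sum>U\<in>subgroups_in V. 1 + of_nat x * of_nat (2 ^ m div card U))"
    using card_subgroups_elementary_times_cyclic[OF V(1,2) c int] V(3) by simp
  also have "\<dots> = (\<Sum>k=0..m. gauss2 m k * (1 + of_nat x * of_nat (2 ^ m div 2 ^ k)))"
    by (rule sum_over_elementary_subgroups[OF V])
  also have "\<dots> = (\<Sum>k=0..m. (2 ^ (m - k) * of_nat x + 1) * gauss2 m k)"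
    by (rule sum.cong[OF refl]) (simp add: power_diff[symmetric] algebra_simps)
  finally show ?thesis .
qed

end

section \<open>Groups of affine permutations\<close>

lemma affine_map_perm: "affine_map n a t g \<Longrightarrow> g permutes {1..n}"
  by (simp add: affine_map_def)

lemma affine_map_cong_apply: "affine_map n a t g \<Longrightarrow> i \<in> {1..n} \<Longrightarrow> [int (g i) = a * int i + t] (mod int n)"
  by (simp add: affine_map_def)

lemma affine_map_range: "affine_map n a t g \<Longrightarrow> i \<in> {1..n} \<Longrightarrow> g i \<in> {1..n}"
  using permutes_in_image[OF affine_map_perm] by blast

lemma affine_map_comp:
  assumes "affine_map n a t g" "affine_map n b s h"
  shows "affine_map n (a * b) (a * s + t) (g \<circ> h)"
  unfolding affine_map_def
proof (intro conjI ballI)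
  show "g \<circ> h permutes {1..n}" by (rule permutes_compose[OF affine_map_perm[OF assms(2)] affine_map_perm[OF assms(1)]])
  fix i assume i: "i \<in> {1..n}"
  have "[int (g (h i)) = a * int (h i) + t] (mod int n)"
    using affine_map_cong_apply[OF assms(1) affine_map_range[OF assms(2) i]] .
  also have "[a * int (h i) + t = a * (b * int i + s) + t] (mod int n)"
    using affine_map_cong_apply[OF assms(2) i] by (intro cong_add cong_mult) auto
  finally show "[int ((g \<circ> h) i) = a * b * int i + (a * s + t)] (mod int n)"
    by (simp add: algebra_simps)
qed

lemma affine_map_cong:
  assumes "affine_map n a t g" "[a = b] (mod int n)" "[t = s] (mod int n)"
  shows "affine_map n b s g"
  unfolding affine_map_def
proof (intro conjI ballI)
  show "g permutes {1..n}" using assms affine_map_perm by blast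
  fix i assume i: "i \<in> {1..n}"
  have "[a * int i + t = b * int i + s] (mod int n)" using assms(2,3) by (intro cong_add cong_mult) auto
  then show "[int (g i) = b * int i + s] (mod int n)"
    using affine_map_cong_apply[OF assms(1) i] cong_trans by blast
qed

lemma affine_map_id: "affine_map n 1 0 id"
  by (simp add: affine_map_def permutes_id)

lemma affine_map_unique:
  assumes n: "n > 0" and g: "affine_map n a t g" "affine_map n b s g"
  shows "[a = b] (mod int n)" "[t = s] (mod int n)"
proof -
  have c: "[a * int i + t = b * int i + s] (mod int n)" if "i \<in> {1..n}" for i
    using affine_map_cong_apply[OF g(1) that] affine_map_cong_apply[OF g(2) that] cong_sym cong_trans by blast
  have "[a * int n + t = t] (mod int n)" "[b * int n + s = s] (mod int n)" by (simp_all add: cong_def)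
  then show ts: "[t = s] (mod int n)" using c[of n] n cong_sym cong_trans
    by (metis atLeastAtMost_iff le_refl Suc_leI One_nat_def)
  have "[a + t - t = b + s - s] (mod int n)" using c[of 1] n ts by (intro cong_diff) auto
  then show "[a = b] (mod int n)" by simp
qed

lemma affine_map_ext:
  assumes "affine_map n a t g" "affine_map n a t h"
  shows "g = h"
proof
  fix i
  show "g i = h i"
  proof (cases "i \<in> {1..n}")
    case True
    then show ?thesis
      using cong_imp_eq[OF affine_map_range[OF assms(1) True] affine_map_range[OF assms(2) True]]
        affine_map_cong_apply[OF assms(1) True] affine_map_cong_apply[OF assms(2) True] cong_sym cong_trans by blast
  next
    case False
    then show ?thesis using affine_map_perm[OF assms(1)] affine_map_perm[OF assms(2)] permutes_not_in by metis
  qed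
qed

lemma affine_map_exists:
  assumes n: "n > 0" and a: "coprime a (int n)"
  shows "\<exists>g. affine_map n a t g"
proof -
  define g where "g i = (if i \<in> {1..n} then resid n (a * int i + t) else i)" for i
  have c: "[int (g i) = a * int i + t] (mod int n)" if "i \<in> {1..n}" for i
    using that resid_cong[OF n] by (simp add: g_def)
  have "inj_on g {1..n}"
  proof (rule inj_onI)
    fix i j assume ij: "i \<in> {1..n}" "j \<in> {1..n}" "g i = g j"
    then have "[a * int i + t = a * int j + t] (mod int n)" using c cong_sym cong_trans by metis
    then have "[a * int i = a * int j] (mod int n)" by (simp add: cong_add_rcancel)
    then have "[int i = int j] (mod int n)" using a by (simp add: cong_mult_lcancel)
    then show "i = j" using cong_imp_eq ij by blast
  qed
  moreover have "g ` {1..n} \<subseteq> {1..n}" using resid_range[OF n] by (auto simp: g_def)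
  ultimately have "bij_betw g {1..n} {1..n}" unfolding bij_betw_def using endo_inj_surj[of "{1..n}" g] by blast
  then have "g permutes {1..n}" by (rule bij_imp_permutes) (auto simp: g_def)
  then show ?thesis using c unfolding affine_map_def by blast
qed

lemma affine_map_coprime:
  assumes n: "n > 0" and g: "affine_map n a t g"
  shows "coprime a (int n)"
proof -
  have "g ` {1..n} = {1..n}" using affine_map_perm[OF g] by (rule permutes_image)
  then obtain i where i: "i \<in> {1..n}" "g i = resid n (t + 1)" using resid_range[OF n] by (metis imageE)
  have "[a * int i + t = t + 1] (mod int n)"
    using affine_map_cong_apply[OF g i(1)] resid_cong[OF n, of "t + 1"] i(2) cong_sym cong_trans by metis
  then have "[a * int i + t - t = t + 1 - t] (mod int n)" by (rule cong_diff) simp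
  then have "[a * int i = 1] (mod int n)" by simp
  then show ?thesis using coprime_iff_invertible_int by blast
qed

lemma affine_map_inv:
  assumes n: "n > 0" and g: "affine_map n a t g" and b: "[a * b = 1] (mod int n)"
  shows "affine_map n b (- b * t) (inv' g)"
  unfolding affine_map_def
proof (intro conjI ballI)
  have p: "g permutes {1..n}" by (rule affine_map_perm[OF g])
  show "inv' g permutes {1..n}" by (rule permutes_inv[OF p])
  fix i assume i: "i \<in> {1..n}"
  let ?j = "inv' g i"
  have j: "?j \<in> {1..n}" "g ?j = i" using permutes_in_image[OF permutes_inv[OF p]] permutes_inverses[OF p] i by blast+
  have "[int i = a * int ?j + t] (mod int n)" using affine_map_cong_apply[OF g j(1)] j(2) by simp
  then have "[b * int i + - b * t = b * (a * int ?j + t) + - b * t] (mod int n)" by (intro cong_add cong_mult) auto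
  also have "b * (a * int ?j + t) + - b * t = (a * b) * int ?j" by (simp add: algebra_simps)
  also have "[(a * b) * int ?j = 1 * int ?j] (mod int n)" using b by (intro cong_mult) auto
  finally show "[int ?j = b * int i + - b * t] (mod int n)" by (simp add: cong_sym)
qed

definition unit_group :: "nat \<Rightarrow> int monoid" where
  "unit_group n = \<lparr>carrier = {a \<in> {0..<int n}. coprime a (int n)}, monoid.mult = (\<lambda>a b. (a * b) mod int n), one = 1 mod int n\<rparr>"

lemma unit_group_simps:
  "carrier (unit_group n) = {a \<in> {0..<int n}. coprime a (int n)}"
  "a \<otimes>\<^bsub>unit_group n\<^esub> b = (a * b) mod int n" "\<one>\<^bsub>unit_group n\<^esub> = 1 mod int n"
  by (simp_all add: unit_group_def)

lemma finite_comm_group_unit_group: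
  assumes n: "n > 0"
  shows "finite_comm_group (unit_group n)"
proof -
  have cop: "coprime (a mod int n) (int n) \<longleftrightarrow> coprime a (int n)" for a
    using n by (metis coprime_mod_left_iff of_nat_0_less_iff less_irrefl)
  have "comm_group (unit_group n)"
  proof (rule comm_groupI)
    fix a assume a: "a \<in> carrier (unit_group n)"
    then obtain b where b: "[a * b = 1] (mod int n)" using coprime_iff_invertible_int by (auto simp: unit_group_simps)
    then have "coprime b (int n)" using coprime_iff_invertible_int by (metis mult.commute)
    moreover have "b mod int n * a mod int n = 1 mod int n" using b
      by (simp add: cong_def mod_mult_left_eq mod_mult_right_eq mult.commute)
    ultimately show "\<exists>y\<in>carrier (unit_group n). y \<otimes>\<^bsub>unit_group n\<^esub> a = \<one>\<^bsub>unit_group n\<^esub>"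
      using n cop by (intro bexI[of _ "b mod int n"]) (auto simp: unit_group_simps)
  qed (use n cop in \<open>auto simp: unit_group_simps mod_mult_left_eq mod_mult_right_eq mult.commute mult.left_commute mult.assoc\<close>)
  moreover have "finite (carrier (unit_group n))"
    by (rule finite_subset[of _ "{0..<int n}"]) (auto simp: unit_group_simps)
  ultimately show ?thesis by (simp add: finite_comm_group_def finite_comm_group_axioms_def)
qed

lemma unit_group_pow: "a [^]\<^bsub>unit_group n\<^esub> (k::nat) = a ^ k mod int n"
  by (induction k) (simp_all add: nat_pow_def unit_group_simps mod_mult_left_eq mult.commute mod_mult_right_eq)

text \<open>\<open>H\<close> is the group of multipliers of a transitive group of affine permutations, \<open>d\<close> generates the group of
  its translations, and \<open>\<phi> a\<close> is the translation part, well defined modulo \<open>d\<close>, of an element with multiplier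
  \<open>a\<close>. The last condition makes \<open>\<phi>\<close> surjective.\<close>
definition affine_datum :: "nat \<Rightarrow> nat \<Rightarrow> int set \<Rightarrow> (int \<Rightarrow> int) \<Rightarrow> bool" where
  "affine_datum n d H \<phi> \<longleftrightarrow> d > 0 \<and> d dvd n \<and> subgroup H (unit_group n) \<and> (\<forall>a\<in>H. [a = 1] (mod int d)) \<and>
     (\<forall>a\<in>H. \<forall>b\<in>H. [\<phi> ((a * b) mod int n) = \<phi> a + \<phi> b] (mod int d)) \<and> (\<exists>a\<in>H. [\<phi> a = 1] (mod int d))"

definition affine_group :: "nat \<Rightarrow> nat \<Rightarrow> int set \<Rightarrow> (int \<Rightarrow> int) \<Rightarrow> (nat \<Rightarrow> nat) set" where
  "affine_group n d H \<phi> = {g. \<exists>a\<in>H. \<exists>t. affine_map n a t g \<and> [t = \<phi> a] (mod int d)}"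

lemma affine_group_subset: "affine_group n d H \<phi> \<subseteq> affine_perms n"
  by (auto simp: affine_group_def affine_perms_def)

lemma affine_datum_pow:
  assumes D: "affine_datum n d H \<phi>" and n: "n > 0" and a: "a \<in> H"
  shows "a ^ k mod int n \<in> H \<and> [\<phi> (a ^ k mod int n) = int k * \<phi> a] (mod int d)"
proof (induction k)
  have H: "subgroup H (unit_group n)" and
    hom: "\<And>a b. a \<in> H \<Longrightarrow> b \<in> H \<Longrightarrow> [\<phi> ((a * b) mod int n) = \<phi> a + \<phi> b] (mod int d)"
    using D by (auto simp: affine_datum_def)
  case 0
  have one: "1 mod int n \<in> H" using subgroup.one_closed[OF H] by (simp add: unit_group_simps)
  have "[\<phi> ((1 mod int n * (1 mod int n)) mod int n) = \<phi> (1 mod int n) + \<phi> (1 mod int n)] (mod int d)"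
    by (rule hom[OF one one])
  then have "[\<phi> (1 mod int n) + 0 = \<phi> (1 mod int n) + \<phi> (1 mod int n)] (mod int d)" by (simp add: mod_mult_eq)
  then have "[0 = \<phi> (1 mod int n)] (mod int d)" by (simp only: cong_add_lcancel)
  then show ?case using one by (simp add: cong_sym)
next
  have H: "subgroup H (unit_group n)" and
    hom: "\<And>a b. a \<in> H \<Longrightarrow> b \<in> H \<Longrightarrow> [\<phi> ((a * b) mod int n) = \<phi> a + \<phi> b] (mod int d)"
    using D by (auto simp: affine_datum_def)
  case (Suc k)
  have e: "(a * (a ^ k mod int n)) mod int n = a ^ Suc k mod int n" by (simp add: mod_mult_right_eq)
  have "a ^ Suc k mod int n \<in> H" using subgroup.m_closed[OF H a, of "a ^ k mod int n"] Suc e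
    by (simp add: unit_group_simps)
  moreover have "[\<phi> (a ^ Suc k mod int n) = \<phi> a + int k * \<phi> a] (mod int d)"
    using hom[OF a, of "a ^ k mod int n"] Suc unfolding e by (meson cong_add_lcancel cong_trans)
  ultimately show ?case by (simp add: algebra_simps)
qed

text \<open>The permutations with multiplier \<open>a\<close> that take \<open>i\<close> to \<open>j\<close> have a translation part congruent to \<open>j - i\<close>
  modulo \<open>d\<close>, as \<open>a\<close> is \<open>1\<close> there. So they belong to the group if \<open>\<phi> a\<close> is congruent to \<open>j - i\<close>, which holds for
  some \<open>a\<close> by surjectivity.\<close>
lemma affine_group_transitive:
  assumes D: "affine_datum n d H \<phi>" and n: "n > 0"
  shows "transitive_perm_group n (affine_group n d H \<phi>)"
  unfolding transitive_perm_group_def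
proof (intro conjI ballI)
  have H: "subgroup H (unit_group n)" and d: "d dvd n" and one: "\<And>a. a \<in> H \<Longrightarrow> [a = 1] (mod int d)" and
    hom: "\<And>a b. a \<in> H \<Longrightarrow> b \<in> H \<Longrightarrow> [\<phi> ((a * b) mod int n) = \<phi> a + \<phi> b] (mod int d)"
    using D by (auto simp: affine_datum_def)
  have Hc: "coprime a (int n)" if "a \<in> H" for a using subgroup.subset[OF H] that by (auto simp: unit_group_simps)
  have oneH: "1 mod int n \<in> H" using subgroup.one_closed[OF H] by (simp add: unit_group_simps)
  have phi1: "[\<phi> (1 mod int n) = 0] (mod int d)" using affine_datum_pow[OF D n oneH, of 0] by simp
  let ?G = "affine_group n d H \<phi>"
  have comp: "g \<circ> h \<in> ?G" if g: "g \<in> ?G" and h: "h \<in> ?G" for g h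
  proof -
    obtain a t where a: "a \<in> H" "affine_map n a t g" "[t = \<phi> a] (mod int d)" using g
      by (auto simp: affine_group_def)
    obtain b s where b: "b \<in> H" "affine_map n b s h" "[s = \<phi> b] (mod int d)" using h
      by (auto simp: affine_group_def)
    have "affine_map n ((a * b) mod int n) (a * s + t) (g \<circ> h)"
      by (rule affine_map_cong[OF affine_map_comp[OF a(2) b(2)]]) (simp_all add: cong_def)
    moreover have "(a * b) mod int n \<in> H" using subgroup.m_closed[OF H a(1) b(1)] by (simp add: unit_group_simps)
    moreover have "[a * s + t = 1 * \<phi> b + \<phi> a] (mod int d)"
      using one[OF a(1)] a(3) b(3) by (intro cong_add cong_mult)
    then have "[a * s + t = \<phi> ((a * b) mod int n)] (mod int d)"
      using hom[OF a(1) b(1)] by (simp add: add.commute) (meson cong_sym cong_trans)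
    ultimately show ?thesis unfolding affine_group_def by blast
  qed
  show "subgroup ?G (sym_group n)"
  proof (rule subgroup_sym_groupI)
    show "g permutes {1..n}" if "g \<in> ?G" for g using that affine_map_perm by (auto simp: affine_group_def)
    have "affine_map n (1 mod int n) 0 id" by (rule affine_map_cong[OF affine_map_id]) (simp_all add: cong_def)
    then show "?G \<noteq> {}" unfolding affine_group_def using oneH cong_sym[OF phi1] by blast
  qed (rule comp)
  fix i j assume i: "i \<in> {1..n}" and j: "j \<in> {1..n}"
  obtain a1 where a1: "a1 \<in> H" "[\<phi> a1 = 1] (mod int d)" using D by (auto simp: affine_datum_def)
  define k where "k = nat ((int j - int i) mod int d)"
  have d0: "d > 0" using D by (simp add: affine_datum_def)
  have k: "[int k = int j - int i] (mod int d)" using d0 by (simp add: k_def cong_def)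
  define a where "a = a1 ^ k mod int n"
  have a: "a \<in> H" "[\<phi> a = int k * \<phi> a1] (mod int d)" using affine_datum_pow[OF D n a1(1), of k]
    by (simp_all add: a_def)
  have "[\<phi> a = int k * 1] (mod int d)" using a(2) a1(2) by (meson cong_mult cong_refl cong_trans)
  then have pk: "[\<phi> a = int j - int i] (mod int d)" using k by simp (meson cong_trans)
  define t where "t = int j - a * int i"
  obtain g where g: "affine_map n a t g" using affine_map_exists[OF n Hc[OF a(1)]] by blast
  have "[t = int j - 1 * int i] (mod int d)" unfolding t_def using one[OF a(1)] by (intro cong_diff cong_mult) auto
  then have "[t = \<phi> a] (mod int d)" using pk by simp (meson cong_sym cong_trans)
  then have gG: "g \<in> ?G" unfolding affine_group_def using a(1) g by blast
  have "[int (g i) = int j] (mod int n)" using affine_map_cong_apply[OF g i] by (simp add: t_def)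
  then have "g i = j" using cong_imp_eq[OF affine_map_range[OF g i] j] by blast
  then show "\<exists>g\<in>?G. g i = j" using gG by blast
qed

text \<open>Suppose that \<open>a0\<close> is not \<open>1\<close> modulo \<open>q\<close>. Then \<open>g0\<close> has exactly one fixed point modulo \<open>q\<close>. Commutators are
  translations, by assumption trivial modulo \<open>q\<close>; so all elements of \<open>G\<close> commute modulo \<open>q\<close>, hence all of them
  fix this point, and \<open>G\<close> is not transitive.\<close>
lemma multiplier_one_mod_prime:
  assumes n: "n > 0" and G: "transitive_perm_group n G" and q: "Factorial_Ring.prime q" "q dvd n"
    and T: "\<And>h t. h \<in> G \<Longrightarrow> affine_map n 1 t h \<Longrightarrow> int q dvd t" and aff: "G \<subseteq> affine_perms n"
    and g0: "g0 \<in> G" "affine_map n a0 t0 g0"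
  shows "[a0 = 1] (mod int q)"
proof (rule ccontr)
  note GD = transitive_groupD[OF G]
  have modq: "[x = y] (mod int q)" if "[x = y] (mod int n)" for x y
    using that q(2) by (meson cong_dvd_modulus of_nat_dvd_iff)
  assume "\<not> [a0 = 1] (mod int q)"
  then have "\<not> int q dvd a0 - 1" by (simp add: cong_iff_dvd_diff)
  moreover have pq: "Factorial_Ring.prime (int q)" using q(1) by simp
  ultimately have "coprime (a0 - 1) (int q)" using prime_imp_coprime by (metis coprime_commute)
  then obtain b where b: "[(a0 - 1) * b = 1] (mod int q)" using coprime_iff_invertible_int by blast
  \<comment> \<open>the translation part of the commutator of \<open>g\<close> and \<open>g0\<close> vanishes modulo \<open>q\<close>\<close>
  have comm: "[(a - 1) * t0 = (a0 - 1) * t] (mod int q)" if g: "g \<in> G" "affine_map n a t g" for g a t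
  proof -
    define k where "k = g0 \<circ> g"
    define h where "h = (g \<circ> g0) \<circ> inv' k"
    have k: "affine_map n (a0 * a) (a0 * t + t0) k" "k \<in> G"
      unfolding k_def using affine_map_comp[OF g0(2) g(2)] GD(3) g g0 by auto
    have gg0: "affine_map n (a * a0) (a * t0 + t) (g \<circ> g0)" by (rule affine_map_comp[OF g(2) g0(2)])
    obtain c where c: "[(a0 * a) * c = 1] (mod int n)"
      using affine_map_coprime[OF n k(1)] coprime_iff_invertible_int by blast
    have h1: "affine_map n ((a * a0) * c) ((a * a0) * (- c * (a0 * t + t0)) + (a * t0 + t)) h"
      unfolding h_def by (rule affine_map_comp[OF gg0 affine_map_inv[OF n k(1) c]])
    have c': "[(a * a0) * c = 1] (mod int n)" using c by (simp add: mult.commute)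
    have "(a * a0) * (- c * (a0 * t + t0)) + (a * t0 + t) = - ((a * a0) * c) * (a0 * t + t0) + (a * t0 + t)"
      by (simp add: algebra_simps)
    also have "[\<dots> = - 1 * (a0 * t + t0) + (a * t0 + t)] (mod int n)"
      using c' by (intro cong_add cong_mult cong_refl) (simp only: cong_minus_minus_iff)
    finally have "affine_map n 1 (- 1 * (a0 * t + t0) + (a * t0 + t)) h" using affine_map_cong[OF h1 c'] by blast
    moreover have "h \<in> G" unfolding h_def by (rule GD(3)[OF GD(3)[OF g(1) g0(1)] GD(4)[OF k(2)]])
    ultimately have "int q dvd - 1 * (a0 * t + t0) + (a * t0 + t)" using T by blast
    then show ?thesis by (simp add: cong_iff_dvd_diff algebra_simps)
  qed
  \<comment> \<open>the fixed point of \<open>g0\<close> modulo \<open>q\<close>\<close>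
  define z where "z = - t0 * b"
  have fixed: "[a * z + t = z] (mod int q)" if g: "g \<in> G" "affine_map n a t g" for g a t
  proof -
    have "a * z + t = z + (- b * ((a - 1) * t0) + t)" by (simp add: z_def algebra_simps)
    also have "[\<dots> = z + (- b * ((a0 - 1) * t) + t)] (mod int q)"
      by (rule cong_add[OF cong_refl cong_add[OF cong_mult[OF cong_refl comm[OF g]] cong_refl]])
    also have "z + (- b * ((a0 - 1) * t) + t) = z + (- ((a0 - 1) * b) * t + t)" by (simp add: algebra_simps)
    also have "[\<dots> = z + (- 1 * t + t)] (mod int q)"
      using b by (intro cong_add cong_mult cong_refl) (simp only: cong_minus_minus_iff)
    finally show ?thesis by simp
  qed
  obtain g where g: "g \<in> G" "g (resid n z) = resid n (z + 1)" using GD(5)[OF resid_range[OF n] resid_range[OF n]]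
    by blast
  obtain a t where at: "affine_map n a t g" using aff g(1) by (auto simp: affine_perms_def)
  have "[int (resid n (z + 1)) = a * int (resid n z) + t] (mod int n)"
    using affine_map_cong_apply[OF at resid_range[OF n], of z] g(2) by simp
  also have "[a * int (resid n z) + t = a * z + t] (mod int n)"
    using resid_cong[OF n] by (intro cong_add cong_mult cong_refl)
  finally have "[z + 1 = a * z + t] (mod int n)" using resid_cong[OF n, of "z + 1"] cong_sym cong_trans by blast
  then have "[z + 1 = z] (mod int q)" using modq fixed[OF g(1) at] cong_trans by blast
  then have "int q dvd 1" by (simp add: cong_iff_dvd_diff)
  then show False using pq by simp
qed

text \<open>Two elements with the same multiplier differ by a translation, so the translation part of an element is
  determined by its multiplier modulo \<open>d\<close>. An element taking \<open>n\<close> to \<open>1\<close> has translation part \<open>1\<close>.\<close>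
lemma transitive_affine_group_datum:
  assumes n: "n > 0" and sf: "squarefree n" and G: "transitive_perm_group n G" and aff: "G \<subseteq> affine_perms n"
  obtains d H \<phi> where "affine_datum n d H \<phi>" "G = affine_group n d H \<phi>"
proof -
  note GD = transitive_groupD[OF G]
  define T where "T = {t. \<exists>h\<in>G. affine_map n 1 t h}"
  obtain d where d: "d > 0" "d dvd n" "T = {t. int d dvd t}"
  proof (rule int_subgroup_multiples[OF n])
    have "affine_map n 1 (int n) id" by (rule affine_map_cong[OF affine_map_id]) (simp_all add: cong_def)
    then show "int n \<in> T" using GD(2) by (auto simp: T_def)
    show "s + t \<in> T" if st: "s \<in> T" "t \<in> T" for s t
    proof -
      obtain g h where gh: "g \<in> G" "affine_map n 1 s g" "h \<in> G" "affine_map n 1 t h" using st by (auto simp: T_def)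
      then show ?thesis using affine_map_comp[OF gh(4,2)] GD(3)[OF gh(3,1)] by (auto simp: T_def)
    qed
    show "- s \<in> T" if s: "s \<in> T" for s
    proof -
      obtain g where g: "g \<in> G" "affine_map n 1 s g" using s by (auto simp: T_def)
      then show ?thesis using affine_map_inv[OF n g(2), of 1] GD(4)[OF g(1)] by (auto simp: T_def)
    qed
  qed
  have Td: "int d dvd t" if "h \<in> G" "affine_map n 1 t h" for h t using that d(3) by (auto simp: T_def)
  have sfd: "squarefree d" using sf d(2) squarefree_mono by blast
  have modd: "[x = y] (mod int d)" if "[x = y] (mod int n)" for x y
    using that d(2) by (meson cong_dvd_modulus of_nat_dvd_iff)
  have one: "[a = 1] (mod int d)" if g: "g \<in> G" "affine_map n a t g" for g a t
  proof -
    have "int d dvd a - 1"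
    proof (rule squarefree_dvdI[OF sfd])
      fix q assume q: "Factorial_Ring.prime q" "q dvd d"
      have "[a = 1] (mod int q)"
      proof (rule multiplier_one_mod_prime[OF n G q(1) _ _ aff g])
        show "q dvd n" using q(2) d(2) dvd_trans by blast
        show "int q dvd t" if "h \<in> G" "affine_map n 1 t h" for h t
          using Td[OF that] q(2) by (meson dvd_trans of_nat_dvd_iff)
      qed
      then show "int q dvd a - 1" by (simp add: cong_iff_dvd_diff)
    qed
    then show ?thesis by (simp add: cong_iff_dvd_diff)
  qed
  have same: "[t = s] (mod int d)"
    if g: "g \<in> G" "affine_map n a t g" and h: "h \<in> G" "affine_map n b s h" and ab: "[a = b] (mod int n)" for g h a b t s
  proof -
    obtain c where c: "[b * c = 1] (mod int n)" using affine_map_coprime[OF n h(2)] coprime_iff_invertible_int by blast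
    have k: "affine_map n (a * c) (a * (- c * s) + t) (g \<circ> inv' h)"
      by (rule affine_map_comp[OF g(2) affine_map_inv[OF n h(2) c]])
    have ac: "[a * c = 1] (mod int n)" using ab c by (meson cong_mult cong_refl cong_trans)
    have "a * (- c * s) + t = - (a * c) * s + t" by simp
    also have "[\<dots> = - 1 * s + t] (mod int n)" using ac
      by (intro cong_add cong_mult cong_refl) (simp only: cong_minus_minus_iff)
    finally have "affine_map n 1 (- 1 * s + t) (g \<circ> inv' h)" using affine_map_cong[OF k ac] by blast
    then have "int d dvd - 1 * s + t" using Td GD g h by blast
    then show ?thesis by (simp add: cong_iff_dvd_diff)
  qed
  define H where "H = {a \<in> {0..<int n}. \<exists>g\<in>G. \<exists>t. affine_map n a t g}"
  define \<phi> where "\<phi> a = (SOME t. \<exists>g\<in>G. affine_map n a t g)" for a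
  have red: "affine_map n (a mod int n) t g \<longleftrightarrow> affine_map n a t g" for a t g
    using affine_map_cong[of n a t g "a mod int n" t] affine_map_cong[of n "a mod int n" t g a t] by (auto simp: cong_def)
  have inH: "a mod int n \<in> H" if "g \<in> G" "affine_map n a t g" for a g t
    using that n red by (auto simp: H_def)
  have phi: "[t = \<phi> a] (mod int d)" if g: "g \<in> G" "affine_map n a t g" for g a t
  proof -
    have "\<exists>t. \<exists>g\<in>G. affine_map n a t g" using g by blast
    then have "\<exists>g\<in>G. affine_map n a (\<phi> a) g" unfolding \<phi>_def by (rule someI_ex)
    then show ?thesis using same[OF g _ _ cong_refl] by blast
  qed
  have datum: "affine_datum n d H \<phi>"
    unfolding affine_datum_def
  proof (intro conjI ballI d(1,2))
    interpret U: finite_comm_group "unit_group n" by (rule finite_comm_group_unit_group[OF n])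
    show "subgroup H (unit_group n)"
    proof (rule U.finite_subgroupI[OF U.finite_carrier])
      show "H \<subseteq> carrier (unit_group n)" using affine_map_coprime[OF n] by (auto simp: H_def unit_group_simps)
      show "H \<noteq> {}" using inH[OF GD(2) affine_map_id] by blast
      fix a b assume "a \<in> H" "b \<in> H"
      then obtain g t h s where g: "g \<in> G" "affine_map n a t g" and h: "h \<in> G" "affine_map n b s h"
        by (auto simp: H_def)
      show "a \<otimes>\<^bsub>unit_group n\<^esub> b \<in> H"
        using inH[OF GD(3)[OF g(1) h(1)] affine_map_comp[OF g(2) h(2)]] by (simp add: unit_group_simps)
    qed
    show "[a = 1] (mod int d)" if "a \<in> H" for a using that one by (auto simp: H_def)
    show "[\<phi> ((a * b) mod int n) = \<phi> a + \<phi> b] (mod int d)" if a: "a \<in> H" and b: "b \<in> H" for a b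
    proof -
      obtain g t where g: "g \<in> G" "affine_map n a t g" using a by (auto simp: H_def)
      obtain h s where h: "h \<in> G" "affine_map n b s h" using b by (auto simp: H_def)
      have "affine_map n ((a * b) mod int n) (a * s + t) (g \<circ> h)" using affine_map_comp[OF g(2) h(2)] red by blast
      then have "[a * s + t = \<phi> ((a * b) mod int n)] (mod int d)" using phi GD(3)[OF g(1) h(1)] by blast
      moreover have "[a * s + t = 1 * \<phi> b + \<phi> a] (mod int d)"
        using one[OF g] phi[OF g] phi[OF h] by (intro cong_add cong_mult)
      ultimately show ?thesis by (simp add: add.commute) (meson cong_sym cong_trans)
    qed
    have nn: "n \<in> {1..n}" using n by auto
    obtain g where g: "g \<in> G" "g n = resid n 1" using GD(5)[OF nn resid_range[OF n]] by blast
    obtain a t where at: "affine_map n a t g" using aff g(1) by (auto simp: affine_perms_def)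
    have "[1 = int (g n)] (mod int n)" using g(2) resid_cong[OF n, of 1] by (simp add: cong_sym)
    also have "[int (g n) = a * int n + t] (mod int n)" by (rule affine_map_cong_apply[OF at nn])
    also have "[a * int n + t = t] (mod int n)" by (simp add: cong_def)
    finally have "[t = 1] (mod int d)" using modd cong_sym by blast
    moreover have "[t = \<phi> (a mod int n)] (mod int d)" using phi[OF g(1)] at red by blast
    ultimately have "[\<phi> (a mod int n) = 1] (mod int d)" using cong_sym cong_trans by blast
    then show "\<exists>a\<in>H. [\<phi> a = 1] (mod int d)" using inH[OF g(1) at] by blast
  qed
  have "G = affine_group n d H \<phi>"
  proof
    show "G \<subseteq> affine_group n d H \<phi>"
    proof
      fix g assume g: "g \<in> G"
      then obtain a t where at: "affine_map n a t g" using aff by (auto simp: affine_perms_def)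
      have "affine_map n (a mod int n) t g" using at red by blast
      then show "g \<in> affine_group n d H \<phi>" unfolding affine_group_def using inH[OF g at] phi[OF g] by blast
    qed
    show "affine_group n d H \<phi> \<subseteq> G"
    proof
      fix g assume "g \<in> affine_group n d H \<phi>"
      then obtain a t where a: "a \<in> H" "affine_map n a t g" "[t = \<phi> a] (mod int d)" by (auto simp: affine_group_def)
      then obtain h s where h: "h \<in> G" "affine_map n a s h" by (auto simp: H_def)
      have "[t = s] (mod int d)" using a(3) phi[OF h] cong_sym cong_trans by blast
      then have "t - s \<in> T" using d(3) by (simp add: cong_iff_dvd_diff)
      then obtain k where k: "k \<in> G" "affine_map n 1 (t - s) k" by (auto simp: T_def)
      have "affine_map n a t (k \<circ> h)" using affine_map_comp[OF k(2) h(2)] by simp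
      then have "g = k \<circ> h" using affine_map_ext a(2) by blast
      then show "g \<in> G" using GD(3) k(1) h(1) by blast
    qed
  qed
  then show ?thesis using that datum by blast
qed

text \<open>The lift is taken to be \<open>1\<close> modulo \<open>n div d\<close>.\<close>
lemma coprime_lift:
  assumes "squarefree n" "d dvd n" "n > 0" "coprime u (int d)"
  obtains w where "coprime w (int n)" "[w = u] (mod int d)"
proof -
  obtain m where m: "n = d * m" using assms(2) by auto
  have "coprime d m" by (rule squarefree_cofactor[OF assms(1) m])
  then have "coprime (int d) (int m)" by simp
  then obtain w where w: "[w = u] (mod int d)" "[w = 1] (mod int m)"
    using binary_chinese_remainder_int[of "int d" "int m" u 1] by blast
  have "coprime w (int d)" by (rule cong_imp_coprime[OF cong_sym[OF w(1)] assms(4)])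
  moreover have "coprime w (int m)" using cong_imp_coprime[OF cong_sym[OF w(2)]] by simp
  ultimately have "coprime w (int d * int m)" by (simp only: coprime_mult_right_iff)
  then have "coprime w (int n)" by (simp only: m of_nat_mult)
  then show ?thesis using that w(1) by blast
qed

text \<open>The kernel of \<open>\<phi>\<close> has order \<open>f\<close>, which is prime to \<open>d\<close>, so \<open>\<psi>\<close> vanishes on it. As both maps are
  surjective, \<open>\<psi>\<close> is a unit multiple \<open>u * \<phi>\<close> modulo \<open>d\<close>, and multiplication by a unit modulo \<open>n\<close> lifting \<open>u\<close>
  conjugates one group into the other.\<close>
lemma same_datum_conjugate:
  assumes n: "n > 0" "squarefree n" and D: "affine_datum n d H \<phi>" and D': "affine_datum n d H \<psi>"
    and f: "card H = d * f" "coprime d f"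
  obtains c where "c permutes {1..n}" "affine_group n d H \<psi> = conj_by c ` affine_group n d H \<phi>"
proof -
  interpret U: finite_comm_group "unit_group n" by (rule finite_comm_group_unit_group[OF n(1)])
  have H: "subgroup H (unit_group n)" and d: "d > 0" "d dvd n" using D by (auto simp: affine_datum_def)
  have hom: "\<And>a b. a \<in> H \<Longrightarrow> b \<in> H \<Longrightarrow> [\<phi> ((a * b) mod int n) = \<phi> a + \<phi> b] (mod int d)"
    "\<And>a b. a \<in> H \<Longrightarrow> b \<in> H \<Longrightarrow> [\<psi> ((a * b) mod int n) = \<psi> a + \<psi> b] (mod int d)"
    using D D' by (auto simp: affine_datum_def)
  obtain a1 where a1: "a1 \<in> H" "[\<phi> a1 = 1] (mod int d)" using D by (auto simp: affine_datum_def)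
  note pow = affine_datum_pow[OF D n(1)] and pow' = affine_datum_pow[OF D' n(1)]
  have oneH: "1 mod int n \<in> H" using subgroup.one_closed[OF H] by (simp add: unit_group_simps)
  have phi1: "[\<phi> (1 mod int n) = 0] (mod int d)" "[\<psi> (1 mod int n) = 0] (mod int d)"
    using pow[OF oneH, of 0] pow'[OF oneH, of 0] by simp_all
  have ker: "[\<psi> b = 0] (mod int d)" if b: "b \<in> H" "[\<phi> b = 0] (mod int d)" for b
  proof -
    define K where "K = {a \<in> H. [\<phi> a = 0] (mod int d)}"
    have K: "subgroup K (unit_group n)"
    proof (rule U.finite_subgroupI[OF U.finite_carrier])
      show "K \<subseteq> carrier (unit_group n)" using subgroup.subset[OF H] by (auto simp: K_def)
      show "K \<noteq> {}" using b by (auto simp: K_def)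
      fix a c assume a: "a \<in> K" and c: "c \<in> K"
      have "[\<phi> ((a * c) mod int n) = 0 + 0] (mod int d)"
        using a c by (intro cong_trans[OF hom(1)] cong_add) (simp_all add: K_def)
      then show "a \<otimes>\<^bsub>unit_group n\<^esub> c \<in> K"
        using subgroup.m_closed[OF H, of a c] a c by (simp add: K_def unit_group_simps)
    qed
    \<comment> \<open>the fibres of \<open>\<phi>\<close> are the cosets of \<open>K\<close>\<close>
    have "card H = card K * d"
    proof -
      let ?Q = "\<lambda>r. {a \<in> H. \<phi> a mod int d = r}"
      have fin: "finite H" by (rule U.finite_subgroup[OF H])
      have "H = (\<Union>r\<in>{0..<int d}. ?Q r)" using d(1) by auto
      then have "card H = card (\<Union>r\<in>{0..<int d}. ?Q r)" by simp
      also have "\<dots> = (\<Sum>r\<in>{0..<int d}. card (?Q r))" by (rule card_UN_disjoint) (use fin in auto)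
      also have "\<dots> = (\<Sum>r\<in>{0..<int d}. card K)"
      proof (rule sum.cong[OF refl])
        fix r assume r: "r \<in> {0..<int d}"
        define c where "c = a1 ^ nat r mod int n"
        have "[\<phi> c = r * \<phi> a1] (mod int d)" using pow[OF a1(1), of "nat r"] r by (simp add: c_def)
        moreover have "[r * \<phi> a1 = r * 1] (mod int d)" using a1(2) by (intro cong_mult) auto
        ultimately have c: "c \<in> H" "[\<phi> c = r] (mod int d)"
          using pow[OF a1(1), of "nat r"] by (simp_all add: c_def) (meson cong_trans)
        have cc: "c \<in> carrier (unit_group n)" using subgroup.mem_carrier[OF H c(1)] .
        have "bij_betw (\<lambda>a. c \<otimes>\<^bsub>unit_group n\<^esub> a) K (?Q r)"
          unfolding bij_betw_def
        proof
          show "inj_on (\<lambda>a. c \<otimes>\<^bsub>unit_group n\<^esub> a) K"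
            using U.inj_on_cmult[OF cc] subgroup.subset[OF K] inj_on_subset by blast
          have im: "c \<otimes>\<^bsub>unit_group n\<^esub> a \<in> ?Q (r mod int d)" if "a \<in> K" for a
          proof -
            have "[\<phi> ((c * a) mod int n) = r + 0] (mod int d)"
              using that c by (intro cong_trans[OF hom(1)] cong_add) (simp_all add: K_def)
            then show ?thesis using subgroup.m_closed[OF H c(1), of a] that by (simp add: K_def unit_group_simps cong_def)
          qed
          show "(\<lambda>a. c \<otimes>\<^bsub>unit_group n\<^esub> a) ` K = ?Q r"
          proof
            show "(\<lambda>a. c \<otimes>\<^bsub>unit_group n\<^esub> a) ` K \<subseteq> ?Q r" using im r by auto
            show "?Q r \<subseteq> (\<lambda>a. c \<otimes>\<^bsub>unit_group n\<^esub> a) ` K"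
            proof
              fix y assume y: "y \<in> ?Q r"
              then have yH: "y \<in> H" "[\<phi> y = r] (mod int d)" using r by (auto simp: cong_def)
              let ?x = "inv\<^bsub>unit_group n\<^esub> c \<otimes>\<^bsub>unit_group n\<^esub> y"
              have xH: "?x \<in> H" using subgroup.m_closed[OF H subgroup.m_inv_closed[OF H c(1)] yH(1)] .
              have cx: "c \<otimes>\<^bsub>unit_group n\<^esub> ?x = y"
                using cc subgroup.mem_carrier[OF H yH(1)] by (simp add: U.m_assoc[symmetric])
              have "[\<phi> ((c * ?x) mod int n) = \<phi> c + \<phi> ?x] (mod int d)" by (rule hom(1)[OF c(1) xH])
              moreover have "(c * ?x) mod int n = y" using cx by (simp add: unit_group_simps)
              ultimately have "[r = \<phi> c + \<phi> ?x] (mod int d)" using yH(2) by (metis cong_sym cong_trans)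
              moreover have "[\<phi> c + \<phi> ?x = r + \<phi> ?x] (mod int d)" using c(2) by (intro cong_add) auto
              ultimately have "[r + 0 = r + \<phi> ?x] (mod int d)" by simp (meson cong_trans)
              then have "[0 = \<phi> ?x] (mod int d)" by (simp only: cong_add_lcancel)
              then have "?x \<in> K" using xH by (simp add: K_def cong_sym)
              then show "y \<in> (\<lambda>a. c \<otimes>\<^bsub>unit_group n\<^esub> a) ` K" using cx by (metis imageI)
            qed
          qed
        qed
        then show "card (?Q r) = card K" by (simp add: bij_betw_same_card)
      qed
      also have "\<dots> = card K * d" by simp
      finally show ?thesis .
    qed
    then have cK: "card K = f" using f(1) d(1) by simp
    have "b [^]\<^bsub>unit_group n\<^esub> f = \<one>\<^bsub>unit_group n\<^esub>"
      using U.subgroup_subset_torsion_card[OF K] b cK by (auto simp: U.torsion_def K_def)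
    then have "b ^ f mod int n = 1 mod int n" by (simp add: unit_group_pow unit_group_simps)
    then have "[int f * \<psi> b = 0] (mod int d)" using pow'[OF b(1), of f] phi1(2) by (metis cong_sym cong_trans)
    then have "int d dvd int f * \<psi> b" by (simp add: cong_0_iff)
    then have "int d dvd \<psi> b" using f(2) coprime_dvd_mult_right_iff[of "int d" "int f"] by simp
    then show ?thesis by (simp add: cong_0_iff)
  qed
  define u where "u = \<psi> a1"
  have psi: "[\<psi> a = u * \<phi> a] (mod int d)" if a: "a \<in> H" for a
  proof -
    define k where "k = nat ((- \<phi> a) mod int d)"
    have k: "[int k = - \<phi> a] (mod int d)" using d(1) by (simp add: k_def cong_def)
    define b where "b = (a * (a1 ^ k mod int n)) mod int n"
    have p: "a1 ^ k mod int n \<in> H" "[\<phi> (a1 ^ k mod int n) = int k * \<phi> a1] (mod int d)"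
      "[\<psi> (a1 ^ k mod int n) = int k * u] (mod int d)"
      using pow[OF a1(1), of k] pow'[OF a1(1), of k] by (simp_all add: u_def)
    have bH: "b \<in> H" using subgroup.m_closed[OF H a p(1)] by (simp add: b_def unit_group_simps)
    have "[\<phi> b = \<phi> a + int k * \<phi> a1] (mod int d)"
      unfolding b_def by (rule cong_trans[OF hom(1)[OF a p(1)] cong_add[OF cong_refl p(2)]])
    moreover have "[\<phi> a + int k * \<phi> a1 = \<phi> a + (- \<phi> a) * 1] (mod int d)" using k a1(2)
      by (intro cong_add cong_mult cong_refl)
    ultimately have "[\<phi> b = 0] (mod int d)" by simp (meson cong_trans)
    then have "[\<psi> b = 0] (mod int d)" by (rule ker[OF bH])
    moreover have "[\<psi> b = \<psi> a + int k * u] (mod int d)"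
      unfolding b_def by (rule cong_trans[OF hom(2)[OF a p(1)] cong_add[OF cong_refl p(3)]])
    moreover have "[\<psi> a + int k * u = \<psi> a + (- \<phi> a) * u] (mod int d)" using k
      by (intro cong_add cong_mult cong_refl)
    ultimately have "[\<psi> a + (- \<phi> a) * u = 0] (mod int d)" by (meson cong_sym cong_trans)
    then show ?thesis by (simp add: cong_iff_dvd_diff mult.commute)
  qed
  obtain a2 where a2: "a2 \<in> H" "[\<psi> a2 = 1] (mod int d)" using D' by (auto simp: affine_datum_def)
  have "[u * \<phi> a2 = 1] (mod int d)" using psi[OF a2(1)] a2(2) cong_sym cong_trans by blast
  then have "coprime u (int d)" using coprime_iff_invertible_int by blast
  then obtain w where w: "coprime w (int n)" "[w = u] (mod int d)" using coprime_lift[OF n(2) d(2) n(1)] by blast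
  obtain c where c: "affine_map n w 0 c" using affine_map_exists[OF n(1) w(1)] by blast
  obtain w' where w': "[w * w' = 1] (mod int n)" using w(1) coprime_iff_invertible_int by blast
  have c': "affine_map n w' 0 (inv' c)" using affine_map_inv[OF n(1) c w'] by simp
  have cperm: "c permutes {1..n}" by (rule affine_map_perm[OF c])
  have conj: "affine_map n a (w * t) (conj_by c g)" if "affine_map n a t g" for a t g
  proof -
    have "affine_map n (w * a * w') (w * a * 0 + (w * t + 0)) (c \<circ> g \<circ> inv' c)"
      by (rule affine_map_comp[OF affine_map_comp[OF c that] c'])
    moreover have "[w * a * w' = a] (mod int n)"
    proof -
      have "w * a * w' = (w * w') * a" by simp
      also have "[\<dots> = 1 * a] (mod int n)" using w' by (intro cong_mult cong_refl)
      finally show ?thesis by simp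
    qed
    ultimately show ?thesis unfolding conj_by_def using affine_map_cong
      by (metis add.right_neutral cong_refl mult_zero_right add_0)
  qed
  have "affine_group n d H \<psi> = conj_by c ` affine_group n d H \<phi>"
  proof
    show "conj_by c ` affine_group n d H \<phi> \<subseteq> affine_group n d H \<psi>"
    proof
      fix h assume "h \<in> conj_by c ` affine_group n d H \<phi>"
      then obtain g a t where g: "h = conj_by c g" "a \<in> H" "affine_map n a t g" "[t = \<phi> a] (mod int d)"
        unfolding affine_group_def by blast
      have "[w * t = u * \<phi> a] (mod int d)" using w(2) g(4) by (rule cong_mult)
      then have "[w * t = \<psi> a] (mod int d)" using psi[OF g(2)] cong_sym cong_trans by blast
      then show "h \<in> affine_group n d H \<psi>" unfolding affine_group_def g(1) using g(2) conj[OF g(3)] by blast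
    qed
    show "affine_group n d H \<psi> \<subseteq> conj_by c ` affine_group n d H \<phi>"
    proof
      fix h assume "h \<in> affine_group n d H \<psi>"
      then obtain a s where h: "a \<in> H" "affine_map n a s h" "[s = \<psi> a] (mod int d)" by (auto simp: affine_group_def)
      have ca: "coprime a (int n)" using affine_map_coprime[OF n(1) h(2)] .
      obtain g where g: "affine_map n a (w' * s) g" using affine_map_exists[OF n(1) ca] by blast
      have ww: "[w * w' = 1] (mod int d)" using w' d(2) by (meson cong_dvd_modulus of_nat_dvd_iff)
      have "[w' * s = w' * (w * \<phi> a)] (mod int d)"
      proof (rule cong_mult[OF cong_refl])
        have "[w * \<phi> a = u * \<phi> a] (mod int d)" using w(2) by (intro cong_mult cong_refl)
        then show "[s = w * \<phi> a] (mod int d)" using h(3) psi[OF h(1)] by (meson cong_sym cong_trans)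
      qed
      also have "w' * (w * \<phi> a) = (w * w') * \<phi> a" by simp
      also have "[\<dots> = 1 * \<phi> a] (mod int d)" using ww by (intro cong_mult cong_refl)
      finally have "g \<in> affine_group n d H \<phi>" unfolding affine_group_def using h(1) g by auto
      moreover have "h = conj_by c g"
      proof (rule affine_map_ext[OF h(2)])
        have "w * (w' * s) = (w * w') * s" by simp
        also have "[\<dots> = 1 * s] (mod int n)" using w' by (intro cong_mult cong_refl)
        finally show "affine_map n a s (conj_by c g)" using affine_map_cong[OF conj[OF g]] by simp
      qed
      ultimately show "h \<in> conj_by c ` affine_group n d H \<phi>" by blast
    qed
  qed
  then show ?thesis using that cperm by blast
qed

text \<open>An element \<open>c\<close> of order \<open>d\<close> generates the \<open>d\<close>-torsion of \<open>H\<close>, into which \<open>a \<mapsto> a ^ f\<close> maps \<open>H\<close>; \<open>\<phi> a\<close> is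
  the exponent of \<open>a ^ f\<close> with respect to \<open>c\<close>. As \<open>f\<close> is prime to \<open>d\<close>, powers of \<open>c\<close> take all values.\<close>
lemma affine_datum_exists:
  assumes n: "n > 0" "squarefree n" and d: "d dvd n" and H: "subgroup H (unit_group n)"
    and one: "\<And>a. a \<in> H \<Longrightarrow> [a = 1] (mod int d)" and f: "card H = d * f" "coprime d f"
  shows "\<exists>\<phi>. affine_datum n d H \<phi>"
proof -
  let ?U = "unit_group n"
  interpret U: finite_comm_group ?U by (rule finite_comm_group_unit_group[OF n(1)])
  have d0: "d > 0" using d n(1) by (auto intro: Nat.gr0I)
  have sfd: "squarefree d" using n(2) d squarefree_mono by blast
  obtain c where c: "c \<in> H" "U.ord c = d" using U.exists_squarefree_order[OF H sfd] f(1) by auto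
  have cc: "c \<in> carrier ?U" using subgroup.mem_carrier[OF H c(1)] .
  have "comm_group (?U\<lparr>carrier := H\<rparr>)" 
    by (rule group.group_comm_groupI[OF U.subgroup_imp_group[OF H]])
      (simp add: U.m_comm subgroup.mem_carrier[OF H])
  then have K: "finite_comm_group (?U\<lparr>carrier := H\<rparr>)"
    using U.finite_subgroup[OF H] by (simp add: finite_comm_group_def finite_comm_group_axioms_def)
  have "card (monoid.torsion (?U\<lparr>carrier := H\<rparr>) d) = d"
    by (rule finite_comm_group.card_torsion[OF K _ f(2)]) (simp add: order_def f(1))
  moreover have "monoid.torsion (?U\<lparr>carrier := H\<rparr>) d = H \<inter> U.torsion d"
    using comm_group.axioms(1)[OF \<open>comm_group (?U\<lparr>carrier := H\<rparr>)\<close>] subgroup.subset[OF H]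
    by (auto simp: U.torsion_def monoid.torsion_def[OF comm_monoid.axioms(1)] U.nat_pow_consistent[symmetric])
  ultimately have cardt: "card (H \<inter> U.torsion d) = d" by simp
  have gen: "generate ?U {c} = H \<inter> U.torsion d"
  proof (rule card_subset_eq)
    show "finite (H \<inter> U.torsion d)" using U.finite_subgroup[OF H] by simp
    show "generate ?U {c} \<subseteq> H \<inter> U.torsion d"
      by (rule U.generate_subgroup_incl[OF _ U.subgroups_Inter_pair]) (use c cc H U.torsion_subgroup in \<open>auto simp: U.mem_torsion_iff\<close>)
    show "card (generate ?U {c}) = card (H \<inter> U.torsion d)" using U.generate_pow_card[OF cc] c(2) cardt by simp
  qed
  have ex: "\<exists>k::int. a [^]\<^bsub>?U\<^esub> f = c [^]\<^bsub>?U\<^esub> k" if a: "a \<in> H" for a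
  proof -
    have ac: "a \<in> carrier ?U" using subgroup.mem_carrier[OF H a] .
    have "U.ord a dvd f * d" using U.ord_dvd_card[OF H a] f(1) by (simp add: mult.commute)
    then have "(a [^]\<^bsub>?U\<^esub> f) [^]\<^bsub>?U\<^esub> d = \<one>\<^bsub>?U\<^esub>"
      using U.pow_eq_id[OF ac] ac by (simp add: U.nat_pow_pow)
    then have "a [^]\<^bsub>?U\<^esub> f \<in> H \<inter> U.torsion d" using U.subgroup_nat_pow[OF H a] ac
      by (simp add: U.torsion_def)
    then show ?thesis using gen U.generate_pow[OF cc] by auto
  qed
  define \<phi> where "\<phi> a = (SOME k::int. a [^]\<^bsub>?U\<^esub> f = c [^]\<^bsub>?U\<^esub> k)" for a
  have phi: "a [^]\<^bsub>?U\<^esub> f = c [^]\<^bsub>?U\<^esub> \<phi> a" if "a \<in> H" for a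
    unfolding \<phi>_def by (rule someI_ex[OF ex[OF that]])
  have eqd: "[i = j] (mod int d)" if "c [^]\<^bsub>?U\<^esub> (i::int) = c [^]\<^bsub>?U\<^esub> j" for i j
    using that U.int_pow_eq[OF cc, of i j] c(2) by (simp add: cong_iff_dvd_diff dvd_diff_commute)
  have "affine_datum n d H \<phi>"
    unfolding affine_datum_def
  proof (intro conjI ballI d0 d H)
    show "[a = 1] (mod int d)" if "a \<in> H" for a using one[OF that] .
    show "[\<phi> ((a * b) mod int n) = \<phi> a + \<phi> b] (mod int d)" if a: "a \<in> H" and b: "b \<in> H" for a b
    proof (rule eqd)
      have ab: "a \<otimes>\<^bsub>?U\<^esub> b \<in> H" by (rule subgroup.m_closed[OF H a b])
      have cab: "a \<in> carrier ?U" "b \<in> carrier ?U" using subgroup.mem_carrier[OF H] a b by auto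
      have "c [^]\<^bsub>?U\<^esub> \<phi> (a \<otimes>\<^bsub>?U\<^esub> b) = (a \<otimes>\<^bsub>?U\<^esub> b) [^]\<^bsub>?U\<^esub> f"
        using phi[OF ab] by simp
      also have "\<dots> = a [^]\<^bsub>?U\<^esub> f \<otimes>\<^bsub>?U\<^esub> b [^]\<^bsub>?U\<^esub> f" using cab
        by (simp add: U.pow_mult_distrib U.m_comm)
      also have "\<dots> = c [^]\<^bsub>?U\<^esub> (\<phi> a + \<phi> b)" using phi[OF a] phi[OF b] cc
        by (simp add: U.int_pow_mult)
      finally show "c [^]\<^bsub>?U\<^esub> \<phi> ((a * b) mod int n) = c [^]\<^bsub>?U\<^esub> (\<phi> a + \<phi> b)"
        by (simp add: unit_group_simps)
    qed
    have "coprime (int f) (int d)" using f(2) by (simp add: coprime_commute)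
    then obtain j where j: "[int f * j = 1] (mod int d)" using coprime_iff_invertible_int by blast
    let ?a = "c [^]\<^bsub>?U\<^esub> j"
    have aH: "?a \<in> H" by (rule U.subgroup_int_pow[OF H c(1)])
    have "c [^]\<^bsub>?U\<^esub> \<phi> ?a = ?a [^]\<^bsub>?U\<^esub> (int f)" using phi[OF aH] by (simp add: int_pow_int)
    also have "\<dots> = c [^]\<^bsub>?U\<^esub> (j * int f)" using cc by (simp add: U.int_pow_pow)
    finally have "[\<phi> ?a = j * int f] (mod int d)" by (rule eqd)
    then show "\<exists>a\<in>H. [\<phi> a = 1] (mod int d)" using aH j by (metis cong_trans mult.commute)
  qed
  then show ?thesis by blast
qed

section \<open>Recovering the parameters from the abstract group\<close>

text \<open>For a prime \<open>q\<close>, \<open>r\<close> generates a normal subgroup of order \<open>q\<close>. Normality is written as a relation between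
  \<open>g\<close> and \<open>r\<close> because the exponent \<open>k\<close> in it will be compared with the multiplier of \<open>g\<close>.\<close>
definition normal_of_prime_order :: "(nat \<Rightarrow> nat) set \<Rightarrow> nat \<Rightarrow> (nat \<Rightarrow> nat) \<Rightarrow> bool" where
  "normal_of_prime_order G q r \<longleftrightarrow> r \<in> G \<and> r \<noteq> id \<and> r ^^ q = id \<and> (\<forall>g\<in>G. \<exists>k. g \<circ> r = (r ^^ k) \<circ> g)"

lemma affine_map_funpow: "affine_map n a t r \<Longrightarrow> \<exists>s. affine_map n (a ^ k) s (r ^^ k)"
proof (induction k)
  case 0
  then show ?case using affine_map_id[of n] by (intro exI[of _ 0]) (simp add: id_def)
next
  case (Suc k)
  then show ?case using affine_map_comp by (metis funpow.simps(2) power_Suc)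
qed

lemma affine_map_funpow_translation: "affine_map n 1 t r \<Longrightarrow> affine_map n 1 (int k * t) (r ^^ k)"
proof (induction k)
  case 0
  then show ?case using affine_map_id by (simp add: id_def)
next
  case (Suc k)
  have "affine_map n (1 * 1) (1 * (int k * t) + t) (r \<circ> r ^^ k)"
    by (rule affine_map_comp[OF Suc.prems Suc.IH[OF Suc.prems]])
  then show ?case by (simp add: algebra_simps comp_def)
qed

context
  fixes n d H \<phi>
  assumes n: "n > 0" and sf: "squarefree n" and D: "affine_datum n d H \<phi>"
begin

lemma datum_translation:
  assumes "int d dvd t" "affine_map n 1 t g"
  shows "g \<in> affine_group n d H \<phi>"
proof -
  have "1 mod int n \<in> H"
    using D subgroup.one_closed[of H "unit_group n"] by (auto simp: affine_datum_def unit_group_simps)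
  moreover from this have "[\<phi> (1 mod int n) = 0] (mod int d)" using affine_datum_pow[OF D n, of _ 0] by auto
  then have "[t = \<phi> (1 mod int n)] (mod int d)" using assms(1) by (meson cong_0_iff cong_sym cong_trans)
  moreover have "affine_map n (1 mod int n) t g" by (rule affine_map_cong[OF assms(2)]) (simp_all add: cong_def)
  ultimately show ?thesis unfolding affine_group_def by blast
qed

lemma translation_datum:
  assumes g: "g \<in> affine_group n d H \<phi>" "affine_map n 1 t g"
  shows "int d dvd t"
proof -
  obtain a s where a: "a \<in> H" "affine_map n a s g" "[s = \<phi> a] (mod int d)" using g(1)
    by (auto simp: affine_group_def)
  have dn: "d dvd n" using D by (simp add: affine_datum_def)
  have u: "[a = 1] (mod int n)" "[s = t] (mod int n)" using affine_map_unique[OF n a(2) g(2)] by auto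
  have ar: "a \<in> {0..<int n}" 
  proof -
    have "subgroup H (unit_group n)" using D by (simp add: affine_datum_def)
    then show ?thesis using a(1) subgroup.mem_carrier by (force simp: unit_group_simps)
  qed
  then have "a = 1 mod int n" using u(1) by (simp add: cong_def)
  then have "[\<phi> a = 0] (mod int d)" using affine_datum_pow[OF D n a(1), of 0] by simp
  moreover have "[s = t] (mod int d)" using u(2) dn by (meson cong_dvd_modulus of_nat_dvd_iff)
  ultimately have "[t = 0] (mod int d)" using a(3) cong_sym cong_trans by blast
  then show ?thesis by (simp add: cong_0_iff)
qed

text \<open>Let \<open>a\<close> be the multiplier of \<open>r\<close>, and suppose that it is not \<open>1\<close> modulo a prime \<open>p\<close>. Then \<open>p\<close> does not
  divide \<open>d\<close>, so the group contains the translation \<open>\<tau>\<close> by \<open>n / p\<close>, and \<open>\<tau> r = r\<^sup>k \<tau>\<close> for some \<open>k\<close>. If \<open>q\<close>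
  divides \<open>k - 1\<close>, then \<open>\<tau>\<close> and \<open>r\<close> commute, contrary to the choice of \<open>p\<close>. Otherwise comparison of multipliers
  shows that the order of \<open>a\<close> divides the coprime numbers \<open>k - 1\<close> and \<open>q\<close>. So \<open>r\<close> is a translation, by a
  multiple of \<open>n / q\<close> that is not a multiple of \<open>n\<close> and hence not of \<open>q\<close>; but it is a multiple of \<open>d\<close>, so \<open>q\<close>
  does not divide \<open>d\<close>.\<close>
lemma normal_of_prime_order_is_translation:
  assumes q: "Factorial_Ring.prime q" "q dvd n" and r: "normal_of_prime_order (affine_group n d H \<phi>) q r"
  obtains t where "affine_map n 1 t r" "\<not> int n dvd t" "int n dvd int q * t" "\<not> q dvd d"
proof -
  let ?G = "affine_group n d H \<phi>"
  have dn: "d dvd n" and d1: "\<And>a. a \<in> H \<Longrightarrow> [a = 1] (mod int d)" and H: "subgroup H (unit_group n)"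
    using D by (auto simp: affine_datum_def)
  obtain a t where a: "a \<in> H" "affine_map n a t r" using r by (auto simp: normal_of_prime_order_def affine_group_def)
  interpret U: finite_comm_group "unit_group n" by (rule finite_comm_group_unit_group[OF n])
  have ac: "a \<in> carrier (unit_group n)" using subgroup.mem_carrier[OF H a(1)] .
  have rid: "r \<noteq> id" "r ^^ q = id" using r by (auto simp: normal_of_prime_order_def)
  have "int n dvd a - 1"
  proof (rule squarefree_dvdI[OF sf])
    fix p assume p: "Factorial_Ring.prime p" "p dvd n"
    show "int p dvd a - 1"
    proof (rule ccontr)
      assume np: "\<not> int p dvd a - 1"
      have "\<not> p dvd d"
      proof
        assume "p dvd d"
        moreover have "int d dvd a - 1" using d1[OF a(1)] by (simp add: cong_iff_dvd_diff)
        ultimately show False using np by (meson dvd_trans of_nat_dvd_iff)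
      qed
      obtain m where m: "n = p * m" using p(2) by auto
      have "coprime d p" using \<open>\<not> p dvd d\<close> p(1) prime_imp_coprime by (metis coprime_commute)
      then have "d dvd m" using dn m by (simp add: coprime_dvd_mult_right_iff)
      obtain \<tau> where \<tau>: "affine_map n 1 (int m) \<tau>" using affine_map_exists[OF n, of 1] by auto
      have "\<tau> \<in> ?G" by (rule datum_translation[OF _ \<tau>]) (use \<open>d dvd m\<close> in simp)
      then obtain k where k: "\<tau> \<circ> r = (r ^^ k) \<circ> \<tau>" using r unfolding normal_of_prime_order_def
        by blast
      obtain s where s: "affine_map n (a ^ k) s (r ^^ k)" using affine_map_funpow[OF a(2)] by blast
      have e1: "affine_map n (1 * a) (1 * t + int m) (\<tau> \<circ> r)" by (rule affine_map_comp[OF \<tau> a(2)])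
      have e2: "affine_map n (a ^ k * 1) (a ^ k * int m + s) (\<tau> \<circ> r)" unfolding k
        by (rule affine_map_comp[OF s \<tau>])
      have ak: "[a = a ^ k] (mod int n)" using affine_map_unique(1)[OF n e1 e2] by simp
      have tp: "\<tau> permutes {1..n}" by (rule affine_map_perm[OF \<tau>])
      have "k \<noteq> 0"
      proof
        assume "k = 0"
        then have "\<tau> \<circ> r = \<tau>" using k by simp
        then have "inv' \<tau> \<circ> \<tau> \<circ> r = inv' \<tau> \<circ> \<tau>" by (simp add: comp_assoc)
        then show False using permutes_inv_o(2)[OF tp] rid(1) by simp
      qed
      then obtain k' where k': "k = Suc k'" using not0_implies_Suc by blast
      show False
      proof (cases "q dvd k'")
        case True
        then obtain j where j: "k' = q * j" by auto
        have "r ^^ k' = (r ^^ q) ^^ j" by (simp add: j funpow_mult)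
        then have "r ^^ k' = id" using rid(2) by (simp add: id_funpow)
        then have "r ^^ k = r" unfolding k' by simp
        then have e3: "affine_map n (a * 1) (a * int m + t) (\<tau> \<circ> r)" unfolding k
          using affine_map_comp[OF a(2) \<tau>] by simp
        have "[1 * t + int m = a * int m + t] (mod int n)" using affine_map_unique(2)[OF n e1 e3] .
        then have "int n dvd (1 * t + int m) - (a * int m + t)" by (simp only: cong_iff_dvd_diff)
        also have "(1 * t + int m) - (a * int m + t) = int m * (1 - a)" by (simp add: algebra_simps)
        finally have "int m * int p dvd int m * (1 - a)" using m by (simp add: mult.commute)
        moreover have "int m \<noteq> 0" using m n by auto
        ultimately have "int p dvd 1 - a" by simp
        then show False using np by (simp add: dvd_diff_commute)
      next
        case False
        obtain s' where "affine_map n (a ^ q) s' id" using affine_map_funpow[OF a(2), of q] rid(2) by auto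
        then have aq: "[a ^ q = 1] (mod int n)" using affine_map_unique(1)[OF n _ affine_map_id] by blast
        have "[a * 1 = a * a ^ k'] (mod int n)" using ak unfolding k' by simp
        moreover have "coprime a (int n)" using ac by (simp add: unit_group_simps)
        ultimately have ak': "[1 = a ^ k'] (mod int n)" using cong_mult_lcancel[of a "int n" 1 "a ^ k'"] by blast
        have "a [^]\<^bsub>unit_group n\<^esub> q = \<one>\<^bsub>unit_group n\<^esub>" "a [^]\<^bsub>unit_group n\<^esub> k' = \<one>\<^bsub>unit_group n\<^esub>"
          using aq ak' by (simp_all add: unit_group_pow unit_group_simps cong_def)
        then have "U.ord a dvd q" "U.ord a dvd k'" using U.pow_eq_id[OF ac] by auto
        moreover have "coprime q k'" using False q(1) prime_imp_coprime by blast
        ultimately have "U.ord a dvd 1" using coprime_common_divisor by blast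
        then have "U.ord a = 1" by simp
        then have "a = 1 mod int n" using U.ord_eq_1[OF ac] by (simp add: unit_group_simps)
        then have "int n dvd a - 1" by (metis cong_iff_dvd_diff cong_mod_left cong_refl)
        then show False using np p(2) by (meson dvd_trans of_nat_dvd_iff)
      qed
    qed
  qed
  then have a1: "[a = 1] (mod int n)" by (simp add: cong_iff_dvd_diff)
  have tr: "affine_map n 1 t r" by (rule affine_map_cong[OF a(2) a1 cong_refl])
  have nt: "\<not> int n dvd t"
  proof
    assume "int n dvd t"
    then have "affine_map n 1 0 r" using affine_map_cong[OF tr cong_refl, of 0] by (simp add: cong_0_iff)
    then show False using affine_map_ext[OF _ affine_map_id] rid(1) by blast
  qed
  have "affine_map n 1 (int q * t) id" using affine_map_funpow_translation[OF tr, of q] rid(2) by simp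
  then have qt: "int n dvd int q * t" using affine_map_unique(2)[OF n _ affine_map_id] by (metis cong_0_iff)
  have "\<not> q dvd d"
  proof
    assume "q dvd d"
    have "int d dvd t" using translation_datum[OF _ tr] r by (simp add: normal_of_prime_order_def)
    then have q_t: "int q dvd t" using \<open>q dvd d\<close> by (meson dvd_trans of_nat_dvd_iff)
    obtain m where m: "n = q * m" using q(2) by auto
    have "int q * int m dvd int q * t" using qt m by simp
    moreover have "int q \<noteq> 0" using q(1) by auto
    ultimately have "int m dvd t" by simp
    moreover have "coprime (int q) (int m)" using squarefree_cofactor[OF sf m] by simp
    ultimately have "int q * int m dvd t" using q_t divides_mult by blast
    then show False using nt m by simp
  qed
  then show ?thesis using that tr nt qt by blast
qed

text \<open>The translation by \<open>n / q\<close> generates such a subgroup.\<close>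
lemma exists_normal_of_prime_order:
  assumes q: "Factorial_Ring.prime q" "q dvd n" and nd: "\<not> q dvd d"
  shows "\<exists>r. normal_of_prime_order (affine_group n d H \<phi>) q r"
proof -
  obtain m where m: "n = q * m" using q(2) by auto
  have dn: "d dvd n" using D by (simp add: affine_datum_def)
  have "coprime d q" using nd q(1) prime_imp_coprime by (metis coprime_commute)
  then have dm: "d dvd m" using dn m by (simp add: coprime_dvd_mult_right_iff)
  obtain r where r: "affine_map n 1 (int m) r" using affine_map_exists[OF n, of 1] by auto
  have rG: "r \<in> affine_group n d H \<phi>" by (rule datum_translation[OF _ r]) (use dm in simp)
  have m0: "m > 0" using m n by (intro gr0I) simp
  have rid: "r \<noteq> id"
  proof
    assume "r = id"
    then have "[int m = 0] (mod int n)" using affine_map_unique(2)[OF n r] affine_map_id by blast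
    then have "q * m dvd m" using m by (simp only: cong_0_iff of_nat_dvd_iff)
    then have "q dvd 1" using m0 by simp
    then show False using q(1) by simp
  qed
  have "affine_map n 1 (int q * int m) (r ^^ q)" by (rule affine_map_funpow_translation[OF r])
  then have "affine_map n 1 0 (r ^^ q)" by (rule affine_map_cong) (simp_all add: m cong_def)
  then have rq: "r ^^ q = id" using affine_map_ext[OF _ affine_map_id] by blast
  have "\<exists>k. g \<circ> r = (r ^^ k) \<circ> g" if gG: "g \<in> affine_group n d H \<phi>" for g
  proof -
    obtain a t where a: "affine_map n a t g" using gG by (auto simp: affine_group_def)
    define k where "k = nat (a mod int n)"
    have k: "[int k = a] (mod int n)" using n by (simp add: k_def cong_def)
    have "affine_map n (1 * a) (1 * t + int k * int m) (r ^^ k \<circ> g)"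
      by (rule affine_map_comp[OF affine_map_funpow_translation[OF r] a])
    then have "affine_map n (1 * a) (int k * int m + t) (r ^^ k \<circ> g)" by (simp add: add.commute)
    moreover have "[int k * int m + t = a * int m + t] (mod int n)"
      using k by (intro cong_add cong_mult) simp_all
    moreover have "[1 * a = a * 1] (mod int n)" by simp
    ultimately have "affine_map n (a * 1) (a * int m + t) (r ^^ k \<circ> g)" using affine_map_cong by blast
    then show ?thesis using affine_map_ext[OF affine_map_comp[OF a r]] by blast
  qed
  then show ?thesis using rG rid rq unfolding normal_of_prime_order_def by blast
qed

end

lemma normal_of_prime_order_iso:
  assumes G: "transitive_perm_group n G" and G': "transitive_perm_group n G'"
    and \<rho>: "\<rho> \<in> iso (perm_group n G) (perm_group n G')" and r: "normal_of_prime_order G q r"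
  shows "normal_of_prime_order G' q (\<rho> r)" "g \<in> G \<Longrightarrow> g \<circ> r = (r ^^ k) \<circ> g \<Longrightarrow> \<rho> g \<circ> \<rho> r = ((\<rho> r) ^^ k) \<circ> \<rho> g"
proof -
  note GD = transitive_groupD[OF G] and GD' = transitive_groupD[OF G']
  have hom: "\<rho> (g \<circ> h) = \<rho> g \<circ> \<rho> h" if "g \<in> G" "h \<in> G" for g h
    using \<rho> that by (auto simp: iso_def hom_def perm_group_simps)
  have bij: "bij_betw \<rho> G G'" using \<rho> by (simp add: iso_def perm_group_simps)
  interpret \<rho>: group_hom "perm_group n G" "perm_group n G'" \<rho>
    using GD(7) GD'(7) \<rho> by (simp add: group_hom_def group_hom_axioms_def iso_def)
  have id: "\<rho> id = id" using \<rho>.hom_one by (simp add: perm_group_simps)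
  have rG: "r \<in> G" "r \<noteq> id" "r ^^ q = id" using r by (auto simp: normal_of_prime_order_def)
  have pow: "r ^^ k \<in> G \<and> \<rho> (r ^^ k) = (\<rho> r) ^^ k" for k
  proof (induction k)
    case 0
    show ?case using GD(2) id by (simp add: id_def)
  next
    case (Suc k)
    then show ?case unfolding funpow.simps(2) using GD(3)[OF rG(1)] hom[OF rG(1)] by metis
  qed
  show comm: "\<rho> g \<circ> \<rho> r = ((\<rho> r) ^^ k) \<circ> \<rho> g"
    if "g \<in> G" "g \<circ> r = (r ^^ k) \<circ> g" for g k
    using hom[OF that(1) rG(1)] hom[of "r ^^ k" g] pow[of k] that by metis
  show "normal_of_prime_order G' q (\<rho> r)"
    unfolding normal_of_prime_order_def
  proof (intro conjI ballI)
    show "\<rho> r \<in> G'" using bij rG(1) bij_betwE by blast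
    show "\<rho> r \<noteq> id" using bij rG(1,2) GD(2) id by (metis bij_betw_def inj_onD)
    show "(\<rho> r) ^^ q = id" using pow[of q] rG(3) id by metis
    fix g' assume "g' \<in> G'"
    then obtain g where g: "g \<in> G" "g' = \<rho> g" using bij by (metis bij_betw_def imageE)
    then obtain k where "g \<circ> r = (r ^^ k) \<circ> g" using r unfolding normal_of_prime_order_def by blast
    then show "\<exists>k. g' \<circ> \<rho> r = ((\<rho> r) ^^ k) \<circ> g'" using comm[OF g(1)] g(2) by blast
  qed
qed

text \<open>The primes dividing \<open>n\<close> but not \<open>d\<close> are those for which there is a normal subgroup of that order. If \<open>g\<close>
  has multiplier \<open>a\<close> and \<open>r\<close> generates the normal subgroup of order \<open>q\<close>, then \<open>g\<close> conjugates \<open>r\<close> to \<open>r\<^sup>a\<close>. The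
  isomorphism preserves this relation, so it preserves multipliers modulo every such \<open>q\<close>; modulo \<open>d\<close> all
  multipliers are \<open>1\<close>.\<close>
lemma datum_le_if_iso:
  assumes n: "n > 0" "squarefree n" and D: "affine_datum n d H \<phi>" and D': "affine_datum n d' H' \<phi>'"
    and \<rho>: "\<rho> \<in> iso (perm_group n (affine_group n d H \<phi>)) (perm_group n (affine_group n d' H' \<phi>'))"
  shows "d' dvd d" "d = d' \<Longrightarrow> H \<subseteq> H'"
proof -
  let ?G = "affine_group n d H \<phi>" and ?G' = "affine_group n d' H' \<phi>'"
  note tr = affine_group_transitive[OF D n(1)] and tr' = affine_group_transitive[OF D' n(1)]
  have dn: "d dvd n" "d' dvd n" using D D' by (auto simp: affine_datum_def)
  have nd: "\<not> q dvd d'" if q: "Factorial_Ring.prime q" "q dvd n" "\<not> q dvd d" for q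
  proof -
    obtain r where "normal_of_prime_order ?G q r" using exists_normal_of_prime_order[OF n D q] by blast
    then have "normal_of_prime_order ?G' q (\<rho> r)" by (rule normal_of_prime_order_iso(1)[OF tr tr' \<rho>])
    then show ?thesis using normal_of_prime_order_is_translation[OF n D' q(1,2)] by metis
  qed
  have "int d' dvd int d"
  proof (rule squarefree_dvdI)
    show "squarefree d'" using n(2) dn(2) squarefree_mono by blast
    show "int q dvd int d" if "Factorial_Ring.prime q" "q dvd d'" for q
      using nd[of q] that dn(2) by (meson dvd_trans of_nat_dvd_iff)
  qed
  then show "d' dvd d" by simp
  assume dd: "d = d'"
  have H: "subgroup H (unit_group n)" "subgroup H' (unit_group n)" and
    one: "\<And>a. a \<in> H \<Longrightarrow> [a = 1] (mod int d)" "\<And>a. a \<in> H' \<Longrightarrow> [a = 1] (mod int d')"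
    using D D' by (auto simp: affine_datum_def)
  show "H \<subseteq> H'"
  proof
    fix a assume a: "a \<in> H"
    then have ac: "a \<in> {0..<int n}" "coprime a (int n)" using subgroup.subset[OF H(1)] by (auto simp: unit_group_simps)
    obtain g where g: "affine_map n a (\<phi> a) g" using affine_map_exists[OF n(1) ac(2)] by blast
    have gG: "g \<in> ?G" using a g cong_refl unfolding affine_group_def by blast
    have "\<rho> g \<in> ?G'" using \<rho> gG by (auto simp: iso_def hom_def perm_group_simps)
    then obtain a' t' where a': "a' \<in> H'" "affine_map n a' t' (\<rho> g)" by (auto simp: affine_group_def)
    have "int n dvd a' - a"
    proof (rule squarefree_dvdI[OF n(2)])
      fix q assume q: "Factorial_Ring.prime q" "q dvd n"
      show "int q dvd a' - a"
      proof (cases "q dvd d")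
        case True
        have "[a' = a] (mod int d)" using one(1)[OF a] one(2)[OF a'(1)] dd cong_sym cong_trans by blast
        then have "int d dvd a' - a" by (simp add: cong_iff_dvd_diff)
        then show ?thesis using True by (meson dvd_trans of_nat_dvd_iff)
      next
        case False
        obtain r where r: "normal_of_prime_order ?G q r" using exists_normal_of_prime_order[OF n D q False] by blast
        obtain s where s: "affine_map n 1 s r" using normal_of_prime_order_is_translation[OF n D q r] by metis
        define k where "k = nat a"
        have k: "int k = a" using ac by (simp add: k_def)
        have "affine_map n (1 * a) (1 * \<phi> a + int k * s) (r ^^ k \<circ> g)"
          by (rule affine_map_comp[OF affine_map_funpow_translation[OF s] g])
        moreover have "affine_map n (a * 1) (a * s + \<phi> a) (g \<circ> r)" by (rule affine_map_comp[OF g s])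
        ultimately have "g \<circ> r = (r ^^ k) \<circ> g" using affine_map_ext[of n a "a * s + \<phi> a"] k
          by (simp add: add.commute)
        then have comm: "\<rho> g \<circ> \<rho> r = ((\<rho> r) ^^ k) \<circ> \<rho> g"
          by (rule normal_of_prime_order_iso(2)[OF tr tr' \<rho> r gG])
        have r': "normal_of_prime_order ?G' q (\<rho> r)" by (rule normal_of_prime_order_iso(1)[OF tr tr' \<rho> r])
        obtain s' where s': "affine_map n 1 s' (\<rho> r)" "\<not> int n dvd s'" "int n dvd int q * s'"
          using normal_of_prime_order_is_translation[OF n D' q r'] by metis
        have e1: "affine_map n (a' * 1) (a' * s' + t') (\<rho> g \<circ> \<rho> r)" by (rule affine_map_comp[OF a'(2) s'(1)])
        have e2: "affine_map n (1 * a') (1 * t' + int k * s') (\<rho> g \<circ> \<rho> r)"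
          unfolding comm by (rule affine_map_comp[OF affine_map_funpow_translation[OF s'(1)] a'(2)])
        have "[a' * s' + t' = 1 * t' + int k * s'] (mod int n)" by (rule affine_map_unique(2)[OF n(1) e1 e2])
        then have "int n dvd (a' * s' + t') - (1 * t' + int k * s')" by (simp only: cong_iff_dvd_diff)
        also have "(a' * s' + t') - (1 * t' + int k * s') = s' * (a' - a)" using k by (simp add: algebra_simps)
        finally have nd': "int n dvd s' * (a' - a)" .
        show ?thesis
        proof (rule ccontr)
          assume c: "\<not> int q dvd a' - a"
          obtain m where m: "n = q * m" using q(2) by auto
          have "int q * int m dvd int q * s'" using s'(3) m by simp
          moreover have "int q \<noteq> 0" using q(1) by auto
          ultimately have ms: "int m dvd s'" by simp
          have "int q dvd int n" using q(2) by simp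
          then have "int q dvd s' * (a' - a)" using nd' dvd_trans by blast
          moreover have "Factorial_Ring.prime (int q)" using q(1) by simp
          ultimately have "int q dvd s'" using c prime_dvd_mult_iff by blast
          moreover have "coprime (int q) (int m)" using squarefree_cofactor[OF n(2) m] by simp
          ultimately have "int q * int m dvd s'" using ms divides_mult by blast
          then show False using s'(2) m by simp
        qed
      qed
    qed
    then have "[a' = a] (mod int n)" by (simp add: cong_iff_dvd_diff)
    moreover have "a' \<in> {0..<int n}" using subgroup.subset[OF H(2)] a'(1) by (auto simp: unit_group_simps)
    ultimately have "a' = a" using ac(1) by (simp add: cong_def)
    then show "a \<in> H'" using a'(1) by simp
  qed
qed

lemma datum_eq_if_conjugate:
  assumes n: "n > 0" "squarefree n" and D: "affine_datum n d H \<phi>" and D': "affine_datum n d' H' \<phi>'"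
    and rel: "(affine_group n d H \<phi>, affine_group n d' H' \<phi>') \<in> perm_iso_rel n"
  shows "d = d'" "H = H'"
proof -
  obtain \<rho> where \<rho>: "\<rho> \<in> iso (perm_group n (affine_group n d H \<phi>)) (perm_group n (affine_group n d' H' \<phi>'))"
    using rel unfolding perm_iso_rel_def pair_iso_def by blast
  have \<rho>': "inv_into (carrier (perm_group n (affine_group n d H \<phi>))) \<rho> \<in> iso (perm_group n (affine_group n d' H' \<phi>')) (perm_group n (affine_group n d H \<phi>))"
    by (rule group.iso_set_sym[OF transitive_groupD(7)[OF affine_group_transitive[OF D n(1)]] \<rho>])
  show dd: "d = d'" using datum_le_if_iso(1)[OF n D D' \<rho>] datum_le_if_iso(1)[OF n D' D \<rho>'] dvd_antisym by blast
  show "H = H'" using datum_le_if_iso(2)[OF n D D' \<rho> dd] datum_le_if_iso(2)[OF n D' D \<rho>' dd[symmetric]] by blast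
qed

section \<open>Isomorphism classes as pairs\<close>

definition datum_pairs :: "nat \<Rightarrow> (nat \<times> int set) set" where
  "datum_pairs n = {(d, H). d dvd n \<and> subgroup H (unit_group n) \<and> (\<forall>a\<in>H. [a = 1] (mod int d)) \<and> d dvd card H}"

text \<open>The order of \<open>H\<close> annihilates the image \<open>\<int>/d\<close> of \<open>\<phi>\<close>.\<close>
lemma datum_divides_card:
  assumes n: "n > 0" and D: "affine_datum n d H \<phi>"
  shows "d dvd card H"
proof -
  interpret U: finite_comm_group "unit_group n" by (rule finite_comm_group_unit_group[OF n])
  have H: "subgroup H (unit_group n)" using D by (simp add: affine_datum_def)
  obtain a where a: "a \<in> H" "[\<phi> a = 1] (mod int d)" using D by (auto simp: affine_datum_def)
  have "a [^]\<^bsub>unit_group n\<^esub> card H = \<one>\<^bsub>unit_group n\<^esub>"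
    using U.subgroup_subset_torsion_card[OF H] a(1) by (auto simp: U.torsion_def)
  then have e: "a ^ card H mod int n = a ^ 0 mod int n" by (simp add: unit_group_pow unit_group_simps)
  have "[int (card H) * \<phi> a = int 0 * \<phi> a] (mod int d)"
    using affine_datum_pow[OF D n a(1), of "card H"] affine_datum_pow[OF D n a(1), of 0] unfolding e
    using cong_sym cong_trans by blast
  moreover have "[int (card H) * \<phi> a = int (card H) * 1] (mod int d)" using a(2) by (intro cong_mult cong_refl)
  ultimately have "[int (card H) = 0] (mod int d)" by simp (meson cong_sym cong_trans)
  then show ?thesis by (simp add: cong_0_iff)
qed

text \<open>The assumption on the cofactor provides a \<open>\<phi>\<close> for every pair and makes the resulting group unique up to
  conjugation.\<close>
lemma num_realised_types_eq_card_pairs: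
  assumes inf: "infinite (UNIV :: 'u set)" and n: "n > 0" "squarefree n"
    and cop: "\<And>d H. (d, H) \<in> datum_pairs n \<Longrightarrow> coprime d (card H div d)"
  shows "num_realised_types TYPE('u) n (integer_mod_group n) = card (datum_pairs n)"
proof -
  let ?R = "{G. transitive_perm_group n G \<and> (\<exists>c. c permutes {1..n} \<and> conj_by c ` G \<subseteq> affine_perms n)}"
  note eqv = equiv_perm_iso_rel[OF n(1)]
  define gp where "gp = (\<lambda>(d, H). affine_group n d H (SOME \<phi>. affine_datum n d H \<phi>))"
  have ex: "affine_datum n d H (SOME \<phi>. affine_datum n d H \<phi>)" if P: "(d, H) \<in> datum_pairs n" for d H
  proof -
    have "\<exists>\<phi>. affine_datum n d H \<phi>"
    proof (rule affine_datum_exists[OF n])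
      show "card H = d * (card H div d)" using P by (auto simp: datum_pairs_def)
      show "coprime d (card H div d)" by (rule cop[OF P])
    qed (use P in \<open>auto simp: datum_pairs_def\<close>)
    then show ?thesis by (rule someI_ex)
  qed
  have gpR: "gp P \<in> ?R" if "P \<in> datum_pairs n" for P
  proof -
    obtain d H where P: "P = (d, H)" by (cases P)
    have D: "affine_datum n d H (SOME \<phi>. affine_datum n d H \<phi>)" using ex that P by blast
    have "transitive_perm_group n (gp P)" using affine_group_transitive[OF D n(1)] by (simp add: gp_def P)
    moreover have "conj_by id ` gp P = gp P" by (simp add: conj_by_def)
    then have "conj_by id ` gp P \<subseteq> affine_perms n" using affine_group_subset by (simp add: gp_def P)
    ultimately show ?thesis using permutes_id by blast
  qed
  have "bij_betw (\<lambda>P. perm_iso_rel n `` {gp P}) (datum_pairs n) (?R // perm_iso_rel n)"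
    unfolding bij_betw_def
  proof
    show "inj_on (\<lambda>P. perm_iso_rel n `` {gp P}) (datum_pairs n)"
    proof (rule inj_onI)
      fix P Q assume P: "P \<in> datum_pairs n" and Q: "Q \<in> datum_pairs n"
        and e: "perm_iso_rel n `` {gp P} = perm_iso_rel n `` {gp Q}"
      obtain d H d' H' where PQ: "P = (d, H)" "Q = (d', H')" by (cases P, cases Q)
      have "gp Q \<in> {G. transitive_perm_group n G}" using gpR[OF Q] by blast
      then have "(gp P, gp Q) \<in> perm_iso_rel n" using eq_equiv_class[OF e eqv] by blast
      then have "d = d'" "H = H'"
        using datum_eq_if_conjugate[OF n ex ex] P Q unfolding PQ gp_def by auto
      then show "P = Q" by (simp add: PQ)
    qed
    show "(\<lambda>P. perm_iso_rel n `` {gp P}) ` datum_pairs n = ?R // perm_iso_rel n"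
    proof
      show "(\<lambda>P. perm_iso_rel n `` {gp P}) ` datum_pairs n \<subseteq> ?R // perm_iso_rel n"
        using gpR by (auto intro: quotientI)
      show "?R // perm_iso_rel n \<subseteq> (\<lambda>P. perm_iso_rel n `` {gp P}) ` datum_pairs n"
      proof
        fix Z assume "Z \<in> ?R // perm_iso_rel n"
        then obtain G where G: "G \<in> ?R" "Z = perm_iso_rel n `` {G}" by (rule quotientE)
        then obtain c where c: "c permutes {1..n}" "conj_by c ` G \<subseteq> affine_perms n" and tr: "transitive_perm_group n G"
          by blast
        have tr': "transitive_perm_group n (conj_by c ` G)" by (rule transitive_conj_by[OF tr c(1)])
        obtain d H \<phi> where D: "affine_datum n d H \<phi>" "conj_by c ` G = affine_group n d H \<phi>"
          using transitive_affine_group_datum[OF n tr' c(2)] by metis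
        have P: "(d, H) \<in> datum_pairs n"
          using D(1) datum_divides_card[OF n(1) D(1)] by (auto simp: datum_pairs_def affine_datum_def)
        have card: "card H = d * (card H div d)" using P by (auto simp: datum_pairs_def)
        obtain c' where c': "c' permutes {1..n}" "gp (d, H) = conj_by c' ` affine_group n d H \<phi>"
          using same_datum_conjugate[OF n D(1) ex[OF P] card cop[OF P]] unfolding gp_def by auto
        have "(G, conj_by c ` G) \<in> perm_iso_rel n" using perm_iso_rel_iff[OF n(1)] tr tr' c(1) by blast
        moreover have "(conj_by c ` G, gp (d, H)) \<in> perm_iso_rel n"
          unfolding perm_iso_rel_iff[OF n(1)] using tr' gpR[OF P] c' D(2) by auto
        ultimately have "(G, gp (d, H)) \<in> perm_iso_rel n" using eqv by (meson equivE transE)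
        then have "Z = perm_iso_rel n `` {gp (d, H)}" unfolding G(2) by (rule equiv_class_eq[OF eqv])
        then show "Z \<in> (\<lambda>P. perm_iso_rel n `` {gp P}) ` datum_pairs n" using P by blast
      qed
    qed
  qed
  then show ?thesis
    unfolding num_realised_types_def realised_perm_groups_cyclic[OF inf n(1)] by (simp add: bij_betw_same_card)
qed

section \<open>Unit groups of residue rings\<close>

lemma order_unit_group: "m > 0 \<Longrightarrow> order (unit_group m) = totient m"
proof -
  assume m: "m > 0"
  show ?thesis
  proof (cases "m = 1")
    case True
    have "carrier (unit_group m) = {0}" unfolding True by (auto simp: unit_group_simps)
    then show ?thesis by (simp add: order_def True)
  next
    case False
    then have m1: "m > 1" using m by simp
    have "bij_betw int (totatives m) (carrier (unit_group m))"
    proof (rule bij_betwI[where g=nat])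
      show "int \<in> totatives m \<rightarrow> carrier (unit_group m)"
        using totatives_less[OF _ m1] by (auto simp: totatives_def unit_group_simps)
      have "a > 0" if "a \<ge> 0" "coprime a (int m)" for a
        using that m1 by (cases "a = 0") auto
      then show "nat \<in> carrier (unit_group m) \<rightarrow> totatives m"
        by (auto simp: totatives_def unit_group_simps coprime_int_iff[symmetric] simp del: coprime_int_iff)
    qed (auto simp: unit_group_simps)
    then show ?thesis unfolding order_def totient_def by (metis bij_betw_same_card)
  qed
qed

lemma bij_betw_subgroups_iso:
  assumes A: "group A" and B: "group B" and h: "h \<in> iso A B"
  shows "bij_betw (image h) {H. subgroup H A \<and> d dvd card H} {H. subgroup H B \<and> d dvd card H}"
proof -
  have inj: "inj_on h (carrier A)" and surj: "h ` carrier A = carrier B" using h by (auto simp: iso_def bij_betw_def)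
  have gh: "group_hom A B h" using A B h by (simp add: group_hom_def group_hom_axioms_def iso_def)
  let ?k = "inv_into (carrier A) h"
  have k: "?k \<in> iso B A" by (rule group.iso_set_sym[OF A h])
  then have gk: "group_hom B A ?k" using A B by (simp add: group_hom_def group_hom_axioms_def iso_def)
  have kh: "?k ` (h ` H) = H" if "H \<subseteq> carrier A" for H
    using inj that by (simp add: inv_into_image_cancel)
  have hk: "h ` (?k ` H) = H" if "H \<subseteq> carrier B" for H
    using surj that by (metis image_inv_into_cancel)
  have ch: "card (h ` H) = card H" if "H \<subseteq> carrier A" for H
    using inj that by (metis card_image inj_on_subset)
  have injk: "inj_on ?k (carrier B)" using k by (simp add: iso_def bij_betw_def)
  show ?thesis
  proof (rule bij_betwI[where g="image ?k"])
    show "image h \<in> {H. subgroup H A \<and> d dvd card H} \<rightarrow> {H. subgroup H B \<and> d dvd card H}"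
    proof
      fix H assume "H \<in> {H. subgroup H A \<and> d dvd card H}"
      then have H: "subgroup H A" "d dvd card H" by auto
      show "h ` H \<in> {H. subgroup H B \<and> d dvd card H}"
        using group_hom.subgroup_img_is_subgroup[OF gh H(1)] ch[OF subgroup.subset[OF H(1)]] H(2) by simp
    qed
    show "image ?k \<in> {H. subgroup H B \<and> d dvd card H} \<rightarrow> {H. subgroup H A \<and> d dvd card H}"
    proof
      fix H assume "H \<in> {H. subgroup H B \<and> d dvd card H}"
      then have H: "subgroup H B" "d dvd card H" by auto
      have "card (?k ` H) = card H" using injk subgroup.subset[OF H(1)] by (metis card_image inj_on_subset)
      then show "?k ` H \<in> {H. subgroup H A \<and> d dvd card H}"
        using group_hom.subgroup_img_is_subgroup[OF gk H(1)] H(2) by simp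
    qed
    show "?k ` (h ` H) = H" if "H \<in> {H. subgroup H A \<and> d dvd card H}" for H
      using that kh subgroup.subset by blast
    show "h ` (?k ` H) = H" if "H \<in> {H. subgroup H B \<and> d dvd card H}" for H
      using that hk subgroup.subset by blast
  qed
qed

lemma subgroup_cong_one:
  assumes n: "n > 0" and d: "d dvd n"
  shows "subgroup {a \<in> carrier (unit_group n). [a = 1] (mod int d)} (unit_group n)" (is "subgroup ?M _")
proof -
  interpret U: finite_comm_group "unit_group n" by (rule finite_comm_group_unit_group[OF n])
  have modd: "[x mod int n = x] (mod int d)" for x using d by (simp add: cong_def mod_mod_cancel)
  show ?thesis
  proof (rule U.finite_subgroupI[OF U.finite_carrier])
    show "?M \<noteq> {}" using modd[of 1] U.one_closed by (auto simp: unit_group_simps(3))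
    fix a b assume "a \<in> ?M" "b \<in> ?M"
    then have a: "a \<in> carrier (unit_group n)" "[a = 1] (mod int d)" and b: "b \<in> carrier (unit_group n)" "[b = 1] (mod int d)"
      by auto
    have "[a * b = 1 * 1] (mod int d)" using a(2) b(2) by (rule cong_mult)
    then have "[(a * b) mod int n = 1] (mod int d)" using modd cong_trans by (metis mult_1)
    then show "a \<otimes>\<^bsub>unit_group n\<^esub> b \<in> ?M" using U.m_closed[OF a(1) b(1)]
      by (simp add: unit_group_simps(2))
  qed auto
qed

text \<open>By the Chinese remainder theorem, reduction modulo \<open>m\<close> is an isomorphism from the units congruent to \<open>1\<close>
  modulo \<open>d\<close> to the units modulo \<open>m\<close>.\<close>
lemma card_pairs_fibre:
  assumes n: "n > 0" and m: "n = d * m" and cop: "coprime d m"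
  shows "card {H. subgroup H (unit_group n) \<and> (\<forall>a\<in>H. [a = 1] (mod int d)) \<and> d dvd card H}
    = card {H. subgroup H (unit_group m) \<and> d dvd card H}"
proof -
  interpret U: finite_comm_group "unit_group n" by (rule finite_comm_group_unit_group[OF n])
  have m0: "m > 0" "d > 0" using n m by (auto intro: Nat.gr0I)
  interpret W: finite_comm_group "unit_group m" by (rule finite_comm_group_unit_group[OF m0(1)])
  define M where "M = {a \<in> carrier (unit_group n). [a = 1] (mod int d)}"
  have modd: "[x mod int n = x] (mod int d)" "[x mod int n = x] (mod int m)" for x
    by (simp_all add: m cong_def mod_mod_cancel)
  have M: "subgroup M (unit_group n)" unfolding M_def by (rule subgroup_cong_one[OF n]) (simp add: m)
  let ?A = "unit_group n\<lparr>carrier := M\<rparr>"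
  have gA: "group ?A" by (rule U.subgroup_imp_group[OF M])
  have copi: "coprime (int d) (int m)" using cop by simp
  have iso: "(\<lambda>a. a mod int m) \<in> iso ?A (unit_group m)"
  proof (rule isoI)
    have mem: "a mod int m \<in> carrier (unit_group m)" if "a \<in> M" for a
    proof -
      have "coprime a (int n)" using that by (simp add: M_def unit_group_simps)
      then have "coprime a (int m)" by (simp add: m)
      then have "coprime (a mod int m) (int m)" using cong_imp_coprime[of a "a mod int m" "int m"] by (simp add: cong_def)
      then show ?thesis using m0(1) by (simp add: unit_group_simps)
    qed
    show "(\<lambda>a. a mod int m) \<in> hom ?A (unit_group m)"
    proof (rule homI)
      fix a b
      have "(a * b) mod int n mod int m = (a * b) mod int m" using modd(2)[of "a * b"] by (simp add: cong_def)
      then show "a \<otimes>\<^bsub>?A\<^esub> b mod int m = a mod int m \<otimes>\<^bsub>unit_group m\<^esub> (b mod int m)"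
        by (simp add: unit_group_simps(2) mod_mult_eq)
    qed (use mem in simp)
    show "bij_betw (\<lambda>a. a mod int m) (carrier ?A) (carrier (unit_group m))"
      unfolding bij_betw_def
    proof
      show "inj_on (\<lambda>a. a mod int m) (carrier ?A)"
      proof (rule inj_onI)
        fix a b assume "a \<in> carrier ?A" "b \<in> carrier ?A" and e: "a mod int m = b mod int m"
        then have ab: "[a = 1] (mod int d)" "[b = 1] (mod int d)" "a \<in> {0..<int n}" "b \<in> {0..<int n}"
          by (auto simp: M_def unit_group_simps)
        have "[a = b] (mod int d)" using ab cong_sym cong_trans by blast
        moreover have "[a = b] (mod int m)" using e by (simp add: cong_def)
        ultimately have "[a = b] (mod int d * int m)" using coprime_cong_mult copi by blast
        then show "a = b" using ab(3,4) by (simp add: m cong_def)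
      qed
      show "(\<lambda>a. a mod int m) ` carrier ?A = carrier (unit_group m)"
      proof
        show "(\<lambda>a. a mod int m) ` carrier ?A \<subseteq> carrier (unit_group m)" using mem by auto
        show "carrier (unit_group m) \<subseteq> (\<lambda>a. a mod int m) ` carrier ?A"
        proof
          fix b assume b: "b \<in> carrier (unit_group m)"
          then have br: "b \<in> {0..<int m}" "coprime b (int m)" by (auto simp: unit_group_simps)
          obtain y where y: "[y = 1] (mod int d)" "[y = b] (mod int m)"
            using binary_chinese_remainder_int[OF copi] by blast
          define a where "a = y mod int n"
          have a: "[a = 1] (mod int d)" "[a = b] (mod int m)"
            using y modd cong_trans unfolding a_def by blast+
          have "coprime a (int d)" using cong_imp_coprime[OF cong_sym[OF a(1)]] by simp
          moreover have "coprime a (int m)" using cong_imp_coprime[OF cong_sym[OF a(2)] br(2)] .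
          ultimately have "coprime a (int d * int m)" by (simp only: coprime_mult_right_iff)
          then have "coprime a (int n)" by (simp add: m)
          then have "a \<in> M" using a(1) n by (simp add: M_def unit_group_simps a_def)
          moreover have "a mod int m = b" using a(2) br(1) by (simp add: cong_def)
          ultimately show "b \<in> (\<lambda>a. a mod int m) ` carrier ?A" by force
        qed
      qed
    qed
  qed
  have "{H. subgroup H (unit_group n) \<and> (\<forall>a\<in>H. [a = 1] (mod int d)) \<and> d dvd card H} = {H. subgroup H ?A \<and> d dvd card H}"
  proof -
    have "subgroup H (unit_group n) \<and> (\<forall>a\<in>H. [a = 1] (mod int d)) \<longleftrightarrow> subgroup H ?A" for H
    proof
      assume H: "subgroup H (unit_group n) \<and> (\<forall>a\<in>H. [a = 1] (mod int d))"
      then have "H \<subseteq> M" using subgroup.subset by (auto simp: M_def)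
      then show "subgroup H ?A" using U.subgroup_incl[OF _ M] H by blast
    next
      assume H: "subgroup H ?A"
      then show "subgroup H (unit_group n) \<and> (\<forall>a\<in>H. [a = 1] (mod int d))"
        using U.incl_subgroup[OF M H] subgroup.subset[OF H] by (auto simp: M_def)
    qed
    then show ?thesis by blast
  qed
  then show ?thesis using bij_betw_same_card[OF bij_betw_subgroups_iso[OF gA W.group_axioms iso, of d]] by simp
qed

text \<open>The part of prime order \<open>p i\<close> of a subgroup is either trivial or everything.\<close>
lemma (in finite_comm_group) card_subgroups_split_primes:
  assumes "finite B" "inj_on p B" "\<And>i. i \<in> B \<Longrightarrow> Factorial_Ring.prime (p i)" "\<And>i. i \<in> B \<Longrightarrow> card (torsion (p i)) = p i"
    and "\<And>i. i \<in> B \<Longrightarrow> coprime (p i) h"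
  shows "card (subgroups_in (torsion (h * (\<Prod>i\<in>B. p i)))) = 2 ^ card B * card (subgroups_in (torsion h))"
  using assms
proof (induction B rule: finite_induct)
  case empty
  show ?case by simp
next
  case (insert b B)
  have cop: "coprime (p b) (h * prod p B)"
    unfolding coprime_mult_right_iff
  proof
    show "coprime (p b) h" using insert.prems by blast
    show "coprime (p b) (prod p B)"
    proof (rule prod_coprime_right)
      fix i assume "i \<in> B"
      then have "p b \<noteq> p i" using insert.prems(1) insert.hyps(2) by (auto simp: inj_on_def)
      then show "coprime (p b) (p i)" using insert.prems(2) \<open>i \<in> B\<close> primes_coprime by blast
    qed
  qed
  have e: "h * prod p (insert b B) = p b * (h * prod p B)" using insert.hyps by simp
  have "card (subgroups_in (torsion (p b))) = 2" using insert.prems card_subgroups_prime by blast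
  moreover have "card (subgroups_in (torsion (h * prod p B))) = 2 ^ card B * card (subgroups_in (torsion h))"
    by (rule insert.IH) (use insert.prems in auto)
  ultimately show ?case unfolding e card_subgroups_split[OF cop] using insert.hyps by simp
qed

lemma mem_torsion_unit_group:
  assumes "m > 0" "a \<in> carrier (unit_group m)"
  shows "a \<in> monoid.torsion (unit_group m) k \<longleftrightarrow> [a ^ k = 1] (mod int m)"
proof -
  interpret U: finite_comm_group "unit_group m" by (rule finite_comm_group_unit_group[OF assms(1)])
  show ?thesis using assms(2) by (simp add: U.torsion_def unit_group_pow unit_group_simps(3) cong_def)
qed

text \<open>The order of \<open>a\<close> divides \<open>u\<close> and, by Fermat, \<open>q - 1\<close>.\<close>
lemma cong_pow_gcd:
  assumes q: "Factorial_Ring.prime q" and a: "coprime a (int q)" and u: "[a ^ u = 1] (mod int q)" and v: "gcd u (q - 1) dvd v"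
  shows "[a ^ v = 1] (mod int q)"
proof -
  have q0: "q > 0" using q prime_gt_0_nat by blast
  interpret U: finite_comm_group "unit_group q" by (rule finite_comm_group_unit_group[OF q0])
  let ?b = "a mod int q"
  have "coprime ?b (int q)" using cong_imp_coprime[of a ?b "int q"] a by (simp add: cong_def)
  then have b: "?b \<in> carrier (unit_group q)" using q0 by (simp add: unit_group_simps)
  have pow: "[a ^ k = 1] (mod int q) \<longleftrightarrow> U.ord ?b dvd k" for k
    using mem_torsion_unit_group[OF q0 b, of k] U.mem_torsion_iff[of ?b k] b by (simp add: cong_def power_mod)
  have "U.ord ?b dvd q - 1" using U.ord_dvd_group_order[OF b] order_unit_group[OF q0] totient_prime[OF q] by simp
  then show ?thesis using u v unfolding pow by (meson dvd_trans gcd_greatest)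
qed

lemma cong_prod_int:
  assumes "\<And>i j. i \<in> A \<Longrightarrow> j \<in> A \<Longrightarrow> i \<noteq> j \<Longrightarrow> coprime (m i) (m j)" "\<And>i. i \<in> A \<Longrightarrow> [x = y] (mod int (m i))"
  shows "[x = y] (mod int (\<Prod>i\<in>A. m i))"
  using assms
proof (induction A rule: infinite_finite_induct)
  case (insert b A)
  have "coprime (int (m b)) (int (prod m A))"
    unfolding coprime_int_iff by (rule prod_coprime_right) (use insert.prems(1) insert.hyps(2) in blast)
  then have "[x = y] (mod int (m b) * int (prod m A))" using insert by (intro coprime_cong_mult) auto
  then show ?case using insert.hyps by simp
qed auto

lemma dvd_prod_primes_imp_subset:
  assumes "finite A" "d dvd (\<Prod>i\<in>A. p i)" "\<And>i. i \<in> A \<Longrightarrow> Factorial_Ring.prime (p i :: nat)"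
  shows "\<exists>D\<subseteq>A. d = (\<Prod>i\<in>D. p i)"
  using assms
proof (induction A arbitrary: d rule: finite_induct)
  case empty
  then show ?case by auto
next
  case (insert b A)
  show ?case
  proof (cases "p b dvd d")
    case True
    then obtain e where e: "d = p b * e" by auto
    have "p b > 0" using insert.prems(2) prime_gt_0_nat by blast
    then have "e dvd prod p A" using insert.prems(1) insert.hyps e by simp
    then obtain D where D: "D \<subseteq> A" "e = prod p D" using insert.IH insert.prems(2) by blast
    have "finite D" "b \<notin> D" using D(1) insert.hyps finite_subset by auto
    then have "d = prod p (insert b D)" using e D(2) by simp
    then show ?thesis using D(1) by (intro exI[of _ "insert b D"]) auto
  next
    case False
    have "coprime d (p b)" using False insert.prems(2) prime_imp_coprime coprime_commute by blast
    then have "d dvd prod p A" using insert.prems(1) insert.hyps by (simp add: coprime_dvd_mult_right_iff)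
    then obtain D where D: "D \<subseteq> A" "d = prod p D" using insert.IH insert.prems(2) by blast
    then show ?thesis by (intro exI[of _ D]) auto
  qed
qed

section \<open>Chains of safe primes\<close>

locale safe_prime_chain =
  fixes p :: "nat \<Rightarrow> nat" and l x s :: nat
  assumes l: "l \<ge> 1"
    and prime: "i \<in> {1..l} \<Longrightarrow> Factorial_Ring.prime (p i)"
    and odd: "i \<in> {1..l} \<Longrightarrow> odd (p i)"
    and decreasing: "1 \<le> i \<Longrightarrow> i < j \<Longrightarrow> j \<le> l \<Longrightarrow> p i > p j"
    and chain: "1 \<le> i \<Longrightarrow> i < l \<Longrightarrow> p i = 2 * p (i + 1) + 1"
    and last: "p l - 1 = 2 ^ x * s" and odd_s: "odd s"
begin

lemma inj_p: "inj_on p {1..l}"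
proof (rule inj_onI)
  fix i j assume "i \<in> {1..l}" "j \<in> {1..l}" "p i = p j"
  then show "i = j" using decreasing[of i j] decreasing[of j i] by (cases i j rule: linorder_cases) auto
qed

lemma coprime_p: "i \<in> {1..l} \<Longrightarrow> j \<in> {1..l} \<Longrightarrow> i \<noteq> j \<Longrightarrow> coprime (p i) (p j)"
  using prime inj_p primes_coprime by (metis inj_onD)

lemma pos_p: "i \<in> {1..l} \<Longrightarrow> p i > 0"
  using prime prime_gt_0_nat by blast

lemma coprime_two: "i \<in> {1..l} \<Longrightarrow> coprime (p i) (2 ^ k)"
  using odd by simp

lemma coprime_last:
  assumes "i \<in> {1..l}"
  shows "coprime (p i) (p l - 1)"
proof (rule prime_imp_coprime[OF prime[OF assms]])
  have "p l > 1" using prime prime_gt_1_nat l by simp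
  moreover have "p l \<le> p i" using decreasing[of i l] assms by (cases "i = l") auto
  ultimately show "\<not> p i dvd p l - 1" by (auto dest!: dvd_imp_le)
qed

lemma coprime_prod_p:
  assumes "A \<subseteq> {1..l}" "B \<subseteq> {1..l}" "A \<inter> B = {}"
  shows "coprime (prod p A) (prod p B)"
  by (intro prod_coprime_left prod_coprime_right coprime_p) (use assms in auto)

lemma pos_prod_p: "A \<subseteq> {1..l} \<Longrightarrow> prod p A > 0"
  using pos_p by (auto intro!: prod_pos)

lemma prime_dvd_prod_p:
  assumes "A \<subseteq> {1..l}" "i \<in> {1..l}"
  shows "p i dvd prod p A \<longleftrightarrow> i \<in> A"
proof
  assume dvd: "p i dvd prod p A"
  show "i \<in> A"
  proof (rule ccontr)
    assume "i \<notin> A"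
    then have "coprime (p i) (prod p A)" using coprime_prod_p[of "{i}" A] assms by simp
    then have "p i dvd 1" using coprime_common_divisor[OF _ dvd_refl dvd] by blast
    then show False using prime[OF assms(2)] not_prime_unit by blast
  qed
qed (use assms finite_subset[OF assms(1)] in \<open>auto intro: dvd_prodI\<close>)

lemma squarefree_prod_p: "squarefree (prod p {1..l})"
  by (intro squarefree_prod_coprime coprime_p squarefree_prime) (auto intro: prime)

text \<open>The contribution of \<open>p l\<close> to the order of the units modulo the product of the \<open>p i\<close> with \<open>i \<in> Q\<close>; it
  differs from those of the other primes, which are \<open>2 * p (Suc i)\<close>.\<close>
definition last_factor :: "nat set \<Rightarrow> nat" where
  "last_factor Q = (if l \<in> Q then 2 ^ x * s else 1)"

lemma coprime_last_factor: "i \<in> {1..l} \<Longrightarrow> coprime (p i) (last_factor Q)"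
  using coprime_last last by (simp add: last_factor_def)

lemma totient_prod_p:
  assumes Q: "Q \<subseteq> {1..l}"
  shows "totient (prod p Q) = 2 ^ card (Q - {l}) * last_factor Q * prod p (Suc ` (Q - {l}))"
proof -
  have fin: "finite Q" using Q finite_subset by blast
  have "totient (prod p Q) = (\<Prod>i\<in>Q. totient (p i))"
  proof (rule totient_prod_coprime)
    show "inj_on p Q" using inj_p Q inj_on_subset by blast
    show "pairwise coprime (p ` Q)"
    proof (rule pairwiseI)
      fix a b assume "a \<in> p ` Q" "b \<in> p ` Q" "a \<noteq> b"
      then obtain i j where "i \<in> Q" "j \<in> Q" "a = p i" "b = p j" by blast
      then show "coprime a b" using coprime_p[of i j] Q \<open>a \<noteq> b\<close> by blast
    qed
  qed
  also have "\<dots> = (\<Prod>i\<in>Q. p i - 1)" using prime Q by (intro prod.cong refl totient_prime) auto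
  also have "\<dots> = (\<Prod>i\<in>Q - {l}. p i - 1) * last_factor Q"
  proof (cases "l \<in> Q")
    case True
    then show ?thesis using prod.remove[OF fin True, of "\<lambda>i. p i - 1"] last by (simp add: last_factor_def)
  next
    case False
    then have "Q - {l} = Q" by blast
    then show ?thesis using False by (simp add: last_factor_def)
  qed
  also have "(\<Prod>i\<in>Q - {l}. p i - 1) = (\<Prod>i\<in>Q - {l}. 2 * p (Suc i))"
  proof (rule prod.cong[OF refl])
    fix i assume "i \<in> Q - {l}"
    then have "1 \<le> i" "i < l" using Q by (auto simp: order_less_le)
    then show "p i - 1 = 2 * p (Suc i)" using chain[of i] by simp
  qed
  also have "\<dots> = 2 ^ card (Q - {l}) * prod p (Suc ` (Q - {l}))"
    by (simp add: prod.distrib prod.reindex)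
  finally show ?thesis by simp
qed

text \<open>The number of units modulo \<open>n\<close> is divisible by each \<open>p i\<close> at most once, so \<open>p i\<close> does not divide both \<open>d\<close>
  and its cofactor.\<close>
lemma coprime_cofactor:
  assumes P: "(d, H) \<in> datum_pairs (prod p {1..l})"
  shows "coprime d (card H div d)"
proof (rule ccontr)
  let ?n = "prod p {1..l}" and ?J = "Suc ` ({1..l} - {l})"
  have n0: "?n > 0" by (rule pos_prod_p) simp
  interpret U: finite_comm_group "unit_group ?n" by (rule finite_comm_group_unit_group[OF n0])
  have d: "d dvd ?n" "d dvd card H" and H: "subgroup H (unit_group ?n)" using P by (auto simp: datum_pairs_def)
  assume "\<not> coprime d (card H div d)"
  then have "gcd d (card H div d) \<noteq> 1" by (simp only: coprime_iff_gcd_eq_1 not_False_eq_True)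
  then obtain q where "Factorial_Ring.prime q" "q dvd gcd d (card H div d)" using prime_factor_nat by blast
  then have q: "Factorial_Ring.prime q" "q dvd d" "q dvd card H div d" by auto
  have "q dvd ?n" using q(2) d(1) dvd_trans by blast
  then obtain j where j: "j \<in> {1..l}" "q dvd p j" using prime_dvd_prod_iff[of "{1..l}" q p] q(1) by blast
  then have qj: "q = p j" using q(1) prime primes_dvd_imp_eq by blast
  have "q * q dvd d * (card H div d)" using q(2,3) by (rule mult_dvd_mono)
  moreover have "card H dvd totient ?n"
    using group.lagrange[OF U.group_axioms H] order_unit_group[OF n0] by (metis dvd_triv_right)
  ultimately have qq: "q * q dvd totient ?n" using d(2) by (metis dvd_mult_div_cancel dvd_trans)
  have J: "?J \<subseteq> {1..l}" by auto
  have tot: "totient ?n = 2 ^ card ({1..l} - {l}) * last_factor {1..l} * prod p ?J" by (rule totient_prod_p) simp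
  have "coprime q (2 ^ card ({1..l} - {l}) * last_factor {1..l})"
    unfolding qj coprime_mult_right_iff using coprime_two coprime_last_factor j(1) by blast
  then have "q * q dvd prod p ?J"
    using qq unfolding tot by (simp add: coprime_dvd_mult_right_iff)
  then have "q * q dvd ?n" using prod_dvd_prod_subset[of "{1..l}" ?J p] J by (meson dvd_trans finite_atLeastAtMost)
  then have "q dvd 1" using squarefree_prod_p by (simp add: squarefree_def power2_eq_square)
  then show False using q(1) by simp
qed

text \<open>\<open>D\<close> is the set of the indices of the prime divisors of \<open>d\<close>.\<close>
definition fibre_card :: "nat set \<Rightarrow> nat" where
  "fibre_card D = card {H. subgroup H (unit_group (prod p ({1..l} - D))) \<and> prod p D dvd card H}"

lemma card_datum_pairs: "card (datum_pairs (prod p {1..l})) = (\<Sum>D\<in>Pow {1..l}. fibre_card D)"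
proof -
  let ?n = "prod p {1..l}"
  have n0: "?n > 0" by (rule pos_prod_p) simp
  interpret U: finite_comm_group "unit_group ?n" by (rule finite_comm_group_unit_group[OF n0])
  let ?F = "\<lambda>d. {H. subgroup H (unit_group ?n) \<and> (\<forall>a\<in>H. [a = 1] (mod int d)) \<and> d dvd card H}"
  have fin: "finite (?F d)" for d
  proof (rule finite_subset)
    show "?F d \<subseteq> Pow (carrier (unit_group ?n))" using subgroup.subset by blast
    show "finite (Pow (carrier (unit_group ?n)))" by (simp only: finite_Pow_iff U.finite_carrier)
  qed
  have "datum_pairs ?n = (SIGMA d:{d. d dvd ?n}. ?F d)" by (auto simp: datum_pairs_def)
  then have "card (datum_pairs ?n) = (\<Sum>d\<in>{d. d dvd ?n}. card (?F d))"
    using fin n0 by simp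
  also have "\<dots> = (\<Sum>D\<in>Pow {1..l}. card (?F (prod p D)))"
  proof (rule sum.reindex_bij_betw[symmetric])
    show "bij_betw (prod p) (Pow {1..l}) {d. d dvd ?n}"
      unfolding bij_betw_def
    proof
      show "inj_on (prod p) (Pow {1..l})"
      proof (rule inj_onI)
        fix A B assume "A \<in> Pow {1..l}" "B \<in> Pow {1..l}" "prod p A = prod p B"
        then have "i \<in> A \<longleftrightarrow> i \<in> B" if "i \<in> {1..l}" for i
          using prime_dvd_prod_p[OF _ that, of A] prime_dvd_prod_p[OF _ that, of B] by auto
        then show "A = B" using \<open>A \<in> Pow {1..l}\<close> \<open>B \<in> Pow {1..l}\<close> by blast
      qed
      show "prod p ` Pow {1..l} = {d. d dvd ?n}"
      proof (intro equalityI subsetI)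
        fix d assume "d \<in> {d. d dvd ?n}"
        then show "d \<in> prod p ` Pow {1..l}" using dvd_prod_primes_imp_subset[of "{1..l}" d p] prime by auto
      qed (auto intro: prod_dvd_prod_subset)
    qed
  qed
  also have "\<dots> = (\<Sum>D\<in>Pow {1..l}. fibre_card D)"
  proof (rule sum.cong[OF refl])
    fix D assume "D \<in> Pow {1..l}"
    then have D: "D \<subseteq> {1..l}" by blast
    have "?n = prod p D * prod p ({1..l} - D)" using prod.subset_diff[OF D] by (simp add: mult.commute)
    moreover have "coprime (prod p D) (prod p ({1..l} - D))" by (rule coprime_prod_p) (use D in auto)
    ultimately show "card (?F (prod p D)) = fibre_card D" unfolding fibre_card_def by (rule card_pairs_fibre[OF n0])
  qed
  finally show ?thesis .
qed

text \<open>A prime \<open>p i\<close> divides the number of units modulo \<open>n / d\<close> only if \<open>p (i - 1)\<close> exists and divides \<open>n / d\<close>.\<close>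
lemma fibre_card_eq_0:
  assumes D: "D \<subseteq> {1..l}" "D \<notin> index_sets l"
  shows "fibre_card D = 0"
proof -
  let ?Q = "{1..l} - D" and ?m = "prod p ({1..l} - D)"
  have m0: "?m > 0" by (rule pos_prod_p) blast
  interpret U: finite_comm_group "unit_group ?m" by (rule finite_comm_group_unit_group[OF m0])
  have "\<not> prod p D dvd card H" if H: "subgroup H (unit_group ?m)" for H
  proof
    assume dvd: "prod p D dvd card H"
    also have "card H dvd totient ?m"
      using group.lagrange[OF U.group_axioms H] order_unit_group[OF m0] by (metis dvd_triv_right)
    finally have dvd: "prod p D dvd totient ?m" .
    have succ: "i \<in> Suc ` (?Q - {l})" if i: "i \<in> D" for i
    proof -
      have il: "i \<in> {1..l}" using i D by blast
      have "p i dvd prod p D" using prime_dvd_prod_p[OF D(1) il] i by blast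
      then have "p i dvd totient ?m" using dvd by (rule dvd_trans)
      also have "totient ?m = 2 ^ card (?Q - {l}) * last_factor ?Q * prod p (Suc ` (?Q - {l}))"
        by (rule totient_prod_p) blast
      finally have "p i dvd 2 ^ card (?Q - {l}) * last_factor ?Q * prod p (Suc ` (?Q - {l}))" .
      moreover have "coprime (p i) (2 ^ card (?Q - {l}) * last_factor ?Q)"
        unfolding coprime_mult_right_iff using coprime_two[OF il] coprime_last_factor[OF il] by blast
      ultimately have "p i dvd prod p (Suc ` (?Q - {l}))" by (simp add: coprime_dvd_mult_right_iff)
      moreover have "Suc ` (?Q - {l}) \<subseteq> {1..l}" by auto
      ultimately show ?thesis using prime_dvd_prod_p il by blast
    qed
    then have "D \<in> index_sets l" using D(1) by (force simp: index_sets_def)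
    then show False using D(2) by blast
  qed
  then have "{H. subgroup H (unit_group ?m) \<and> prod p D dvd card H} = {}" by blast
  then show ?thesis unfolding fibre_card_def by (simp only: card.empty)
qed

end

context safe_prime_chain
begin

text \<open>For \<open>i \<in> D\<close> the prime \<open>p i\<close> must divide the order of the subgroup. Each of the other primes \<open>p (Suc i)\<close>
  dividing the order of the group leaves a choice between the trivial subgroup and the Sylow subgroup, of order
  \<open>p (Suc i)\<close>. There remain the 2-part and the part of order dividing \<open>s\<close>.\<close>
lemma fibre_card_eq:
  assumes D: "D \<in> index_sets l"
  defines "Q \<equiv> {1..l} - D"
  shows "fibre_card D = 2 ^ (card (Q - {l}) - card D) *
    card (monoid.subgroups_in (unit_group (prod p Q)) (monoid.torsion (unit_group (prod p Q)) (2 ^ card (Q - {l}) * last_factor Q)))"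
proof -
  let ?m = "prod p Q" and ?J = "Suc ` (Q - {l})"
  define h where "h = 2 ^ card (Q - {l}) * last_factor Q"
  have Q: "Q \<subseteq> {1..l}" unfolding Q_def by blast
  have m0: "?m > 0" by (rule pos_prod_p[OF Q])
  interpret U: finite_comm_group "unit_group ?m" by (rule finite_comm_group_unit_group[OF m0])
  have J: "?J \<subseteq> {1..l}"
  proof
    fix j assume "j \<in> ?J"
    then obtain i where i: "i \<in> Q" "i \<noteq> l" "j = Suc i" by blast
    then have "i \<le> l" using Q by auto
    then show "j \<in> {1..l}" using i by simp
  qed
  have DJ: "D \<subseteq> ?J"
  proof
    fix i assume i: "i \<in> D"
    then have "i \<in> {2..l}" using D by (auto simp: index_sets_def)
    moreover have "i - 1 \<notin> D" using D i \<open>i \<in> {2..l}\<close>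
      by (auto simp: index_sets_def dest!: spec[of _ "i - 1"])
    ultimately have "i = Suc (i - 1)" "i - 1 \<in> Q - {l}" unfolding Q_def by auto
    then show "i \<in> ?J" by blast
  qed
  have finJ: "finite ?J" using J finite_subset by blast
  have Jl: "?J - D \<subseteq> {1..l}" "D \<subseteq> {1..l}" using J DJ by auto
  have ord: "order (unit_group ?m) = h * prod p ?J" using order_unit_group[OF m0] totient_prod_p[OF Q] by (simp add: h_def)
  have split: "prod p ?J = prod p (?J - D) * prod p D" by (rule prod.subset_diff[OF DJ finJ])
  have coph: "coprime (p i) h" if "i \<in> {1..l}" for i
    unfolding h_def coprime_mult_right_iff using coprime_two[OF that] coprime_last_factor[OF that] by blast
  have "coprime (prod p D) (h * prod p (?J - D))"
    unfolding coprime_mult_right_iff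
  proof
    show "coprime (prod p D) h" by (rule prod_coprime_left) (use coph Jl in blast)
    show "coprime (prod p D) (prod p (?J - D))" by (rule coprime_prod_p) (use Jl in auto)
  qed
  moreover have "order (unit_group ?m) = prod p D * (h * prod p (?J - D))" by (simp add: ord split)
  ultimately have "fibre_card D = card (U.subgroups_in (U.torsion (h * prod p (?J - D))))"
    unfolding fibre_card_def Q_def[symmetric] using U.card_subgroups_divisible_order by blast
  also have "\<dots> = 2 ^ card (?J - D) * card (U.subgroups_in (U.torsion h))"
  proof (rule U.card_subgroups_split_primes)
    show "finite (?J - D)" using finJ by blast
    show "inj_on p (?J - D)" using inj_p Jl(1) by (rule inj_on_subset)
    fix i assume i: "i \<in> ?J - D"
    then have il: "i \<in> {1..l}" using Jl(1) by blast
    show "Factorial_Ring.prime (p i)" by (rule prime[OF il])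
    show "coprime (p i) h" by (rule coph[OF il])
    show "card (U.torsion (p i)) = p i"
    proof (rule U.card_torsion)
      have "prod p ?J = p i * prod p (?J - {i})" using finJ i by (intro prod.remove) auto
      then show "order (unit_group ?m) = p i * (h * prod p (?J - {i}))" by (simp add: ord)
      have "coprime (prod p {i}) (prod p (?J - {i}))" by (rule coprime_prod_p) (use il J in auto)
      then show "coprime (p i) (h * prod p (?J - {i}))" using coph[OF il] by (simp add: coprime_mult_right_iff)
    qed
  qed
  also have "card (?J - D) = card (Q - {l}) - card D"
    using card_Diff_subset[of D ?J] DJ finite_subset[OF DJ finJ] by (simp add: card_image)
  finally show ?thesis by (simp only: h_def)
qed

text \<open>For \<open>i \<noteq> l\<close> the number \<open>p i - 1\<close> is twice an odd number.\<close>
lemma two_power_torsion_square: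
  assumes Q: "Q \<subseteq> {1..l}" and i: "i \<in> Q" "i \<noteq> l" and a: "a \<in> carrier (unit_group (prod p Q))"
    and pow: "[a ^ (2 ^ e) = 1] (mod int (prod p Q))"
  shows "[a\<^sup>2 = 1] (mod int (p i))"
proof (rule cong_pow_gcd)
  have il: "i \<in> {1..l}" "Suc i \<in> {1..l}" using Q i by force+
  have fin: "finite Q" using Q finite_subset by blast
  show "Factorial_Ring.prime (p i)" by (rule prime[OF il(1)])
  have dvd: "int (p i) dvd int (prod p Q)" unfolding int_dvd_int_iff using fin i(1) by (rule dvd_prodI)
  have "coprime a (int (prod p Q))" using a by (simp add: unit_group_simps)
  then show "coprime a (int (p i))" by (rule coprime_divisors[OF dvd_refl dvd])
  show "[a ^ (2 ^ e) = 1] (mod int (p i))" using pow dvd cong_dvd_modulus by blast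
  have "p i - 1 = 2 * p (Suc i)" using chain[of i] il i by auto
  moreover have "coprime (2 ^ e) (p (Suc i))" using coprime_two[OF il(2)] by (simp add: coprime_commute)
  ultimately have "gcd (2 ^ e) (p i - 1) = gcd (2 ^ e) 2" by (simp add: gcd_mult_right_right_cancel)
  then show "gcd (2 ^ e) (p i - 1) dvd 2" by simp
qed

lemma card_subgroups_torsion_without_last:
  assumes Q: "Q \<subseteq> {1..l}" "l \<notin> Q"
  shows "of_nat (card (monoid.subgroups_in (unit_group (prod p Q))
      (monoid.torsion (unit_group (prod p Q)) (2 ^ card (Q - {l}) * last_factor Q)))) = (\<Sum>t=0..card Q. gauss2 (card Q) t)"
proof -
  let ?m = "prod p Q"
  have m0: "?m > 0" by (rule pos_prod_p[OF Q(1)])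
  interpret U: finite_comm_group "unit_group ?m" by (rule finite_comm_group_unit_group[OF m0])
  have Ql: "Q - {l} = Q" using Q(2) by blast
  have last_factor: "last_factor Q = 1" using Q(2) by (simp add: last_factor_def)
  have J: "Suc ` Q \<subseteq> {1..l}"
  proof
    fix j assume "j \<in> Suc ` Q"
    then obtain i where i: "i \<in> Q" "j = Suc i" by blast
    then have "i \<noteq> l" "i \<le> l" using Q by auto
    then show "j \<in> {1..l}" using i(2) by simp
  qed
  have V: "U.torsion (2 ^ card Q) \<subseteq> U.torsion 2"
  proof
    fix a assume a: "a \<in> U.torsion (2 ^ card Q)"
    then have ac: "a \<in> carrier (unit_group ?m)" by (simp add: U.torsion_def)
    have "[a ^ 2 ^ card Q = 1] (mod int ?m)" using a mem_torsion_unit_group[OF m0 ac] by blast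
    then have "[a\<^sup>2 = 1] (mod int (p i))" if "i \<in> Q" for i
      using two_power_torsion_square[OF Q(1) that _ ac] Q(2) that by blast
    then have "[a\<^sup>2 = 1] (mod int ?m)" by (intro cong_prod_int) (use coprime_p Q(1) in blast)+
    then show "a \<in> U.torsion 2" using mem_torsion_unit_group[OF m0 ac] by blast
  qed
  have "card (U.torsion (2 ^ card Q)) = 2 ^ card Q"
  proof (rule U.card_torsion)
    show "order (unit_group ?m) = 2 ^ card Q * prod p (Suc ` Q)"
      using order_unit_group[OF m0] totient_prod_p[OF Q(1)] by (simp add: Ql last_factor)
    show "coprime (2 ^ card Q) (prod p (Suc ` Q))"
      by (rule prod_coprime_right) (use coprime_two J coprime_commute in blast)
  qed
  then show ?thesis unfolding Ql last_factor mult_1_right by (rule U.card_subgroups_elementary[OF U.torsion_subgroup V])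
qed

text \<open>The units modulo \<open>p l\<close> form a cyclic group of order \<open>2 ^ x * s\<close>. A generator \<open>c\<close> is lifted to a unit
  modulo the whole product that is \<open>1\<close> modulo the other primes. Its power of order \<open>s\<close> generates the
  \<open>s\<close>-torsion. The 2-part is the product of the cyclic group generated by the power of order \<open>2 ^ x\<close> and of the
  group \<open>V\<close> of those elements that are \<open>1\<close> modulo \<open>p l\<close>, which have order at most \<open>2\<close> because the other primes
  contribute only one factor \<open>2\<close> each.\<close>
lemma card_subgroups_torsion_with_last:
  assumes Q: "Q \<subseteq> {1..l}" "l \<in> Q"
  defines "k \<equiv> card (Q - {l})"
  shows "of_nat (card (monoid.subgroups_in (unit_group (prod p Q)) (monoid.torsion (unit_group (prod p Q)) (2 ^ k * last_factor Q))))
    = (\<Sum>t=0..k. (2 ^ (k - t) * of_nat x + 1) * gauss2 k t) * of_nat (num_divisors s)"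
proof -
  let ?m = "prod p Q" and ?Q = "Q - {l}" and ?J = "Suc ` (Q - {l})"
  have m0: "?m > 0" by (rule pos_prod_p[OF Q(1)])
  interpret U: finite_comm_group "unit_group ?m" by (rule finite_comm_group_unit_group[OF m0])
  have fin: "finite Q" using Q(1) finite_subset by blast
  have ll: "l \<in> {1..l}" using l by simp
  have Q': "?Q \<subseteq> {1..l}" using Q(1) by blast
  have J: "?J \<subseteq> {1..l}"
  proof
    fix j assume "j \<in> ?J"
    then obtain i where i: "i \<in> Q" "i \<noteq> l" "j = Suc i" by blast
    then have "i \<le> l" using Q by auto
    then show "j \<in> {1..l}" using i by simp
  qed
  have last_factor: "last_factor Q = 2 ^ x * s" using Q(2) by (simp add: last_factor_def)
  have m: "?m = p l * prod p ?Q" using fin Q(2) by (rule prod.remove)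
  have s0: "s > 0" using odd_s by (auto intro: Nat.gr0I)
  have cops: "coprime (2 ^ e) s" for e using odd_s by simp
  have ord: "order (unit_group ?m) = 2 ^ (k + x) * (s * prod p ?J)"
    using order_unit_group[OF m0] totient_prod_p[OF Q(1)] by (simp add: last_factor k_def power_add)
  have copJ: "coprime (p i) (2 ^ (k + x))" "coprime (p i) s" if "i \<in> {1..l}" for i
    using coprime_two[OF that] coprime_last[OF that] last by (simp_all only: coprime_mult_right_iff)
  have copJ2: "coprime (2 ^ (k + x)) (prod p ?J)" "coprime s (prod p ?J)"
    using copJ J by (auto intro!: prod_coprime_right simp only: coprime_commute[of _ "p _"])
  have card2: "card (U.torsion (2 ^ (k + x))) = 2 ^ (k + x)"
    by (rule U.card_torsion[OF ord]) (use cops copJ2(1) in \<open>simp only: coprime_mult_right_iff\<close>)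
  have cards: "card (U.torsion s) = s"
  proof (rule U.card_torsion)
    show "order (unit_group ?m) = s * (2 ^ (k + x) * prod p ?J)" by (simp add: ord)
    show "coprime s (2 ^ (k + x) * prod p ?J)"
      unfolding coprime_mult_right_iff using cops[THEN coprime_commute[THEN iffD1]] copJ2(2) by blast
  qed
  obtain g where g: "residue_primroot (p l) g"
    using prime_primitive_root_exists[OF prime_gt_1_nat[OF prime[OF ll]] prime[OF ll]] by blast
  have ordg: "[g ^ j = 1] (mod p l) \<longleftrightarrow> p l - 1 dvd j" for j
    using g totient_prime[OF prime[OF ll]] unfolding ord_divides by (simp add: residue_primroot_def)
  have copg: "coprime (int g) (int (p l))" using g by (simp add: residue_primroot_def coprime_commute)
  have copm: "coprime (int (p l)) (int (prod p ?Q))"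
    unfolding coprime_int_iff using coprime_prod_p[of "{l}" ?Q] ll Q' by simp
  obtain y where y: "[y = int g] (mod int (p l))" "[y = 1] (mod int (prod p ?Q))"
    using binary_chinese_remainder_int[OF copm] by blast
  define c where "c = y mod int ?m"
  have modm: "[a mod int ?m = a] (mod int (p l))" "[a mod int ?m = a] (mod int (prod p ?Q))" for a
    by (simp_all add: m cong_def mod_mod_cancel)
  have cl: "[c = int g] (mod int (p l))" and c1: "[c = 1] (mod int (prod p ?Q))"
    using modm y cong_trans unfolding c_def by blast+
  have "coprime c (int (p l))" using cong_imp_coprime[OF cong_sym[OF cl] copg] .
  moreover have "coprime c (int (prod p ?Q))" using cong_imp_coprime[OF cong_sym[OF c1]] by simp
  ultimately have "coprime c (int (p l) * int (prod p ?Q))" by (simp only: coprime_mult_right_iff)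
  then have "coprime c (int ?m)" by (simp only: m of_nat_mult)
  moreover have "c \<in> {0..<int ?m}"
    unfolding c_def atLeastLessThan_iff using m0 by (simp only: pos_mod_sign pos_mod_bound of_nat_0_less_iff simp_thms)
  ultimately have cc: "c \<in> carrier (unit_group ?m)" unfolding unit_group_simps(1) by blast
  have cpow: "[c ^ j = int g ^ j] (mod int (p l))" "[c ^ j = 1] (mod int (prod p ?Q))" for j
    using cong_pow[OF cl, of j] cong_pow[OF c1, of j] by simp_all
  have "U.ord c dvd j \<longleftrightarrow> p l - 1 dvd j" for j
  proof -
    have "U.ord c dvd j \<longleftrightarrow> [c ^ j = 1] (mod int ?m)"
      using mem_torsion_unit_group[OF m0 cc] U.mem_torsion_iff cc by blast
    also have "\<dots> \<longleftrightarrow> [c ^ j = 1] (mod int (p l))"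
    proof
      show "[c ^ j = 1] (mod int (p l))" if "[c ^ j = 1] (mod int ?m)"
        using that cong_dvd_modulus[of "c ^ j" 1 "int ?m" "int (p l)"] by (simp add: m)
      show "[c ^ j = 1] (mod int ?m)" if "[c ^ j = 1] (mod int (p l))"
        unfolding m of_nat_mult using coprime_cong_mult[OF that cpow(2) copm] .
    qed
    also have "\<dots> \<longleftrightarrow> [int (g ^ j) = int 1] (mod int (p l))"
      using cpow(1)[of j] cong_trans cong_sym by (metis of_nat_1 of_nat_power)
    also have "\<dots> \<longleftrightarrow> p l - 1 dvd j" unfolding cong_int_iff by (rule ordg)
    finally show ?thesis .
  qed
  then have ordc: "U.ord c = 2 ^ x * s" unfolding last by (metis dvd_antisym dvd_refl)
  let ?c2 = "c [^]\<^bsub>unit_group ?m\<^esub> s" and ?cs = "c [^]\<^bsub>unit_group ?m\<^esub> ((2::nat) ^ x)"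
  have c2: "?c2 \<in> carrier (unit_group ?m)" "U.ord ?c2 = 2 ^ x"
    using U.ord_pow[OF cc, of s] s0 cc by (simp_all add: ordc)
  have cs: "?cs \<in> carrier (unit_group ?m)" "U.ord ?cs = s"
    using U.ord_pow[OF cc, of "2 ^ x"] cc by (simp_all add: ordc)
  have odd_part: "card (U.subgroups_in (U.torsion s)) = num_divisors s"
    unfolding num_divisors_def by (rule U.card_subgroups_cyclic[OF cards s0 cs])
  let ?L = "{a \<in> carrier (unit_group ?m). [a = 1] (mod int (p l))}"
  let ?R = "{a \<in> carrier (unit_group ?m). [a = 1] (mod int (prod p ?Q))}"
  let ?C = "generate (unit_group ?m) {?c2}"
  define V where "V = U.torsion (2 ^ (k + x)) \<inter> ?L"
  have L: "subgroup ?L (unit_group ?m)" by (rule subgroup_cong_one[OF m0]) (simp only: m dvd_triv_left)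
  have R: "subgroup ?R (unit_group ?m)" by (rule subgroup_cong_one[OF m0]) (simp only: m dvd_triv_right)
  have V: "subgroup V (unit_group ?m)" unfolding V_def by (rule U.subgroups_Inter_pair[OF U.torsion_subgroup L])
  have C: "subgroup ?C (unit_group ?m)" by (rule U.generate_is_subgroup) (use c2 in blast)
  have V2: "V \<subseteq> U.torsion 2"
  proof
    fix a assume a: "a \<in> V"
    then have ac: "a \<in> carrier (unit_group ?m)" and al: "[a = 1] (mod int (p l))" and at: "a \<in> U.torsion (2 ^ (k + x))"
      by (simp_all add: V_def)
    have pow: "[a ^ 2 ^ (k + x) = 1] (mod int ?m)" using at mem_torsion_unit_group[OF m0 ac] by blast
    have "[a\<^sup>2 = 1] (mod int (p i))" if "i \<in> Q" for i
    proof (cases "i = l")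
      case True
      then show ?thesis using cong_pow[OF al, of 2] by simp
    next
      case False
      then show ?thesis using two_power_torsion_square[OF Q(1) that False ac pow] by blast
    qed
    then have "[a\<^sup>2 = 1] (mod int ?m)" by (intro cong_prod_int) (use coprime_p Q(1) in blast)+
    then show "a \<in> U.torsion 2" using mem_torsion_unit_group[OF m0 ac] by blast
  qed
  have CR: "?C \<subseteq> ?R"
  proof (rule U.generate_subgroup_incl[OF _ R])
    have "c \<in> ?R" using cc c1 by blast
    then show "{?c2} \<subseteq> ?R" using U.subgroup_nat_pow[OF R] by blast
  qed
  have VC: "V \<inter> ?C = {\<one>\<^bsub>unit_group ?m\<^esub>}"
  proof
    show "V \<inter> ?C \<subseteq> {\<one>\<^bsub>unit_group ?m\<^esub>}"
    proof
      fix a assume "a \<in> V \<inter> ?C"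
      then have "[a = 1] (mod int (p l))" "[a = 1] (mod int (prod p ?Q))" "a \<in> carrier (unit_group ?m)"
        using CR by (auto simp: V_def)
      then have "[a = 1] (mod int ?m)" "a \<in> {0..<int ?m}"
        using coprime_cong_mult[OF _ _ copm] by (simp_all add: m unit_group_simps)
      then show "a \<in> {\<one>\<^bsub>unit_group ?m\<^esub>}" by (simp add: unit_group_simps cong_def)
    qed
    show "{\<one>\<^bsub>unit_group ?m\<^esub>} \<subseteq> V \<inter> ?C"
      using subgroup.one_closed[OF V] subgroup.one_closed[OF C] by blast
  qed
  have C2: "?C \<subseteq> U.torsion (2 ^ (k + x))"
  proof (rule U.generate_subgroup_incl[OF _ U.torsion_subgroup])
    show "{?c2} \<subseteq> U.torsion (2 ^ (k + x))" using c2 by (simp add: U.mem_torsion_iff le_imp_power_dvd)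
  qed
  have prod: "U.torsion (2 ^ (k + x)) = V <#>\<^bsub>unit_group ?m\<^esub> ?C"
  proof
    show "V <#>\<^bsub>unit_group ?m\<^esub> ?C \<subseteq> U.torsion (2 ^ (k + x))"
      using subgroup.m_closed[OF U.torsion_subgroup] C2 by (auto simp: set_mult_def V_def)
    show "U.torsion (2 ^ (k + x)) \<subseteq> V <#>\<^bsub>unit_group ?m\<^esub> ?C"
    proof
      fix w assume w: "w \<in> U.torsion (2 ^ (k + x))"
      then have wc: "w \<in> carrier (unit_group ?m)" by (simp add: U.torsion_def)
      have wpow: "[w ^ 2 ^ (k + x) = 1] (mod int (p l))"
        using w mem_torsion_unit_group[OF m0 wc] cong_dvd_modulus[of _ 1 "int ?m" "int (p l)"] by (simp add: m)
      have pl1: "p l > 1" using prime[OF ll] prime_gt_1_nat by blast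
      have "coprime w (int (p l))" using wc by (simp add: unit_group_simps m)
      then have "coprime (w mod int (p l)) (int (p l))" using cong_imp_coprime[of w "w mod int (p l)"]
        by (simp add: cong_def)
      moreover define v where "v = nat (w mod int (p l))"
      moreover have iv: "int v = w mod int (p l)" using pl1 by (simp add: v_def)
      ultimately have "coprime v (p l)" by (metis coprime_int_iff)
      moreover have "v < p l" using iv pl1
        by (metis of_nat_less_iff pos_mod_bound of_nat_0_less_iff less_trans zero_less_one)
      moreover have "v > 0" using \<open>coprime v (p l)\<close> pl1 by (cases "v = 0") auto
      ultimately have "v \<in> totatives (p l)" by (simp add: totatives_def)
      \<comment> \<open>\<open>w\<close> agrees modulo \<open>p l\<close> with a power of \<open>c\<close>, and the exponent is a multiple of \<open>s\<close> because \<open>w\<close> has 2-power order\<close>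
      then obtain j where j: "v = g ^ j mod p l"
        using residue_primroot_is_generator[OF pl1 g] by (auto simp: bij_betw_def)
      have wj: "[w = int g ^ j] (mod int (p l))"
        using iv unfolding j by (simp add: cong_def zmod_int)
      have "[int (g ^ (j * 2 ^ (k + x))) = int 1] (mod int (p l))"
        using cong_pow[OF cong_sym[OF wj], of "2 ^ (k + x)"] wpow cong_trans by (simp add: power_mult) blast
      then have "p l - 1 dvd j * 2 ^ (k + x)" using ordg unfolding cong_int_iff by blast
      then have "s dvd j * 2 ^ (k + x)" unfolding last using dvd_mult_right by blast
      then have "s dvd j" using cops coprime_commute coprime_dvd_mult_left_iff by blast
      then obtain i where i: "j = s * i" by auto
      let ?z = "?c2 [^]\<^bsub>unit_group ?m\<^esub> i"
      have z: "?z \<in> ?C" using U.subgroup_nat_pow[OF C] generate.incl[of ?c2 "{?c2}" "unit_group ?m"] by blast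
      have zc: "?z \<in> carrier (unit_group ?m)" using c2(1) by simp
      have "?z = c ^ j mod int ?m" unfolding unit_group_pow i power_mult by (rule power_mod)
      then have zw: "[?z = w] (mod int (p l))" using modm(1) cpow(1) wj cong_trans cong_sym by metis
      let ?v = "w \<otimes>\<^bsub>unit_group ?m\<^esub> inv\<^bsub>unit_group ?m\<^esub> ?z"
      have vt: "?v \<in> U.torsion (2 ^ (k + x))"
        using U.torsion_subgroup w z C2 by (meson subgroup.m_closed subgroup.m_inv_closed subsetD)
      then have vc: "?v \<in> carrier (unit_group ?m)" by (simp add: U.torsion_def)
      have vz: "w = ?v \<otimes>\<^bsub>unit_group ?m\<^esub> ?z" using wc zc by (simp add: U.m_assoc)
      then have "[w = ?v * ?z] (mod int (p l))" using modm(1) unfolding unit_group_simps(2) by metis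
      then have "[?v * ?z = ?z] (mod int (p l))" by (rule cong_trans[OF cong_sym cong_sym[OF zw]])
      then have "[?v * ?z = 1 * ?z] (mod int (p l))" by (simp only: mult_1)
      moreover have "coprime ?z (int (p l))" using zc by (simp add: unit_group_simps(1) m)
      ultimately have "[?v = 1] (mod int (p l))" using cong_mult_rcancel by blast
      then have "?v \<in> V" using vt vc by (simp add: V_def)
      then show "w \<in> V <#>\<^bsub>unit_group ?m\<^esub> ?C" using vz z unfolding set_mult_def by blast
    qed
  qed
  have "card V * 2 ^ x = 2 ^ k * 2 ^ x"
    using U.card_set_mult[OF V C VC] card2 U.generate_pow_card[OF c2(1)] by (simp add: prod[symmetric] c2(2) power_add)
  then have cardV: "card V = 2 ^ k" by simp
  have "card (U.subgroups_in (U.torsion (2 ^ k * last_factor Q)))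
      = card (U.subgroups_in (V <#>\<^bsub>unit_group ?m\<^esub> ?C)) * num_divisors s"
    using U.card_subgroups_split[OF cops[of "k + x"]] odd_part prod by (simp add: last_factor power_add mult.assoc)
  then show ?thesis
    using U.card_subgroups_elementary_times_cyclic_gauss2[OF V V2 cardV c2 VC] by simp
qed

theorem card_datum_pairs_eq_formula: "of_nat (card (datum_pairs (prod p {1..l}))) = type_count_formula l x s"
proof -
  have fin: "finite (index_sets l)" by (rule finite_subset[of _ "Pow {2..l}"]) (auto simp: index_sets_def)
  have sub: "index_sets l \<subseteq> Pow {1..l}" by (force simp: index_sets_def)
  have with_last: "rat_of_nat (fibre_card D) = 2 ^ (l - 2 * card D) *
      (\<Sum>k=0..l - card D. \<Prod>i=1..k. (2 ^ (l - card D - (i - 1)) - 1) / (2 ^ i - 1))"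
    if D: "D \<in> index_sets l" "l \<in> D" for D
  proof -
    let ?Q = "{1..l} - D"
    have Q: "?Q \<subseteq> {1..l}" "l \<notin> ?Q" using D(2) by auto
    have Ql: "?Q - {l} = ?Q" using Q(2) by blast
    have DP: "D \<subseteq> {1..l}" using sub D(1) by blast
    have card: "card ?Q = l - card D" using card_Diff_subset[OF finite_subset[OF DP] DP] by simp
    show ?thesis
      using fibre_card_eq[OF D(1)] card_subgroups_torsion_without_last[OF Q]
      unfolding Ql card by (simp add: gauss2_def mult_2 diff_diff_left)
  qed
  have without_last: "rat_of_nat (fibre_card D) =
      2 ^ (l - 1 - 2 * card D) * Sigma_coeff x (l - card D) * of_nat (num_divisors s)"
    if D: "D \<in> index_sets l" "l \<notin> D" for D
  proof -
    let ?Q = "{1..l} - D" and ?k = "l - card D - 1"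
    have Q: "?Q \<subseteq> {1..l}" "l \<in> ?Q" using D(2) l by auto
    have DP: "D \<subseteq> {1..l}" using sub D(1) by blast
    have "card ?Q = l - card D" using card_Diff_subset[OF finite_subset[OF DP] DP] by simp
    then have card: "card (?Q - {l}) = ?k" using Q(2) by simp
    have "Sigma_coeff x (l - card D) = (\<Sum>t=0..?k. (2 ^ (?k - t) * of_nat x + 1) * gauss2 ?k t)"
      unfolding Sigma_coeff_def gauss2_def
    proof (rule sum.cong[OF refl])
      fix t
      have "(\<Prod>i=1..t. (2 ^ (l - card D - i) - 1) / (2 ^ i - 1)) = (\<Prod>i=1..t. (2 ^ (?k - (i - 1)) - 1) / (2 ^ i - 1 :: rat))"
      proof (rule prod.cong[OF refl])
        fix i assume "i \<in> {1..t}"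
        then have "l - card D - i = ?k - (i - 1)" by auto
        then show "(2 ^ (l - card D - i) - 1) / (2 ^ i - 1 :: rat) = (2 ^ (?k - (i - 1)) - 1) / (2 ^ i - 1)" by simp
      qed
      then show "(2 ^ (l - card D - (t + 1)) * of_nat x + 1) * (\<Prod>i=1..t. (2 ^ (l - card D - i) - 1) / (2 ^ i - 1))
          = (2 ^ (?k - t) * of_nat x + 1) * (\<Prod>i=1..t. (2 ^ (?k - (i - 1)) - 1) / (2 ^ i - 1 :: rat))" by simp
    qed
    moreover have "?k - card D = l - 1 - 2 * card D" by simp
    ultimately show ?thesis
      using fibre_card_eq[OF D(1)] card_subgroups_torsion_with_last[OF Q] unfolding card by simp
  qed
  have "card (datum_pairs (prod p {1..l})) = (\<Sum>D\<in>index_sets l. fibre_card D)"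
    unfolding card_datum_pairs
    by (rule sum.mono_neutral_right) (use sub fibre_card_eq_0 in auto)
  also have "index_sets l = {I \<in> index_sets l. l \<in> I} \<union> {I \<in> index_sets l. l \<notin> I}" by blast
  also have "sum fibre_card \<dots> = (\<Sum>D\<in>{I \<in> index_sets l. l \<in> I}. fibre_card D) + (\<Sum>D\<in>{I \<in> index_sets l. l \<notin> I}. fibre_card D)"
    by (rule sum.union_disjoint) (use fin in auto)
  finally have "rat_of_nat (card (datum_pairs (prod p {1..l})))
      = (\<Sum>D\<in>{I \<in> index_sets l. l \<in> I}. of_nat (fibre_card D)) + (\<Sum>D\<in>{I \<in> index_sets l. l \<notin> I}. of_nat (fibre_card D))"
    by simp
  then show ?thesis unfolding type_count_formula_def using with_last without_last by simp
qed

end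

theorem theorem3p14:
  fixes l n x s :: nat and p :: "nat \<Rightarrow> nat"
  assumes "infinite (UNIV :: 'u set)"
    and "l \<ge> 1"
    and "\<And>i. i \<in> {1..l} \<Longrightarrow> Factorial_Ring.prime (p i) \<and> odd (p i)"
    and "\<And>i j. 1 \<le> i \<Longrightarrow> i < j \<Longrightarrow> j \<le> l \<Longrightarrow> p i > p j"
    and "\<And>i. 1 \<le> i \<Longrightarrow> i < l \<Longrightarrow> p i = 2 * p (i + 1) + 1"
    and "n = (\<Prod>i=1..l. p i)"
    and "p l - 1 = 2 ^ x * s" and "odd s"
  shows "of_nat (num_realised_types TYPE('u) n (integer_mod_group n)) = type_count_formula l x s"
proof -
  interpret safe_prime_chain p l x s by unfold_locales (use assms in auto)
  have "num_realised_types TYPE('u) n (integer_mod_group n) = card (datum_pairs n)"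
    unfolding assms(6)
    by (rule num_realised_types_eq_card_pairs[OF assms(1) pos_prod_p[OF order_refl] squarefree_prod_p coprime_cofactor])
  then show ?thesis using card_datum_pairs_eq_formula assms(6) by simp
qed

end
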